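(* Let $Q\subseteq\mathbb{R}^m$ be a nonempty closed set, let $g_1,\ldots,g_s\in\mathbb{R}[\mathrm{x},\mathrm{y}]$, $g_0:=1$, and let $K=\{x\in\mathbb{R}^n : g_1(x,y)\ge 0,\ldots,g_s(x,y)\ge 0\ \ \forall y\in Q\}$. Let $\nu$ be a nonnegative Borel measure on $\mathbb{R}^m$ with $\operatorname{supp}(\nu)=Q$ satisfying the multivariate Carleman condition. Let $w=(w_\alpha)_{\alpha\in\mathbb{N}^n_{2d}}\in\mathbb{R}^{\mathbb{N}^n_{2d}}$ be a truncated multisequence of degree $2d$ such that for all $j=0,1,\ldots,s$, $$\mathrm{L}^{(k,l)}_{\nu,g_j}[w]\succeq 0,\qquad k=1,2,\ldots,d,\quad l=1,2,\ldots.$$ Let $d_g:=\max\{1,\deg_{\mathrm{x}}(g)\}$. If there exists a positive integer $k\le d-d_g$ such that $$r:=\operatorname{rank}\mathrm{H}^{(k)}[w]=\operatorname{rank}\mathrm{H}^{(d)}[w],$$ then $w$ admits an $r$-atomic representing measure $\mu$ supported in $K$, and $\mu$ is the unique representing measure for $w$.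
   Context: Here $\mathrm{x}=(\mathrm{x}_1,\ldots,\mathrm{x}_n)$ and $\mathrm{y}=(\mathrm{y}_1,\ldots,\mathrm{y}_m)$ are tuples of variables; $\mathbb{N}$ is the set of nonnegative integers and $\mathbb{N}^n_d=\{\alpha\in\mathbb{N}^n:\alpha_1+\cdots+\alpha_n\le d\}$. All measures are finite, and $\nu$ has finite moments of all orders. The measure $\nu$ satisfies the multivariate Carleman condition if $\sum_{d=1}^\infty\big(\int y_j^{2d}\,d\nu(y)\big)^{-\frac{1}{2d}}=\infty$ for $j=1,\ldots,m$ (a term with zero moment is read as $+\infty$). $\deg_{\mathrm{x}}(g)$ is the maximum of the degrees in $\mathrm{x}$ of the $g_j$. A representing measure for $w$ is a nonnegative Borel measure $\mu$ on $\mathbb{R}^n$ with $w_\alpha=\int x^\alpha\,d\mu(x)$ for all $\alpha\in\mathbb{N}^n_{2d}$; it is supported in $K$ if $\operatorname{supp}(\mu)\subseteq K$, and $r$-atomic if its support consists of exactly $r$ points. The Riesz functional $\mathscr{R}_w$ is the linear functional on polynomials of degree at most $2d$ with $\mathscr{R}_w(\mathrm{x}^\alpha)=w_\alpha$. The moment matrix is $\mathrm{H}^{(k)}[w]=(w_{\alpha+\beta})_{\alpha,\beta\in\mathbb{N}^n_k}$. Localizing matrices: let $k'=k-\lceil\deg_{\mathrm{x}}(g_j)/2\rceil$ and $l'=l-\lceil\deg_{\mathrm{y}}(g_j)/2\rceil$. $\mathrm{L}^{(k,l)}_{\nu,g_j}[w]$ is the symmetric matrix such that $$\mathscr{R}_w\Big(\int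 p(\mathrm{x},y)^2g_j(\mathrm{x},y)\,d\nu(y)\Big)=\mathbf{p}^T\,\mathrm{L}^{(k,l)}_{\nu,g_j}[w]\,\mathbf{p}$$ for all $p\in\mathbb{R}[\mathrm{x},\mathrm{y}]$ with $\deg_{\mathrm{x}}(p)\le k'$, $\deg_{\mathrm{y}}(p)\le l'$, where $\mathbf{p}$ is the coefficient vector of $p$ in the basis $[\mathrm{x}]_{k'}\otimes[\mathrm{y}]_{l'}$, and $[\cdot]_d$ denotes the vector of all monomials of degree at most $d$. If $k'<0$ or $l'<0$, the matrix is empty and the condition is vacuous. $W\succeq0$ means $W$ is positive semidefinite. *)

theory Defs
  imports "HOL-Analysis.Analysis" "HOL-Analysis.Finite_Function_Topology"
begin

text \<open>
  A multi-index over the variables \<open>'n\<close> is a term of type \<^typ>\<open>'n \<Rightarrow>\<^sub>0 nat\<close>. Polynomials are finitely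
  supported coefficient families, with the convolution product of \<^typ>\<open>'a \<Rightarrow>\<^sub>0 'b\<close>; a polynomial in
  \<open>(x, y)\<close> is indexed by pairs of multi-indices, so \<open>(\<alpha>, \<beta>)\<close> stands for the monomial
  \<open>x\<^sup>\<alpha> y\<^sup>\<beta>\<close>.
\<close>

abbreviation (input) lookup :: "('a \<Rightarrow>\<^sub>0 'b::zero) \<Rightarrow> 'a \<Rightarrow> 'b" where
  "lookup \<equiv> Poly_Mapping.lookup"

abbreviation (input) keys :: "('a \<Rightarrow>\<^sub>0 'b::zero) \<Rightarrow> 'a set" where
  "keys \<equiv> Poly_Mapping.keys"

type_synonym 'n multiindex = "'n \<Rightarrow>\<^sub>0 nat"
type_synonym 'n rpoly = "'n multiindex \<Rightarrow>\<^sub>0 real"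
type_synonym ('n, 'm) rpoly2 = "('n multiindex \<times> 'm multiindex) \<Rightarrow>\<^sub>0 real"

definition mdeg :: "'n::finite multiindex \<Rightarrow> nat" where
  "mdeg \<alpha> = (\<Sum>i\<in>UNIV. lookup \<alpha> i)"

definition mpow :: "real ^ 'n::finite \<Rightarrow> 'n multiindex \<Rightarrow> real" where
  "mpow x \<alpha> = (\<Prod>i\<in>UNIV. (x $ i) ^ lookup \<alpha> i)"

definition peval :: "'n::finite rpoly \<Rightarrow> real ^ 'n \<Rightarrow> real" where
  "peval q x = (\<Sum>\<alpha>\<in>keys q. lookup q \<alpha> * mpow x \<alpha>)"

definition peval2 :: "('n::finite, 'm::finite) rpoly2 \<Rightarrow> real ^ 'n \<Rightarrow> real ^ 'm \<Rightarrow> real" where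
  "peval2 p x y = (\<Sum>(\<alpha>, \<beta>)\<in>keys p. lookup p (\<alpha>, \<beta>) * mpow x \<alpha> * mpow y \<beta>)"

text \<open>The zero polynomial gets degree 0.\<close>

definition deg_x :: "('n::finite, 'm::finite) rpoly2 \<Rightarrow> nat" where
  "deg_x p = Max (insert 0 ((\<lambda>(\<alpha>, \<beta>). mdeg \<alpha>) ` keys p))"

definition deg_y :: "('n::finite, 'm::finite) rpoly2 \<Rightarrow> nat" where
  "deg_y p = Max (insert 0 ((\<lambda>(\<alpha>, \<beta>). mdeg \<beta>) ` keys p))"

definition supp :: "'a::topological_space measure \<Rightarrow> 'a set" where
  "supp \<mu> = {x. \<forall>U. open U \<longrightarrow> x \<in> U \<longrightarrow> emeasure \<mu> U > 0}"

definition finite_moments :: "(real ^ 'm::finite) measure \<Rightarrow> bool" where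
  "finite_moments \<nu> \<longleftrightarrow> (\<forall>\<beta>. integrable \<nu> (\<lambda>y. mpow y \<beta>))"

definition carleman_term :: "(real ^ 'm::finite) measure \<Rightarrow> 'm \<Rightarrow> nat \<Rightarrow> ennreal" where
  "carleman_term \<nu> j d =
     (let M = (\<integral>y. (y $ j) ^ (2 * d) \<partial>\<nu>)
      in if M = 0 then \<infinity> else ennreal (M powr (- 1 / (2 * real d))))"

definition carleman :: "(real ^ 'm::finite) measure \<Rightarrow> bool" where
  "carleman \<nu> \<longleftrightarrow> (\<forall>j. suminf (\<lambda>d. carleman_term \<nu> j (Suc d)) = \<infinity>)"

text \<open>
  A truncated multisequence of degree \<open>2d\<close> is represented by a function on all multi-indices of
  which only the values at multi-indices of degree at most \<open>2d\<close> matter.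
\<close>

type_synonym 'n multiseq = "'n multiindex \<Rightarrow> real"

definition representing_measure ::
    "nat \<Rightarrow> 'n::finite multiseq \<Rightarrow> (real ^ 'n) measure \<Rightarrow> bool" where
  "representing_measure d w \<mu> \<longleftrightarrow>
     sets \<mu> = sets borel \<and> finite_measure \<mu> \<and>
     (\<forall>\<alpha>. mdeg \<alpha> \<le> 2 * d \<longrightarrow>
        integrable \<mu> (\<lambda>x. mpow x \<alpha>) \<and> w \<alpha> = (\<integral>x. mpow x \<alpha> \<partial>\<mu>))"

definition atomic :: "nat \<Rightarrow> 'a::topological_space measure \<Rightarrow> bool" where
  "atomic r \<mu> \<longleftrightarrow> finite (supp \<mu>) \<and> card (supp \<mu>) = r"

definition riesz :: "'n::finite multiseq \<Rightarrow> 'n rpoly \<Rightarrow> real" where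
  "riesz w q = (\<Sum>\<alpha>\<in>keys q. lookup q \<alpha> * w \<alpha>)"

text \<open>
  The polynomial \<open>\<integral> q(x, y) d\<nu>(y)\<close> in \<open>x\<close>: each coefficient of \<open>q\<close>, seen as a polynomial in
  \<open>x\<close> with coefficients in \<open>\<real>[y]\<close>, is integrated; see \<open>peval_y_integral\<close> below.
\<close>

definition y_integral ::
    "(real ^ 'm::finite) measure \<Rightarrow> ('n::finite, 'm) rpoly2 \<Rightarrow> 'n rpoly" where
  "y_integral \<nu> q =
     (\<Sum>\<alpha>\<in>fst ` keys q.
        Poly_Mapping.single \<alpha> (\<integral>y. (\<Sum>\<beta>\<in>snd ` keys q. lookup q (\<alpha>, \<beta>) * mpow y \<beta>) \<partial>\<nu>))"

text \<open>
  A matrix with rows and columns indexed by a finite set \<open>I\<close> is a function of two arguments,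
  considered on \<open>I \<times> I\<close> only.
\<close>

definition quad_form :: "'i set \<Rightarrow> ('i \<Rightarrow> 'i \<Rightarrow> real) \<Rightarrow> ('i \<Rightarrow> real) \<Rightarrow> real" where
  "quad_form I M v = (\<Sum>a\<in>I. \<Sum>b\<in>I. v a * M a b * v b)"

definition pos_semidef :: "'i set \<Rightarrow> ('i \<Rightarrow> 'i \<Rightarrow> real) \<Rightarrow> bool" where
  "pos_semidef I M \<longleftrightarrow> (\<forall>a\<in>I. \<forall>b\<in>I. M a b = M b a) \<and> (\<forall>v. 0 \<le> quad_form I M v)"

definition mat_col :: "'i set \<Rightarrow> ('i \<Rightarrow> 'i \<Rightarrow> real) \<Rightarrow> 'i \<Rightarrow> ('i \<Rightarrow>\<^sub>0 real)" where
  "mat_col I M b = (\<Sum>a\<in>I. Poly_Mapping.single a (M a b))"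

definition mat_rank :: "'i set \<Rightarrow> ('i \<Rightarrow> 'i \<Rightarrow> real) \<Rightarrow> nat" where
  "mat_rank I M = dim (mat_col I M ` I)"

definition multiindices :: "nat \<Rightarrow> 'n::finite multiindex set" where
  "multiindices k = {\<alpha>. mdeg \<alpha> \<le> k}"

definition moment_matrix :: "'n::finite multiseq \<Rightarrow> 'n multiindex \<Rightarrow> 'n multiindex \<Rightarrow> real" where
  "moment_matrix w = (\<lambda>\<alpha> \<beta>. w (\<alpha> + \<beta>))"

definition moment_matrix_rank :: "'n::finite multiseq \<Rightarrow> nat \<Rightarrow> nat" where
  "moment_matrix_rank w k = mat_rank (multiindices k) (moment_matrix w)"

definition loc_order :: "nat \<Rightarrow> nat \<Rightarrow> int" where
  "loc_order k e = int k - \<lceil>real e / 2\<rceil>"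

text \<open>The index set of the localizing matrix; it is empty if one of the two orders is negative.\<close>

definition loc_index ::
    "('n::finite, 'm::finite) rpoly2 \<Rightarrow> nat \<Rightarrow> nat \<Rightarrow> ('n multiindex \<times> 'm multiindex) set" where
  "loc_index g k l =
     {(\<alpha>, \<beta>). int (mdeg \<alpha>) \<le> loc_order k (deg_x g) \<and> int (mdeg \<beta>) \<le> loc_order l (deg_y g)}"

definition is_localizing_matrix ::
    "(real ^ 'm::finite) measure \<Rightarrow> ('n::finite, 'm) rpoly2 \<Rightarrow> 'n multiseq \<Rightarrow> nat \<Rightarrow> nat \<Rightarrow>
     ('n multiindex \<times> 'm multiindex \<Rightarrow> 'n multiindex \<times> 'm multiindex \<Rightarrow> real) \<Rightarrow> bool" where
  "is_localizing_matrix \<nu> g w k l L \<longleftrightarrow>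
     (\<forall>a b. L a b = L b a) \<and>
     (\<forall>a b. a \<notin> loc_index g k l \<longrightarrow> L a b = 0) \<and>
     (\<forall>p :: ('n, 'm) rpoly2.
        int (deg_x p) \<le> loc_order k (deg_x g) \<longrightarrow> int (deg_y p) \<le> loc_order l (deg_y g) \<longrightarrow>
        riesz w (y_integral \<nu> (p ^ 2 * g)) = quad_form (loc_index g k l) L (lookup p))"

text \<open>
  The matrix is determined uniquely if \<open>\<nu>\<close> has finite moments, because it is normalized to 0 outside
  its index set; see \<open>is_localizing_matrix_iff\<close> and \<open>localizing_matrix_entry\<close> below.
\<close>

definition localizing_matrix ::
    "(real ^ 'm::finite) measure \<Rightarrow> ('n::finite, 'm) rpoly2 \<Rightarrow> 'n multiseq \<Rightarrow> nat \<Rightarrow> nat \<Rightarrow>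
     'n multiindex \<times> 'm multiindex \<Rightarrow> 'n multiindex \<times> 'm multiindex \<Rightarrow> real" where
  "localizing_matrix \<nu> g w k l = (THE L. is_localizing_matrix \<nu> g w k l L)"

definition localizing_psd ::
    "(real ^ 'm::finite) measure \<Rightarrow> ('n::finite, 'm) rpoly2 \<Rightarrow> 'n multiseq \<Rightarrow> nat \<Rightarrow> nat \<Rightarrow> bool" where
  "localizing_psd \<nu> g w k l \<longleftrightarrow> pos_semidef (loc_index g k l) (localizing_matrix \<nu> g w k l)"

lemma finite_multiindices: "finite (multiindices k :: 'n::finite multiindex set)"
proof (rule finite_imageD)
  have "lookup ` (multiindices k :: 'n multiindex set) \<subseteq> (\<Pi>\<^sub>E i\<in>UNIV. {..k})"
  proof
    fix f :: "'n \<Rightarrow> nat" assume "f \<in> lookup ` (multiindices k :: 'n multiindex set)"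
    then obtain \<alpha> :: "'n multiindex" where f: "f = lookup \<alpha>" and "mdeg \<alpha> \<le> k"
      by (auto simp: multiindices_def)
    moreover have "lookup \<alpha> i \<le> mdeg \<alpha>" for i
      unfolding mdeg_def by (rule member_le_sum) auto
    ultimately have "\<And>i. f i \<le> k" using le_trans by metis
    then show "f \<in> (\<Pi>\<^sub>E i\<in>UNIV. {..k})" by auto
  qed
  then show "finite (lookup ` (multiindices k :: 'n multiindex set))"
    by (rule finite_subset) (auto intro!: finite_PiE)
  show "inj_on lookup (multiindices k)"
    by (auto intro!: inj_onI poly_mapping_eqI)
qed

lemma finite_loc_index:
  fixes g :: "('n::finite, 'm::finite) rpoly2"
  shows "finite (loc_index g k l)"
proof (rule finite_subset)
  show "loc_index g k l \<subseteq> multiindices (nat (loc_order k (deg_x g)))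
          \<times> multiindices (nat (loc_order l (deg_y g)))"
    unfolding loc_index_def multiindices_def by auto
qed (auto intro: finite_multiindices)

lemma deg_x_le_iff: "deg_x p \<le> k \<longleftrightarrow> (\<forall>(\<alpha>, \<beta>)\<in>keys p. mdeg \<alpha> \<le> k)"
  unfolding deg_x_def by (subst Max_le_iff) auto

lemma deg_y_le_iff: "deg_y p \<le> k \<longleftrightarrow> (\<forall>(\<alpha>, \<beta>)\<in>keys p. mdeg \<beta> \<le> k)"
  unfolding deg_y_def by (subst Max_le_iff) auto

lemma keys_subset_loc_index:
  assumes "int (deg_x p) \<le> loc_order k (deg_x g)" "int (deg_y p) \<le> loc_order l (deg_y g)"
  shows "keys p \<subseteq> loc_index g k l"
proof
  fix a assume "a \<in> keys p"
  then have "mdeg (fst a) \<le> deg_x p" "mdeg (snd a) \<le> deg_y p"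
    using deg_x_le_iff[of p "deg_x p"] deg_y_le_iff[of p "deg_y p"] by fastforce+
  then show "a \<in> loc_index g k l"
    using assms unfolding loc_index_def by (cases a) auto
qed

lemma keys_loc_index_deg:
  assumes "keys p \<subseteq> loc_index g k l" "c \<in> loc_index g k l"
  shows "int (deg_x p) \<le> loc_order k (deg_x g)" "int (deg_y p) \<le> loc_order l (deg_y g)"
proof -
  have nn: "0 \<le> loc_order k (deg_x g)" "0 \<le> loc_order l (deg_y g)"
    using assms(2) unfolding loc_index_def by auto
  have "deg_x p \<le> nat (loc_order k (deg_x g))"
    unfolding deg_x_le_iff using assms(1) unfolding loc_index_def by auto
  then show "int (deg_x p) \<le> loc_order k (deg_x g)" using nn by auto
  have "deg_y p \<le> nat (loc_order l (deg_y g))"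
    unfolding deg_y_le_iff using assms(1) unfolding loc_index_def by auto
  then show "int (deg_y p) \<le> loc_order l (deg_y g)" using nn by auto
qed

lemma lookup_y_integral:
  assumes "finite_moments \<nu>"
  shows "lookup (y_integral \<nu> q) \<alpha> =
    (\<Sum>\<beta>\<in>snd ` keys q. lookup q (\<alpha>, \<beta>) * (\<integral>y. mpow y \<beta> \<partial>\<nu>))"
proof -
  have "(\<integral>y. (\<Sum>\<beta>\<in>snd ` keys q. lookup q (\<alpha>, \<beta>) * mpow y \<beta>) \<partial>\<nu>) =
      (\<Sum>\<beta>\<in>snd ` keys q. lookup q (\<alpha>, \<beta>) * (\<integral>y. mpow y \<beta> \<partial>\<nu>))"
    using assms unfolding finite_moments_def by (subst Bochner_Integration.integral_sum) auto
  moreover have "lookup q (\<alpha>, \<beta>) = 0" if "\<alpha> \<notin> fst ` keys q" for \<beta>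
    using that by (metis fst_conv image_eqI in_keys_iff)
  ultimately show ?thesis
    unfolding y_integral_def lookup_sum lookup_single when_def
    by (cases "\<alpha> \<in> fst ` keys q") auto
qed

lemma sum_keys_y_integral:
  assumes "finite_moments \<nu>"
  shows "(\<Sum>\<alpha>\<in>keys (y_integral \<nu> q). lookup (y_integral \<nu> q) \<alpha> * f \<alpha>) =
    (\<Sum>(\<alpha>, \<beta>)\<in>keys q. lookup q (\<alpha>, \<beta>) * f \<alpha> * (\<integral>y. mpow y \<beta> \<partial>\<nu>))"
proof -
  let ?A = "fst ` keys q" and ?B = "snd ` keys q"
  have sub: "keys (y_integral \<nu> q) \<subseteq> ?A"
  proof
    fix \<alpha> assume "\<alpha> \<in> keys (y_integral \<nu> q)"
    then have "lookup (y_integral \<nu> q) \<alpha> \<noteq> 0" by (simp add: in_keys_iff)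
    then obtain \<beta> where "lookup q (\<alpha>, \<beta>) \<noteq> 0"
      unfolding lookup_y_integral[OF assms]
      by (auto elim!: sum.not_neutral_contains_not_neutral)
    then show "\<alpha> \<in> ?A" by (metis fst_conv image_eqI in_keys_iff)
  qed
  have "(\<Sum>\<alpha>\<in>keys (y_integral \<nu> q). lookup (y_integral \<nu> q) \<alpha> * f \<alpha>) =
      (\<Sum>\<alpha>\<in>?A. lookup (y_integral \<nu> q) \<alpha> * f \<alpha>)"
    by (rule sum.mono_neutral_left) (use sub in \<open>auto simp: in_keys_iff\<close>)
  also have "\<dots> = (\<Sum>(\<alpha>, \<beta>)\<in>?A \<times> ?B. lookup q (\<alpha>, \<beta>) * f \<alpha> * (\<integral>y. mpow y \<beta> \<partial>\<nu>))"
    unfolding lookup_y_integral[OF assms] sum.cartesian_product[symmetric] sum_distrib_right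
    by (simp add: mult_ac)
  also have "\<dots> = (\<Sum>(\<alpha>, \<beta>)\<in>keys q. lookup q (\<alpha>, \<beta>) * f \<alpha> * (\<integral>y. mpow y \<beta> \<partial>\<nu>))"
    by (rule sum.mono_neutral_right) (force simp: in_keys_iff)+
  finally show ?thesis .
qed

lemma peval_y_integral:
  assumes "finite_moments \<nu>"
  shows "peval (y_integral \<nu> q) x = (\<integral>y. peval2 q x y \<partial>\<nu>)"
proof -
  have "(\<integral>y. peval2 q x y \<partial>\<nu>) =
      (\<Sum>(\<alpha>, \<beta>)\<in>keys q. lookup q (\<alpha>, \<beta>) * mpow x \<alpha> * (\<integral>y. mpow y \<beta> \<partial>\<nu>))"
    using assms unfolding peval2_def finite_moments_def case_prod_beta
    by (subst Bochner_Integration.integral_sum) auto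
  then show ?thesis
    unfolding peval_def sum_keys_y_integral[OF assms] by simp
qed

lemma riesz_y_integral_add:
  assumes "finite_moments \<nu>"
  shows "riesz w (y_integral \<nu> (p + q)) = riesz w (y_integral \<nu> p) + riesz w (y_integral \<nu> q)"
  unfolding riesz_def sum_keys_y_integral[OF assms] case_prod_beta prod.collapse
  using setsum_keys_plus_distrib[of
      "\<lambda>a c. c * w (fst a) * (\<integral>y. mpow y (snd a) \<partial>\<nu>)" p q]
  by (simp add: distrib_right)

lemma riesz_y_integral_sum:
  assumes "finite_moments \<nu>"
  shows "riesz w (y_integral \<nu> (\<Sum>i\<in>I. f i)) = (\<Sum>i\<in>I. riesz w (y_integral \<nu> (f i)))"
proof (induction I rule: infinite_finite_induct)
  case (insert i I)
  then show ?case by (simp add: riesz_y_integral_add[OF assms])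
qed (simp_all add: riesz_def y_integral_def)

lemma lookup_single_zero_mult:
  fixes q :: "'a::monoid_add \<Rightarrow>\<^sub>0 real"
  shows "lookup (Poly_Mapping.single 0 c * q) a = c * lookup q a"
  unfolding mult_map_scale_conv_mult[symmetric] by (simp add: Poly_Mapping.map.rep_eq when_def)

lemma riesz_y_integral_scale:
  assumes "finite_moments \<nu>"
  shows "riesz w (y_integral \<nu> (Poly_Mapping.single 0 c * q)) = c * riesz w (y_integral \<nu> q)"
proof -
  have "(\<Sum>(\<alpha>, \<beta>)\<in>keys (Poly_Mapping.single 0 c * q).
          lookup (Poly_Mapping.single 0 c * q) (\<alpha>, \<beta>) * w \<alpha> * (\<integral>y. mpow y \<beta> \<partial>\<nu>)) =
        (\<Sum>(\<alpha>, \<beta>)\<in>keys q.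
          lookup (Poly_Mapping.single 0 c * q) (\<alpha>, \<beta>) * w \<alpha> * (\<integral>y. mpow y \<beta> \<partial>\<nu>))"
    by (rule sum.mono_neutral_left) (auto simp: in_keys_iff lookup_single_zero_mult)
  then show ?thesis
    unfolding riesz_def sum_keys_y_integral[OF assms]
    by (simp add: lookup_single_zero_mult sum_distrib_left case_prod_beta mult.assoc)
qed

lemma sum_single_lookup:
  assumes "finite I" "keys p \<subseteq> I"
  shows "(\<Sum>a\<in>I. Poly_Mapping.single a (lookup p a)) = p"
proof (rule poly_mapping_eqI)
  fix b
  have "b \<notin> I \<Longrightarrow> lookup p b = 0" using assms by (auto simp: in_keys_iff)
  then show "lookup (\<Sum>a\<in>I. Poly_Mapping.single a (lookup p a)) b = lookup p b"
    using assms by (auto simp: lookup_sum lookup_single when_def)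
qed

lemma riesz_y_integral_square:
  assumes fin: "finite_moments \<nu>" and I: "finite I" "keys p \<subseteq> I"
  shows "riesz w (y_integral \<nu> (p ^ 2 * g)) =
    quad_form I (\<lambda>a b. riesz w (y_integral \<nu> (Poly_Mapping.single (a + b) 1 * g))) (lookup p)"
proof -
  let ?s = "\<lambda>a. Poly_Mapping.single a (lookup p a)"
  have "p ^ 2 * g = (\<Sum>a\<in>I. ?s a) * (\<Sum>a\<in>I. ?s a) * g"
    using sum_single_lookup[OF I] by (simp add: power2_eq_square)
  also have "\<dots> = (\<Sum>a\<in>I. \<Sum>b\<in>I. Poly_Mapping.single 0 (lookup p a * lookup p b) *
      (Poly_Mapping.single (a + b) 1 * g))"
    unfolding sum_product by (simp add: sum_distrib_right mult_single mult.assoc[symmetric])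
  finally show ?thesis
    unfolding quad_form_def
    by (simp add: riesz_y_integral_sum[OF fin] riesz_y_integral_scale[OF fin]
        mult.assoc mult.left_commute[of "riesz w _"] mult.commute[of "riesz w _"])
qed

lemma quad_form_single:
  assumes "finite I" "a \<in> I"
  shows "quad_form I L (lookup (Poly_Mapping.single a 1)) = L a a"
proof -
  have "quad_form I L (lookup (Poly_Mapping.single a 1)) =
      (\<Sum>i\<in>I. if i = a then \<Sum>j\<in>I. if j = a then L a a else 0 else 0)"
    unfolding quad_form_def lookup_single when_def by (intro sum.cong) (auto intro!: sum.cong)
  also have "\<dots> = L a a" using assms by simp
  finally show ?thesis .
qed

lemma quad_form_two:
  assumes I: "finite I" "a \<in> I" "b \<in> I" and "a \<noteq> b"
  shows "quad_form I L (lookup (Poly_Mapping.single a 1 + Poly_Mapping.single b 1)) =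
    L a a + L a b + L b a + L b b"
proof -
  let ?v = "lookup (Poly_Mapping.single a (1::real) + Poly_Mapping.single b 1)"
  have v: "?v i = (if i = a then 1 else 0) + (if i = b then 1 else 0)" for i
    by (auto simp: lookup_add lookup_single when_def)
  have "(\<Sum>j\<in>I. ?v i * L i j * ?v j) = ?v i * (L i a + L i b)" for i
    unfolding v using I by (simp add: distrib_left sum.distrib if_distrib[of "(*) _"] cong: if_cong)
  then have "quad_form I L ?v = (\<Sum>i\<in>I. ?v i * (L i a + L i b))"
    unfolding quad_form_def by simp
  also have "\<dots> = (\<Sum>i\<in>I. (if i = a then L a a + L a b else 0) + (if i = b then L b a + L b b else 0))"
    unfolding v by (rule sum.cong) (use \<open>a \<noteq> b\<close> in auto)
  finally show ?thesis using I by (simp add: sum.distrib)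
qed

lemma is_localizing_matrix_iff:
  assumes fin: "finite_moments \<nu>"
  shows "is_localizing_matrix \<nu> g w k l L \<longleftrightarrow>
    L = (\<lambda>a b. if a \<in> loc_index g k l \<and> b \<in> loc_index g k l
               then riesz w (y_integral \<nu> (Poly_Mapping.single (a + b) 1 * g)) else 0)"
    (is "_ \<longleftrightarrow> L = ?L")
proof
  let ?I = "loc_index g k l"
  let ?B = "\<lambda>a b. riesz w (y_integral \<nu> (Poly_Mapping.single (a + b) 1 * g))"
  note fI = finite_loc_index[of g k l]
  have "quad_form ?I ?B v = quad_form ?I ?L v" for v
    unfolding quad_form_def by simp
  then have sq: "riesz w (y_integral \<nu> (p ^ 2 * g)) = quad_form ?I ?L (lookup p)"
    if "keys p \<subseteq> ?I" for p
    using riesz_y_integral_square[OF fin fI that] by simp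
  have "is_localizing_matrix \<nu> g w k l ?L"
    unfolding is_localizing_matrix_def
  proof (intro conjI allI impI)
    show "?L a b = ?L b a" for a b by (simp add: add.commute)
    show "riesz w (y_integral \<nu> (p ^ 2 * g)) = quad_form ?I ?L (lookup p)"
      if "int (deg_x p) \<le> loc_order k (deg_x g)" "int (deg_y p) \<le> loc_order l (deg_y g)" for p
      by (rule sq) (rule keys_subset_loc_index[OF that])
  qed simp
  then show "L = ?L \<Longrightarrow> is_localizing_matrix \<nu> g w k l L" by simp
  assume L: "is_localizing_matrix \<nu> g w k l L"
  have Lsym: "L a b = L b a" and L0: "a \<notin> ?I \<Longrightarrow> L a b = 0" for a b
    using L unfolding is_localizing_matrix_def by blast+
  have eq: "quad_form ?I L (lookup p) = quad_form ?I ?L (lookup p)"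
    if "keys p \<subseteq> ?I" "c \<in> ?I" for p c
  proof -
    have "riesz w (y_integral \<nu> (p ^ 2 * g)) = quad_form ?I L (lookup p)"
      using L keys_loc_index_deg[OF that] unfolding is_localizing_matrix_def by blast
    then show ?thesis using sq[OF that(1)] by simp
  qed
  have diag: "L a a = ?L a a" if "a \<in> ?I" for a
  proof -
    have "keys (Poly_Mapping.single a (1::real)) \<subseteq> ?I" using that by simp
    from eq[OF this that] show ?thesis unfolding quad_form_single[OF fI that] .
  qed
  show "L = ?L"
  proof (intro ext)
    fix a b
    show "L a b = ?L a b"
    proof (cases "a \<in> ?I \<and> b \<in> ?I \<and> a \<noteq> b")
      case True
      then have ab: "a \<in> ?I" "b \<in> ?I" "a \<noteq> b" by auto
      have "keys (Poly_Mapping.single a (1::real) + Poly_Mapping.single b 1) \<subseteq> ?I"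
        using ab Poly_Mapping.keys_add[of "Poly_Mapping.single a (1::real)" "Poly_Mapping.single b 1"] by auto
      from eq[OF this ab(1)] have "L a a + L a b + L b a + L b b = ?L a a + ?L a b + ?L b a + ?L b b"
        unfolding quad_form_two[OF fI ab] .
      moreover have "?L b a = ?L a b" by (simp add: add.commute)
      ultimately show ?thesis using Lsym[of b a] diag[OF ab(1)] diag[OF ab(2)] by linarith
    next
      case False
      then show ?thesis using diag[of a] L0[of a b] L0[of b a] Lsym[of a b] by auto
    qed
  qed
qed

lemma localizing_matrix_entry:
  assumes "finite_moments \<nu>"
  shows "localizing_matrix \<nu> g w k l = (\<lambda>a b.
    if a \<in> loc_index g k l \<and> b \<in> loc_index g k l
    then riesz w (y_integral \<nu> (Poly_Mapping.single (a + b) 1 * g)) else 0)"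
  unfolding localizing_matrix_def is_localizing_matrix_iff[OF assms] by simp

end

theory Submission
  imports Defs
begin

text \<open>
  The proof combines a truncated moment problem in \<open>x\<close> with a density theorem in \<open>y\<close>.

  The localizing matrices of \<open>g 0 = 1\<close> make the form \<open>B(p, q) = R\<^sub>w(p q)\<close> positive semidefinite on
  the polynomials of degree at most \<open>d\<close>. Equality of the ranks of the moment matrices of orders
  \<open>k < d\<close> and \<open>d\<close> says that, modulo null vectors of \<open>B\<close>, every polynomial of degree \<open>d\<close> is a
  combination of an orthonormal family \<open>E\<close> of \<open>r\<close> polynomials of degree at most \<open>k\<close>. Multiplication
  by the variables therefore acts on the span of \<open>E\<close>, by commuting self-adjoint operators
  (\<open>joint_eigenbasis\<close>), and \<open>E\<close> can be chosen to consist of joint eigenvectors \<open>e\<close>, with eigenvalues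
  \<open>\<xi> e\<close>. Up to the factors \<open>c e = R\<^sub>w(e)\<close> these eigenvectors are the Lagrange polynomials of the \<open>r\<close>
  distinct points \<open>\<xi> e\<close>, and the measure with mass \<open>(c e)\<^sup>2\<close> at \<open>\<xi> e\<close> represents \<open>w\<close>
  (\<open>moments_eq_sum\<close>). Null vectors vanish almost everywhere for any representing measure, which
  forces such a measure onto the points \<open>\<xi> e\<close> with the same masses (\<open>representing_measure_unique\<close>).

  It remains to see that \<open>h(y) = g\<^sub>j(\<xi> e, y)\<close> is nonnegative on \<open>Q\<close>. As \<open>e\<close> has degree at most
  \<open>k \<le> d - d\<^sub>g\<close>, the localizing matrices of \<open>g\<^sub>j\<close> may be tested with the products \<open>e(x) q(y)\<close>, and since
  \<open>e\<close> vanishes at the other points the result is \<open>\<integral> q\<^sup>2 h d\<nu> \<ge> 0\<close> for every polynomial \<open>q\<close>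
  (\<open>localized_integral_nonneg\<close>). The Carleman condition extends this inequality from polynomials
  to the powers of \<open>\<Prod>\<^sub>j 1 / (1 + (y\<^sub>j - a\<^sub>j)\<^sup>2)\<close>, which concentrate at \<open>a\<close>, so \<open>h(a) < 0\<close> is impossible for \<open>a\<close>
  in the support of \<open>\<nu>\<close> (\<open>nonneg_on_support\<close>).

  The extension rests on the approximation of a single function \<open>1 / (1 + (y\<^sub>j - a)\<^sup>2)\<close> by polynomials
  in \<open>y\<^sub>j\<close>, in mean square with respect to \<open>p\<^sup>2 \<nu>\<close> for an arbitrary polynomial weight \<open>p\<close>. That function
  is the imaginary part of the resolvent \<open>1 / (y\<^sub>j - (a + i))\<close>. The coefficients of the resolvent in the
  orthogonal polynomials of \<open>y\<^sub>j\<close> obey their three-term recurrence, so that the approximation error is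
  given by a Wronskian (\<open>wronskian\<close>), and Carleman's inequality turns a positive lower bound for the
  error into convergence of the Carleman series (\<open>poly_approx_v\<close>). Arbitrary weights make the class of
  approximable functions closed under products (\<open>approximable_mult\<close>), which gives the kernels in
  several variables.
\<close>

section \<open>Orthonormal families of a symmetric bilinear form\<close>

text \<open>
  Semidefinite forms are included: the moment form of a truncated sequence has null vectors, and
  eigenvectors will be found as null vectors of a form \<open>A - \<lambda> B\<close>.
\<close>

locale symmetric_form =
  fixes B :: "'v::real_vector \<Rightarrow> 'v \<Rightarrow> real"
  assumes sym: "B x y = B y x"
    and add_left: "B (x + y) z = B x z + B y z"
    and scale_left: "B (c *\<^sub>R x) z = c * B x z"
begin

lemma add_right: "B z (x + y) = B z x + B z y"
  by (metis add_left sym)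

lemma scale_right: "B z (c *\<^sub>R x) = c * B z x"
  by (metis scale_left sym)

lemma zero_left [simp]: "B 0 z = 0"
  using scale_left[of 0 0 z] by simp

lemma zero_right [simp]: "B z 0 = 0"
  by (metis sym zero_left)

lemma diff_left: "B (x - y) z = B x z - B y z"
  using add_left[of "x - y" y z] by simp

lemma sum_left: "B (\<Sum>i\<in>I. f i) z = (\<Sum>i\<in>I. B (f i) z)"
  by (induction I rule: infinite_finite_induct) (auto simp: add_left)

lemma sum_right: "B z (\<Sum>i\<in>I. f i) = (\<Sum>i\<in>I. B z (f i))"
  by (induction I rule: infinite_finite_induct) (auto simp: add_right)

text \<open>
  The equality case of the Cauchy--Schwarz inequality: if \<open>B x y\<close> were nonzero, \<open>B\<close> would take a negative
  value at \<open>y + t x\<close> for suitable \<open>t\<close>.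
\<close>

lemma null_orthogonal:
  assumes V: "subspace V" and psd: "\<And>x. x \<in> V \<Longrightarrow> 0 \<le> B x x"
    and x: "x \<in> V" "B x x = 0" and y: "y \<in> V"
  shows "B x y = 0"
proof (rule ccontr)
  assume ne: "B x y \<noteq> 0"
  define t where "t = - (B y y + 1) / (2 * B x y)"
  have "t *\<^sub>R x + y \<in> V"
    using V x y by (simp add: subspace_add subspace_scale)
  then have "0 \<le> B (t *\<^sub>R x + y) (t *\<^sub>R x + y)" by (rule psd)
  also have "\<dots> = 2 * t * B x y + B y y"
    by (simp add: add_left add_right scale_left scale_right x sym[of y x])
  also have "\<dots> = -1" using ne by (simp add: t_def field_simps)
  finally show False by simp
qed

definition orthonormal :: "'v set \<Rightarrow> bool" where
  "orthonormal E \<longleftrightarrow> finite E \<and> (\<forall>e\<in>E. \<forall>f\<in>E. B e f = (if e = f then 1 else 0))"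

definition proj :: "'v set \<Rightarrow> 'v \<Rightarrow> 'v" where
  "proj E x = (\<Sum>e\<in>E. B x e *\<^sub>R e)"

lemma orthonormal_finite: "orthonormal E \<Longrightarrow> finite E"
  by (simp add: orthonormal_def)

lemma form_orthonormal_sum:
  assumes "orthonormal E" "f \<in> E"
  shows "B (\<Sum>e\<in>E. c e *\<^sub>R e) f = c f"
proof -
  have "B (\<Sum>e\<in>E. c e *\<^sub>R e) f = (\<Sum>e\<in>E. if e = f then c e else 0)"
    unfolding sum_left scale_left
    by (rule sum.cong) (use assms in \<open>auto simp: orthonormal_def\<close>)
  then show ?thesis using assms by (simp add: orthonormal_def)
qed

lemma proj_linear: "linear (proj E)"
  by (rule linearI)
    (simp_all add: proj_def add_left scale_left scaleR_add_left sum.distrib scaleR_sum_right)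

lemma proj_in_span: "proj E x \<in> span E"
  unfolding proj_def by (intro span_sum span_scale span_base)

lemma form_proj: "orthonormal E \<Longrightarrow> f \<in> E \<Longrightarrow> B (proj E x) f = B x f"
  unfolding proj_def by (rule form_orthonormal_sum)

lemma form_proj_span:
  assumes "orthonormal E" "y \<in> span E"
  shows "B (proj E x) y = B x y"
  using assms(2)
proof (induction rule: span_induct_alt)
  case (step c f y)
  then show ?case by (simp add: add_right scale_right form_proj[OF assms(1)])
qed simp

lemma proj_span:
  assumes "orthonormal E" "x \<in> span E"
  shows "proj E x = x"
proof -
  have "linear (\<lambda>x. x :: 'v)" by (simp add: linear_iff)
  moreover have "proj E f = f" if "f \<in> E" for f
  proof -
    have "proj E f = (\<Sum>e\<in>E. if f = e then e else 0)"
      unfolding proj_def by (rule sum.cong) (use assms that in \<open>auto simp: orthonormal_def\<close>)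
    then show ?thesis using assms that by (simp add: orthonormal_def)
  qed
  ultimately show ?thesis
    using linear_eq_on[OF proj_linear _ assms(2), of "\<lambda>x. x"] by blast
qed

lemma form_span_self:
  assumes "orthonormal E" "x \<in> span E"
  shows "B x x = (\<Sum>e\<in>E. (B x e)\<^sup>2)"
proof -
  have "B x x = B (proj E x) x" using proj_span[OF assms] by simp
  also have "\<dots> = (\<Sum>e\<in>E. B x e * B e x)" by (simp only: proj_def sum_left scale_left)
  also have "\<dots> = (\<Sum>e\<in>E. (B x e)\<^sup>2)" by (metis power2_eq_square sym)
  finally show ?thesis .
qed

lemma form_pos_span: "orthonormal E \<Longrightarrow> x \<in> span E \<Longrightarrow> 0 \<le> B x x"
  by (simp add: form_span_self sum_nonneg)

lemma form_definite_span:
  assumes "orthonormal E" "x \<in> span E" "B x x = 0"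
  shows "x = 0"
proof -
  have "finite E" using assms by (simp add: orthonormal_def)
  then have "\<forall>e\<in>E. B x e = 0"
    using assms(3) by (simp add: form_span_self[OF assms(1,2)] sum_nonneg_eq_0_iff)
  then have "proj E x = 0" by (simp add: proj_def)
  then show ?thesis using proj_span[OF assms(1,2)] by simp
qed

lemma orthonormal_independent:
  assumes "orthonormal E"
  shows "independent E"
proof (rule independent_if_scalars_zero)
  fix c f assume "(\<Sum>e\<in>E. c e *\<^sub>R e) = 0" "f \<in> E"
  then show "c f = 0" using form_orthonormal_sum[OF assms, of f c] by simp
qed (use assms in \<open>simp add: orthonormal_def\<close>)

lemma dim_span_orthonormal: "orthonormal E \<Longrightarrow> dim (span E) = card E"
  by (intro real_vector.dim_span_eq_card_independent orthonormal_independent)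

lemma orthonormal_Un:
  assumes "orthonormal E" "orthonormal F" "\<And>e f. e \<in> E \<Longrightarrow> f \<in> F \<Longrightarrow> B e f = 0"
  shows "orthonormal (E \<union> F)" "E \<inter> F = {}"
proof -
  show 1: "E \<inter> F = {}"
    using assms by (auto simp: orthonormal_def) (metis zero_neq_one)
  show "orthonormal (E \<union> F)"
    using assms 1 sym unfolding orthonormal_def by (auto; metis)
qed

text \<open>
  Gram--Schmidt for a positive semidefinite form: vectors that are already null modulo the earlier
  ones contribute nothing, so the resulting family spans only modulo null vectors.
\<close>

lemma gram_schmidt_extend:
  assumes V: "subspace V" and psd: "\<And>x. x \<in> V \<Longrightarrow> 0 \<le> B x x"
    and "finite F" "F \<subseteq> V" "orthonormal E\<^sub>0" "E\<^sub>0 \<subseteq> V"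
  shows "\<exists>E. orthonormal E \<and> E\<^sub>0 \<subseteq> E \<and> E \<subseteq> span (E\<^sub>0 \<union> F) \<and>
    (\<forall>x\<in>span F. \<forall>z\<in>V. B (x - proj E x) z = 0)"
  using assms(3,4)
proof (induction F rule: finite_induct)
  case empty
  show ?case
    by (rule exI[of _ E\<^sub>0]) (use assms in \<open>auto simp: span_base proj_def\<close>)
next
  case (insert a F)
  then obtain E where E: "orthonormal E" "E\<^sub>0 \<subseteq> E" "E \<subseteq> span (E\<^sub>0 \<union> F)"
    and nul: "\<And>x z. x \<in> span F \<Longrightarrow> z \<in> V \<Longrightarrow> B (x - proj E x) z = 0"
    by blast
  have sub: "E\<^sub>0 \<union> insert a F \<subseteq> V" using insert assms by auto
  have span_V: "span (E\<^sub>0 \<union> insert a F) \<subseteq> V"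
    using sub V by (rule span_minimal)
  have E': "E \<subseteq> span (E\<^sub>0 \<union> insert a F)"
    using E(3) span_mono[of "E\<^sub>0 \<union> F" "E\<^sub>0 \<union> insert a F"] by blast
  define b where "b = a - proj E a"
  have "proj E a \<in> span (E\<^sub>0 \<union> insert a F)"
    using proj_in_span[of E a] span_minimal[OF E' subspace_span] by blast
  then have b: "b \<in> span (E\<^sub>0 \<union> insert a F)"
    unfolding b_def by (intro span_diff) (auto intro: span_base)
  then have bV: "b \<in> V" using span_V by blast
  have b_orth: "B b e = 0" if "e \<in> E" for e
    using form_proj[OF E(1) that] by (simp add: b_def diff_left)
  have span_ext: "B (x - proj G x) z = 0"
    if "\<And>x z. x \<in> insert a F \<Longrightarrow> z \<in> V \<Longrightarrow> B (x - proj G x) z = 0" "x \<in> span (insert a F)" "z \<in> V"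
    for G x z
    using that(2)
  proof (induction rule: span_induct_alt)
    case base
    then show ?case by (simp add: proj_def)
  next
    case (step c y x)
    have eq: "c *\<^sub>R y + x - proj G (c *\<^sub>R y + x) = c *\<^sub>R (y - proj G y) + (x - proj G x)"
      by (simp add: linear_add[OF proj_linear] linear_cmul[OF proj_linear] scaleR_diff_right)
    show ?case unfolding eq using that(1)[OF step(1) that(3)] step(2) by (simp add: add_left scale_left)
  qed
  show ?case
  proof (cases "B b b = 0")
    case True
    have "B (x - proj E x) z = 0" if "x \<in> insert a F" "z \<in> V" for x z
      using that null_orthogonal[OF V psd bV True] nul[of x z] by (auto simp: b_def span_base)
    from span_ext[OF this] show ?thesis
      using E E' by blast
  next
    case False
    then have pos: "B b b > 0" using psd[OF bV] by simp
    define f where "f = (1 / sqrt (B b b)) *\<^sub>R b"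
    have ff: "B f f = 1"
      using pos by (simp add: f_def scale_left scale_right)
    have f_orth: "B f e = 0" if "e \<in> E" for e
      using b_orth[OF that] by (simp add: f_def scale_left)
    have proj_f: "B (proj E x) f = 0" for x
    proof -
      have "B e f = 0" if "e \<in> E" for e using f_orth[OF that] sym[of e f] by simp
      then show ?thesis by (simp add: proj_def sum_left scale_left)
    qed
    have f_in: "f \<in> span (E\<^sub>0 \<union> insert a F)" using b by (simp add: f_def span_scale)
    then have fV: "f \<in> V" using span_V by blast
    have "f \<notin> E" using f_orth ff by fastforce
    then have pr: "proj (insert f E) x = proj E x + B x f *\<^sub>R f" for x
      using E(1) by (simp add: proj_def orthonormal_def add.commute)
    have "B (x - proj (insert f E) x) z = 0" if x: "x \<in> insert a F" and z: "z \<in> V" for x z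
    proof (cases "x = a")
      case True
      have "B (proj E a) f = 0" by (rule proj_f)
      then have "B a f = B b f" by (simp add: b_def diff_left)
      also have "\<dots> = sqrt (B b b)" using pos by (simp add: f_def scale_right real_div_sqrt)
      finally have "B a f *\<^sub>R f = b" using pos by (simp add: f_def)
      then show ?thesis by (simp add: True pr b_def flip: diff_diff_eq)
    next
      case False
      then have "x \<in> span F" using x by (simp add: span_base)
      note n = nul[OF this]
      have "B (proj E x) f = 0" by (rule proj_f)
      then have "B x f = 0" using n[OF fV] by (simp add: diff_left)
      then show ?thesis using n[OF z] by (simp add: pr)
    qed
    note ext = span_ext[OF this]
    have "orthonormal (insert f E)"
      using E(1) ff f_orth \<open>f \<notin> E\<close> sym unfolding orthonormal_def by (auto; metis)
    then show ?thesis
      using E E' f_in ext by (intro exI[of _ "insert f E"]) blast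
  qed
qed

text \<open>On the span of an orthonormal family the form is definite, so Gram--Schmidt is exact there.\<close>

lemma orthonormal_basis_subspace:
  assumes E: "orthonormal E" and U: "subspace U" "U \<subseteq> span E"
  shows "\<exists>G. orthonormal G \<and> span G = U"
proof -
  obtain F where F: "F \<subseteq> U" "independent F" "U \<subseteq> span F"
    using basis_exists[of U] by metis
  have "finite F"
    using independent_span_bound[of E F] F E U orthonormal_finite by blast
  have psd: "0 \<le> B x x" if "x \<in> U" for x
    using form_pos_span[OF E] that U by blast
  have sF: "span F = U" using F U by (metis span_subspace)
  obtain G where G: "orthonormal G" "G \<subseteq> span ({} \<union> F)"
    and nul: "\<forall>x\<in>span F. \<forall>z\<in>U. B (x - proj G x) z = 0"
    using gram_schmidt_extend[OF U(1) psd \<open>finite F\<close> F(1), of "{}"] by (auto simp: orthonormal_def)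
  have GU: "span G \<subseteq> U" using G(2) sF span_minimal[of G U] U(1) by simp
  have "x \<in> span G" if "x \<in> U" for x
  proof -
    have y: "x - proj G x \<in> U" using that GU U proj_in_span subspace_diff by blast
    then have "x - proj G x = 0"
      using nul that sF U form_definite_span[OF E] by blast
    then show ?thesis using proj_in_span[of G x] by simp
  qed
  then show ?thesis using G GU by blast
qed

text \<open>
  On a finite-dimensional space every form is bounded by the sum of squares of the coordinates, hence
  by any positive definite form.
\<close>

lemma form_sum_bound:
  assumes "finite E"
  shows "\<bar>B (\<Sum>e\<in>E. c e *\<^sub>R e) (\<Sum>e\<in>E. c e *\<^sub>R e)\<bar> \<le> (\<Sum>e\<in>E. (c e)\<^sup>2) * (\<Sum>e\<in>E. \<Sum>f\<in>E. \<bar>B e f\<bar>)"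
proof -
  let ?s = "\<Sum>e\<in>E. (c e)\<^sup>2"
  have cc: "\<bar>c e * c f\<bar> \<le> ?s" if "e \<in> E" "f \<in> E" for e f
  proof -
    have le: "(c x)\<^sup>2 \<le> ?s" if "x \<in> E" for x
      using assms that by (intro member_le_sum) auto
    have "0 \<le> (\<bar>c e\<bar> - \<bar>c f\<bar>)\<^sup>2" by simp
    then have "2 * \<bar>c e * c f\<bar> \<le> (c e)\<^sup>2 + (c f)\<^sup>2"
      by (simp add: power2_diff abs_mult algebra_simps)
    then show ?thesis using le[OF that(1)] le[OF that(2)] by linarith
  qed
  have "\<bar>B (\<Sum>e\<in>E. c e *\<^sub>R e) (\<Sum>e\<in>E. c e *\<^sub>R e)\<bar> = \<bar>\<Sum>e\<in>E. \<Sum>f\<in>E. c e * c f * B e f\<bar>"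
    unfolding sum_left scale_left sum_right scale_right by (subst sum.swap) (simp add: sum_distrib_left mult.assoc mult.left_commute)
  also have "\<dots> \<le> (\<Sum>e\<in>E. \<Sum>f\<in>E. \<bar>c e * c f * B e f\<bar>)"
    by (rule order_trans[OF sum_abs]) (intro sum_mono sum_abs)
  also have "\<dots> \<le> (\<Sum>e\<in>E. \<Sum>f\<in>E. ?s * \<bar>B e f\<bar>)"
    using cc by (intro sum_mono) (metis abs_ge_zero abs_mult mult_right_mono)
  finally show ?thesis by (simp add: sum_distrib_left)
qed

text \<open>
  The least value \<open>\<lambda>\<close> of the Rayleigh quotient is attained, for otherwise \<open>A - \<lambda> B\<close> would be positive
  definite, hence bounded below by a positive multiple of \<open>B\<close>, and \<open>\<lambda>\<close> could be increased.
\<close>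

lemma eigenvector_exists:
  assumes A: "symmetric_form A" and E: "orthonormal E" "E \<noteq> {}"
  shows "\<exists>l. \<exists>p\<in>span E. p \<noteq> 0 \<and> (\<forall>q\<in>span E. A p q = l * B p q)"
proof -
  interpret A: symmetric_form A by (fact A)
  define R where "R = {A p p | p. p \<in> span E \<and> B p p = 1}"
  obtain e where "e \<in> E" using E(2) by blast
  then have "A e e \<in> R" using E(1) unfolding R_def orthonormal_def by (auto simp: span_base)
  then have ne: "R \<noteq> {}" by blast
  have bdd: "bdd_below R"
  proof (rule bdd_belowI)
    fix v assume "v \<in> R"
    then obtain p where p: "v = A p p" "p \<in> span E" "B p p = 1" by (auto simp: R_def)
    have "\<bar>A (proj E p) (proj E p)\<bar> \<le> (\<Sum>e\<in>E. (B p e)\<^sup>2) * (\<Sum>e\<in>E. \<Sum>f\<in>E. \<bar>A e f\<bar>)"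
      unfolding proj_def using E by (intro A.form_sum_bound) (simp add: orthonormal_def)
    then show "- (\<Sum>e\<in>E. \<Sum>f\<in>E. \<bar>A e f\<bar>) \<le> v"
      using p form_span_self[OF E(1) p(2)] proj_span[OF E(1) p(2)] by simp
  qed
  define l where "l = Inf R"
  define C where "C = (\<lambda>p q. A p q - l * B p q)"
  interpret C: symmetric_form C
  proof
    show "C x y = C y x" for x y by (simp only: C_def A.sym[of x y] sym[of x y])
  qed (simp_all add: C_def A.add_left add_left A.scale_left scale_left algebra_simps)
  have l_le: "l * B p p \<le> A p p" if p: "p \<in> span E" for p
  proof (cases "p = 0")
    case False
    then have pos: "B p p > 0"
      using form_definite_span[OF E(1) p] form_pos_span[OF E(1) p] by force
    let ?q = "(1 / sqrt (B p p)) *\<^sub>R p"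
    have "B ?q ?q = 1" "A ?q ?q = A p p / B p p"
      using pos by (simp_all add: scale_left scale_right A.scale_left A.scale_right)
    moreover have "?q \<in> span E" using p by (rule span_scale)
    ultimately have "A p p / B p p \<in> R" unfolding R_def by force
    then have "l \<le> A p p / B p p" unfolding l_def using bdd by (rule cInf_lower)
    then show ?thesis using pos by (simp add: field_simps)
  qed simp
  have psd: "0 \<le> C x x" if "x \<in> span E" for x
    using l_le[OF that] by (simp add: C_def)
  show ?thesis
  proof (cases "\<exists>x\<in>span E. x \<noteq> 0 \<and> C x x = 0")
    case True
    then obtain x where x: "x \<in> span E" "x \<noteq> 0" "C x x = 0" by blast
    have "C x q = 0" if "q \<in> span E" for q
      using C.null_orthogonal[OF subspace_span psd x(1,3) that] .
    then show ?thesis using x by (auto simp: C_def)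
  next
    case False
    have "finite E" using E by (simp add: orthonormal_def)
    obtain G where G: "C.orthonormal G" "G \<subseteq> span E"
      and nul: "\<forall>x\<in>span E. \<forall>z\<in>span E. C (x - C.proj G x) z = 0"
      using C.gram_schmidt_extend[OF subspace_span psd \<open>finite E\<close> span_superset, of "{}"]
      by (auto simp: C.orthonormal_def)
    define M where "M = (\<Sum>e\<in>G. \<Sum>f\<in>G. \<bar>B e f\<bar>)"
    have M0: "M \<ge> 0" unfolding M_def by (intro sum_nonneg) auto
    have "1 \<le> (v - l) * M" if v: "v \<in> R" for v
    proof -
      obtain p where p: "v = A p p" "p \<in> span E" "B p p = 1" using v by (auto simp: R_def)
      have "C.proj G p \<in> span E"
        using C.proj_in_span[of G p] span_minimal[OF G(2) subspace_span] by blast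
      then have "p - C.proj G p \<in> span E" using p by (intro span_diff)
      then have pp: "p = C.proj G p" using nul p False by force
      then have "p \<in> span G" using C.proj_in_span[of G p] by simp
      from C.form_span_self[OF G(1) this] have "(\<Sum>e\<in>G. (C p e)\<^sup>2) = v - l"
        using p by (simp add: C_def)
      moreover have "\<bar>B (C.proj G p) (C.proj G p)\<bar> \<le> (\<Sum>e\<in>G. (C p e)\<^sup>2) * M"
        unfolding C.proj_def M_def by (intro form_sum_bound C.orthonormal_finite[OF G(1)])
      ultimately show ?thesis using p pp by simp
    qed
    then have *: "l + 1 / (M + 1) \<le> v" if "v \<in> R" for v
    proof -
      have "v - l \<ge> 0" unfolding l_def using cInf_lower[OF that bdd] by simp
      then have "1 \<le> (v - l) * (M + 1)"
        using \<open>\<And>v. v \<in> R \<Longrightarrow> 1 \<le> (v - l) * M\<close>[OF that] by (simp add: distrib_left)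
      then show ?thesis using M0 by (simp add: field_simps)
    qed
    have "l + 1 / (M + 1) \<le> l"
      unfolding l_def[of] by (rule cInf_greatest[OF ne]) (use * in \<open>simp add: l_def\<close>)
    then show ?thesis using M0 by (simp add: field_simps)
  qed
qed

text \<open>
  If some operator of the family is not scalar, one of its eigenspaces and the orthogonal complement
  of that eigenspace are invariant under the whole family and both of smaller dimension.
\<close>

theorem joint_diagonalization:
  assumes "\<And>i. linear (T i)"
    and "orthonormal E"
    and "\<And>i x. x \<in> span E \<Longrightarrow> T i x \<in> span E"
    and "\<And>i x y. x \<in> span E \<Longrightarrow> y \<in> span E \<Longrightarrow> B (T i x) y = B x (T i y)"
    and "\<And>i j x. x \<in> span E \<Longrightarrow> T i (T j x) = T j (T i x)"
  shows "\<exists>G. orthonormal G \<and> span G = span E \<and> (\<forall>e\<in>G. \<forall>i. \<exists>l. T i e = l *\<^sub>R e)"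
  using assms(2-)
proof (induction "card E" arbitrary: E rule: less_induct)
  case less
  note E = less.prems(1) and inv = less.prems(2) and adj = less.prems(3) and comm = less.prems(4)
  let ?S = "span E"
  show ?case
  proof (cases "\<forall>i. \<exists>l. \<forall>x\<in>?S. T i x = l *\<^sub>R x")
    case True
    then have "\<forall>e\<in>E. \<forall>i. \<exists>l. T i e = l *\<^sub>R e" by (meson span_base)
    then show ?thesis using E by blast
  next
    case False
    then obtain i where i: "\<And>l. \<exists>x\<in>?S. T i x \<noteq> l *\<^sub>R x" by blast
    have T_zero: "T i 0 = 0" by (simp add: assms(1) linear_0)
    have "E \<noteq> {}" using i[of 0] T_zero by auto
    define A where "A = (\<lambda>x y. B (T i (proj E x)) (proj E y))"
    have A: "symmetric_form A"
    proof
      show "A x y = A y x" for x y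
        unfolding A_def using adj proj_in_span sym by metis
    qed (simp_all add: A_def linear_add[OF proj_linear] linear_cmul[OF proj_linear]
          linear_add[OF assms(1)] linear_cmul[OF assms(1)] add_left scale_left)
    obtain l p where p: "p \<in> ?S" "p \<noteq> 0" "\<And>q. q \<in> ?S \<Longrightarrow> A p q = l * B p q"
      using eigenvector_exists[OF A E \<open>E \<noteq> {}\<close>] by blast
    have "B (T i p - l *\<^sub>R p) q = 0" if "q \<in> ?S" for q
      using p(3)[OF that] by (simp add: A_def proj_span[OF E] p that diff_left scale_left)
    then have Tp: "T i p = l *\<^sub>R p"
      using form_definite_span[OF E, of "T i p - l *\<^sub>R p"] inv[OF p(1)] p(1)
      by (simp add: span_diff span_scale)
    define U where "U = {x \<in> ?S. T i x = l *\<^sub>R x}"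
    define W where "W = {x \<in> ?S. \<forall>y\<in>U. B x y = 0}"
    have U: "subspace U" "U \<subseteq> ?S"
      unfolding U_def subspace_def
      by (auto simp: T_zero linear_add[OF assms(1)] linear_cmul[OF assms(1)]
          span_zero span_add span_scale scaleR_add_right)
    have W: "subspace W" "W \<subseteq> ?S"
      unfolding W_def subspace_def
      by (auto simp: add_left scale_left span_zero span_add span_scale)
    have U_inv: "T j x \<in> U" if "x \<in> U" for j x
      using that inv comm[of x i j] by (auto simp: U_def linear_cmul[OF assms(1)])
    have W_inv: "T j x \<in> W" if "x \<in> W" for j x
      using that inv adj U_inv U(2) by (auto simp: W_def)
    obtain G\<^sub>U where GU: "orthonormal G\<^sub>U" "span G\<^sub>U = U"
      using orthonormal_basis_subspace[OF E U] by blast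
    obtain G\<^sub>W where GW: "orthonormal G\<^sub>W" "span G\<^sub>W = W"
      using orthonormal_basis_subspace[OF E W] by blast
    have decomp: "x \<in> span (G \<union> H)" if x: "x \<in> ?S" and GH: "span G = U" "span H = W" for x G H
    proof -
      have "x - proj G\<^sub>U x \<in> W"
        using x U proj_in_span[of G\<^sub>U x] GU form_proj_span[OF GU(1)]
        by (auto simp: W_def diff_left span_diff)
      then have "x - proj G\<^sub>U x \<in> span (G \<union> H)"
        using GH span_mono[of H "G \<union> H"] by blast
      moreover have "proj G\<^sub>U x \<in> span (G \<union> H)"
        using GH GU proj_in_span[of G\<^sub>U x] span_mono[of G "G \<union> H"] by blast
      ultimately show ?thesis using span_add by fastforce
    qed
    have un: "orthonormal (G \<union> H)" "G \<inter> H = {}" "span (G \<union> H) = ?S"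
      if "orthonormal G" "orthonormal H" "span G = U" "span H = W" for G H
    proof -
      have orth: "B e f = 0" if "e \<in> G" "f \<in> H" for e f
        using that \<open>span G = U\<close> \<open>span H = W\<close> sym[of f e] unfolding W_def
        by (metis (mono_tags, lifting) mem_Collect_eq span_base)
      show "orthonormal (G \<union> H)" "G \<inter> H = {}"
        using orthonormal_Un[OF that(1,2) orth] by auto
      have "G \<union> H \<subseteq> ?S" using that U W span_superset[of G] span_superset[of H] by auto
      then show "span (G \<union> H) = ?S"
        using decomp[OF _ that(3,4)] span_minimal[OF _ subspace_span] by blast
    qed
    have "card G\<^sub>U + card G\<^sub>W = card E"
      using un[OF GU(1) GW(1) GU(2) GW(2)] dim_span_orthonormal E GU GW
      by (metis card_Un_disjoint orthonormal_finite)
    moreover have "G\<^sub>U \<noteq> {}" using p Tp GU(2) by (auto simp: U_def)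
    moreover have "G\<^sub>W \<noteq> {}"
    proof
      assume "G\<^sub>W = {}"
      then have "?S \<subseteq> U" using decomp[OF _ GU(2) GW(2)] GU(2) by auto
      then show False using i[of l] unfolding U_def by blast
    qed
    ultimately have less_card: "card G\<^sub>U < card E" "card G\<^sub>W < card E"
      using orthonormal_finite[OF GU(1)] orthonormal_finite[OF GW(1)] card_gt_0_iff[of G\<^sub>U]
        card_gt_0_iff[of G\<^sub>W] by auto
    have "\<exists>H. orthonormal H \<and> span H = span G\<^sub>U \<and> (\<forall>e\<in>H. \<forall>i. \<exists>l. T i e = l *\<^sub>R e)"
    proof (rule less.hyps[OF less_card(1) GU(1)])
      show "T j x \<in> span G\<^sub>U" if "x \<in> span G\<^sub>U" for j x
        using U_inv that unfolding GU(2) .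
      show "B (T j x) y = B x (T j y)" if "x \<in> span G\<^sub>U" "y \<in> span G\<^sub>U" for j x y
        using adj U(2) that unfolding GU(2) by (meson in_mono)
      show "T j (T k x) = T k (T j x)" if "x \<in> span G\<^sub>U" for j k x
        using comm U(2) that unfolding GU(2) by (meson in_mono)
    qed
    then obtain H\<^sub>U where HU: "orthonormal H\<^sub>U" "span H\<^sub>U = U" "\<forall>e\<in>H\<^sub>U. \<forall>i. \<exists>l. T i e = l *\<^sub>R e"
      unfolding GU(2) by blast
    have "\<exists>H. orthonormal H \<and> span H = span G\<^sub>W \<and> (\<forall>e\<in>H. \<forall>i. \<exists>l. T i e = l *\<^sub>R e)"
    proof (rule less.hyps[OF less_card(2) GW(1)])
      show "T j x \<in> span G\<^sub>W" if "x \<in> span G\<^sub>W" for j x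
        using W_inv that unfolding GW(2) .
      show "B (T j x) y = B x (T j y)" if "x \<in> span G\<^sub>W" "y \<in> span G\<^sub>W" for j x y
        using adj W(2) that unfolding GW(2) by (meson in_mono)
      show "T j (T k x) = T k (T j x)" if "x \<in> span G\<^sub>W" for j k x
        using comm W(2) that unfolding GW(2) by (meson in_mono)
    qed
    then obtain H\<^sub>W where HW: "orthonormal H\<^sub>W" "span H\<^sub>W = W" "\<forall>e\<in>H\<^sub>W. \<forall>i. \<exists>l. T i e = l *\<^sub>R e"
      unfolding GW(2) by blast
    have "\<forall>e\<in>H\<^sub>U \<union> H\<^sub>W. \<forall>i. \<exists>l. T i e = l *\<^sub>R e" using HU(3) HW(3) by blast
    then show ?thesis using un(1,3)[OF HU(1) HW(1) HU(2) HW(2)] by blast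
  qed
qed

end

section \<open>Polynomials and the Riesz functional\<close>

lemma lookup_scaleR_poly_mapping [simp]:
  "lookup (c *\<^sub>R p) a = c *\<^sub>R lookup (p :: 'a \<Rightarrow>\<^sub>0 'b::real_vector) a"
proof -
  have "finite {x. c *\<^sub>R lookup p x \<noteq> 0}"
    by (rule finite_subset[OF _ finite_keys[of p]]) (auto simp: in_keys_iff)
  then show ?thesis by (simp add: scaleR_poly_mapping_def)
qed

lemma scaleR_eq_single_mult:
  fixes p :: "'a::monoid_add \<Rightarrow>\<^sub>0 real"
  shows "c *\<^sub>R p = Poly_Mapping.single 0 c * p"
  by (rule poly_mapping_eqI) (simp add: lookup_single_zero_mult)

lemma scaleR_mult_left_poly_mapping:
  fixes p q :: "'a::comm_monoid_add \<Rightarrow>\<^sub>0 real"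
  shows "(c *\<^sub>R p) * q = c *\<^sub>R (p * q)" "p * (c *\<^sub>R q) = c *\<^sub>R (p * q)"
  by (simp_all add: scaleR_eq_single_mult mult_ac)

lemma mdeg_add: "mdeg (\<alpha> + \<beta>) = mdeg \<alpha> + mdeg \<beta>"
  by (simp add: mdeg_def lookup_add sum.distrib)

lemma mdeg_zero [simp]: "mdeg 0 = 0"
  by (simp add: mdeg_def)

lemma mdeg_single [simp]: "mdeg (Poly_Mapping.single i n) = n"
  by (simp add: mdeg_def lookup_single when_def)

lemma mdeg_Suc_split:
  assumes "mdeg \<alpha> = Suc n"
  obtains i \<beta> where "\<alpha> = Poly_Mapping.single i 1 + \<beta>" "mdeg \<beta> = n"
proof -
  obtain i where i: "lookup \<alpha> i \<noteq> 0"
    using assms sum.not_neutral_contains_not_neutral[of "lookup \<alpha>" UNIV] by (auto simp: mdeg_def)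
  have "\<alpha> = Poly_Mapping.single i 1 + (\<alpha> - Poly_Mapping.single i 1)"
    using i by (intro poly_mapping_eqI) (auto simp: lookup_add lookup_minus lookup_single when_def)
  moreover from this have "mdeg (\<alpha> - Poly_Mapping.single i 1) = n"
    using assms mdeg_add[of "Poly_Mapping.single i 1" "\<alpha> - Poly_Mapping.single i 1"] by simp
  ultimately show thesis by (rule that)
qed

lemma mdeg_split:
  assumes "mdeg \<alpha> \<le> m + n"
  obtains \<beta> \<gamma> where "\<alpha> = \<beta> + \<gamma>" "mdeg \<beta> \<le> m" "mdeg \<gamma> \<le> n"
proof -
  have "\<exists>\<beta> \<gamma>. \<alpha> = \<beta> + \<gamma> \<and> mdeg \<beta> \<le> m \<and> mdeg \<gamma> \<le> n"
    using assms
  proof (induction m arbitrary: \<alpha>)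
    case 0
    then show ?case by (intro exI[of _ 0] exI[of _ \<alpha>]) simp
  next
    case (Suc m)
    show ?case
    proof (cases "mdeg \<alpha>")
      case 0
      then show ?thesis by (intro exI[of _ 0] exI[of _ \<alpha>]) simp
    next
      case (Suc l)
      then obtain i \<alpha>' where \<alpha>': "\<alpha> = Poly_Mapping.single i 1 + \<alpha>'" "mdeg \<alpha>' = l"
        by (rule mdeg_Suc_split)
      then obtain \<beta> \<gamma> where "\<alpha>' = \<beta> + \<gamma>" "mdeg \<beta> \<le> m" "mdeg \<gamma> \<le> n"
        using Suc.IH[of \<alpha>'] Suc.prems Suc by auto
      then show ?thesis using \<alpha>'
        by (intro exI[of _ "Poly_Mapping.single i 1 + \<beta>"] exI[of _ \<gamma>]) (simp add: mdeg_add add.assoc)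
    qed
  qed
  then show thesis using that by blast
qed

lemma mpow_zero [simp]: "mpow x 0 = 1"
  by (simp add: mpow_def)

lemma mpow_add: "mpow x (\<alpha> + \<beta>) = mpow x \<alpha> * mpow x \<beta>"
  by (simp add: mpow_def lookup_add power_add prod.distrib)

lemma mpow_single [simp]: "mpow x (Poly_Mapping.single i n) = (x $ i) ^ n"
proof -
  have "mpow x (Poly_Mapping.single i n) = (\<Prod>j\<in>UNIV. if j = i then (x $ i) ^ n else 1)"
    unfolding mpow_def by (rule prod.cong) (auto simp: lookup_single when_def)
  then show ?thesis by simp
qed

text \<open>
  The Riesz functional is taken for an arbitrary function on multi-indices, so that evaluation at a
  point \<open>x\<close>, which is the Riesz functional of \<open>\<alpha> \<mapsto> x\<^sup>\<alpha>\<close>, and integration are instances.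
\<close>

lemma riesz_superset:
  assumes "finite I" "keys p \<subseteq> I"
  shows "riesz f p = (\<Sum>\<alpha>\<in>I. lookup p \<alpha> * f \<alpha>)"
  unfolding riesz_def by (rule sum.mono_neutral_left) (use assms in \<open>auto simp: in_keys_iff\<close>)

lemma linear_riesz: "linear (riesz (f :: 'n::finite multiseq))"
proof (rule linearI)
  fix p q :: "'n rpoly"
  let ?I = "keys p \<union> keys q"
  have "riesz f (p + q) = (\<Sum>\<alpha>\<in>?I. lookup (p + q) \<alpha> * f \<alpha>)"
    by (rule riesz_superset) (auto simp: Poly_Mapping.keys_add)
  also have "\<dots> = riesz f p + riesz f q"
    by (simp add: riesz_superset[of ?I p] riesz_superset[of ?I q] lookup_add distrib_right sum.distrib)
  finally show "riesz f (p + q) = riesz f p + riesz f q" .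
next
  fix c and p :: "'n rpoly"
  have "riesz f (c *\<^sub>R p) = (\<Sum>\<alpha>\<in>keys p. lookup (c *\<^sub>R p) \<alpha> * f \<alpha>)"
    by (rule riesz_superset) (auto simp: in_keys_iff)
  then show "riesz f (c *\<^sub>R p) = c *\<^sub>R riesz f p"
    by (simp add: riesz_def sum_distrib_left mult.assoc)
qed

lemmas riesz_add = linear_add[OF linear_riesz]
  and riesz_diff = linear_diff[OF linear_riesz]
  and riesz_scale = linear_cmul[OF linear_riesz]
  and riesz_sum = linear_sum[OF linear_riesz]

lemma riesz_single [simp]: "riesz f (Poly_Mapping.single \<alpha> c) = c * f \<alpha>"
  by (simp add: riesz_superset[of "{\<alpha>}"])

lemma riesz_mult:
  "riesz f (p * q) = (\<Sum>\<alpha>\<in>keys p. \<Sum>\<beta>\<in>keys q. lookup p \<alpha> * lookup q \<beta> * f (\<alpha> + \<beta>))"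
proof -
  have "p * q = (\<Sum>\<alpha>\<in>keys p. Poly_Mapping.single \<alpha> (lookup p \<alpha>)) *
      (\<Sum>\<beta>\<in>keys q. Poly_Mapping.single \<beta> (lookup q \<beta>))"
    by (simp add: sum_single_lookup)
  then show ?thesis by (simp add: sum_product mult_single riesz_sum)
qed

lemma peval_eq_riesz: "peval p x = riesz (mpow x) p"
  by (simp add: peval_def riesz_def)

lemma peval_mult: "peval (p * q) x = peval p x * peval q x"
  unfolding peval_eq_riesz riesz_mult unfolding riesz_def sum_product
  by (intro sum.cong refl) (simp add: mpow_add)

lemma peval_one [simp]: "peval 1 x = 1"
  by (simp add: peval_eq_riesz flip: single_one)

definition polys :: "nat \<Rightarrow> 'n::finite rpoly set" where
  "polys d = {p. keys p \<subseteq> multiindices d}"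

abbreviation monomial :: "'n multiindex \<Rightarrow> 'n rpoly" where
  "monomial \<alpha> \<equiv> Poly_Mapping.single \<alpha> 1"

lemma polys_mono: "a \<le> b \<Longrightarrow> polys a \<subseteq> polys b"
  by (auto simp: polys_def multiindices_def)

lemma polys_mult:
  assumes "p \<in> polys a" "q \<in> polys b"
  shows "p * q \<in> polys (a + b)"
  using assms keys_mult[of p q] unfolding polys_def multiindices_def
  by (force simp: mdeg_add intro: add_mono)

lemma mono_in_polys: "mdeg \<alpha> \<le> d \<Longrightarrow> Poly_Mapping.single \<alpha> c \<in> polys d"
  by (simp add: polys_def multiindices_def)

lemma subspace_polys: "subspace (polys d :: 'n::finite rpoly set)"
proof (unfold subspace_def, intro conjI ballI allI)
  fix p q :: "'n rpoly" and c :: real assume "p \<in> polys d" "q \<in> polys d"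
  then show "p + q \<in> polys d"
    using Poly_Mapping.keys_add[of p q] by (auto simp: polys_def)
next
  fix p :: "'n rpoly" and c :: real assume "p \<in> polys d"
  then show "c *\<^sub>R p \<in> polys d"
    by (auto simp: polys_def in_keys_iff subset_iff)
qed (simp add: polys_def)

lemma span_monomials: "span (monomial ` multiindices d) = (polys d :: 'n::finite rpoly set)"
proof (rule span_subspace)
  show "monomial ` multiindices d \<subseteq> (polys d :: 'n rpoly set)" by (auto simp: polys_def)
  show "(polys d :: 'n rpoly set) \<subseteq> span (monomial ` multiindices d)"
  proof
    fix p :: "'n rpoly" assume "p \<in> polys d"
    then have p: "(\<Sum>\<alpha>\<in>multiindices d. Poly_Mapping.single \<alpha> (lookup p \<alpha>)) = p"
      by (intro sum_single_lookup finite_multiindices) (simp add: polys_def)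
    have single: "Poly_Mapping.single \<alpha> (c :: real) = c *\<^sub>R monomial \<alpha>"
      for \<alpha> :: "'n multiindex" and c
      by (rule poly_mapping_eqI) (simp add: lookup_single when_def)
    have "(\<Sum>\<alpha>\<in>multiindices d. Poly_Mapping.single \<alpha> (lookup p \<alpha>)) \<in> span (monomial ` multiindices d)"
      by (subst single) (intro span_sum span_scale span_base imageI)
    then show "p \<in> span (monomial ` multiindices d)" by (simp only: p)
  qed
qed (rule subspace_polys)

section \<open>Flat moment sequences\<close>

definition moment_form :: "'n::finite multiseq \<Rightarrow> 'n rpoly \<Rightarrow> 'n rpoly \<Rightarrow> real" where
  "moment_form w p q = riesz w (p * q)"

interpretation moment_form: symmetric_form "moment_form w"
proof
  show "moment_form w p q = moment_form w q p" for p q by (simp only: moment_form_def mult.commute)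
qed (simp_all add: moment_form_def distrib_right riesz_add riesz_scale scaleR_mult_left_poly_mapping)

text \<open>
  Both sides are the dimension of the space of polynomials of degree at most \<open>m\<close> modulo null vectors:
  the columns of the moment matrix are the images of the monomials under \<open>p \<mapsto> (R\<^sub>w(x\<^sup>\<alpha> p))\<^sub>\<alpha>\<close>, a
  linear map whose kernel consists of the null vectors.
\<close>

lemma moment_matrix_rank_eq_card:
  assumes E: "moment_form.orthonormal w E" "E \<subseteq> polys m"
    and nul: "\<And>x z. x \<in> polys m \<Longrightarrow> z \<in> polys m \<Longrightarrow> moment_form w (x - moment_form.proj w E x) z = 0"
  shows "moment_matrix_rank w m = card E"
proof -
  define \<phi> where "\<phi> p = (\<Sum>\<alpha>\<in>multiindices m. Poly_Mapping.single \<alpha> (riesz w (monomial \<alpha> * p)))" for p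
  have lookup_\<phi>: "lookup (\<phi> p) \<alpha> = (if \<alpha> \<in> multiindices m then riesz w (monomial \<alpha> * p) else 0)" for p \<alpha>
    by (simp add: \<phi>_def lookup_sum lookup_single when_def finite_multiindices)
  have lin: "linear \<phi>"
    by (rule linearI; rule poly_mapping_eqI)
      (simp_all add: lookup_\<phi> lookup_add distrib_left riesz_add scaleR_mult_left_poly_mapping riesz_scale)
  have col: "mat_col (multiindices m) (moment_matrix w) \<beta> = \<phi> (monomial \<beta>)" for \<beta>
    by (simp add: mat_col_def moment_matrix_def \<phi>_def mult_single)
  have ker: "\<phi> p = \<phi> q" if "\<And>z. z \<in> polys m \<Longrightarrow> moment_form w (p - q) z = 0" for p q
  proof -
    have "\<phi> (p - q) = 0"
    proof (rule poly_mapping_eqI)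
      fix \<alpha>
      show "lookup (\<phi> (p - q)) \<alpha> = lookup 0 \<alpha>"
        using that[of "monomial \<alpha>"]
        by (simp add: lookup_\<phi> moment_form_def mult.commute mono_in_polys multiindices_def)
    qed
    then show ?thesis using linear_diff[OF lin, of p q] by simp
  qed
  have orth: "moment_form w p z = 0" if p: "\<phi> p = 0" and z: "z \<in> polys m" for p z
    using z unfolding span_monomials[symmetric]
  proof (induction rule: span_induct_alt)
    case (step c x y)
    then obtain \<alpha> where \<alpha>: "x = monomial \<alpha>" "\<alpha> \<in> multiindices m" by auto
    then have "moment_form w p x = 0"
      using arg_cong[OF p, of "\<lambda>q. lookup q \<alpha>"] by (simp add: lookup_\<phi> moment_form_def mult.commute)
    then show ?case using step(2) by (simp add: moment_form.add_right moment_form.scale_right)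
  qed simp
  have spanE: "span E \<subseteq> polys m" using E(2) subspace_polys by (rule span_minimal)
  have "\<phi> ` polys m = \<phi> ` span E"
  proof
    show "\<phi> ` polys m \<subseteq> \<phi> ` span E"
    proof
      fix y assume "y \<in> \<phi> ` polys m"
      then obtain x where x: "y = \<phi> x" "x \<in> polys m" by blast
      have "\<phi> x = \<phi> (moment_form.proj w E x)" by (rule ker) (rule nul[OF x(2)])
      then show "y \<in> \<phi> ` span E" using x moment_form.proj_in_span by blast
    qed
  qed (use spanE in blast)
  have inj: "inj_on \<phi> (span E)"
  proof (rule inj_onI)
    fix x y assume xy: "x \<in> span E" "y \<in> span E" "\<phi> x = \<phi> y"
    then have "\<phi> (x - y) = 0" "x - y \<in> span E" by (simp_all add: linear_diff[OF lin] span_diff)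
    then have "x - y = 0"
      using moment_form.form_definite_span[OF E(1)] orth spanE by blast
    then show "x = y" by simp
  qed
  have ind: "independent (\<phi> ` E)"
    by (rule linear_independent_injective_image[OF lin moment_form.orthonormal_independent[OF E(1)] inj])
  have "moment_matrix_rank w m = dim (\<phi> ` monomial ` multiindices m)"
    unfolding moment_matrix_rank_def mat_rank_def image_image col ..
  also have "\<dots> = card (\<phi> ` E)"
  proof (rule real_vector.dim_eq_card[OF _ ind])
    show "span (\<phi> ` E) = span (\<phi> ` monomial ` multiindices m)"
      unfolding linear_span_image[OF lin] span_monomials using \<open>\<phi> ` polys m = \<phi> ` span E\<close> by simp
  qed
  also have "\<dots> = card E"
    using inj by (intro card_image inj_on_subset[OF inj]) (auto intro: span_base)
  finally show ?thesis .
qed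

locale flat_moments =
  fixes w :: "'n::finite multiseq" and d k :: nat
  assumes psd: "p \<in> polys d \<Longrightarrow> 0 \<le> riesz w (p * p)"
    and k_less_d: "k < d"
    and rank_eq: "moment_matrix_rank w k = moment_matrix_rank w d"
begin

definition null :: "'n rpoly \<Rightarrow> bool" where
  "null p \<longleftrightarrow> p \<in> polys d \<and> (\<forall>z\<in>polys d. moment_form w p z = 0)"

abbreviation "X i \<equiv> monomial (Poly_Mapping.single i 1) :: 'n rpoly"

lemma nullD: "null p \<Longrightarrow> z \<in> polys d \<Longrightarrow> moment_form w p z = 0"
  by (simp add: null_def)

lemma null_add: "null p \<Longrightarrow> null q \<Longrightarrow> null (p + q)"
  by (simp add: null_def moment_form.add_left subspace_add[OF subspace_polys])

lemma null_scale: "null p \<Longrightarrow> null (c *\<^sub>R p)"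
  by (simp add: null_def moment_form.scale_left subspace_scale[OF subspace_polys])

lemma null_zero: "null 0"
  by (simp add: null_def subspace_0[OF subspace_polys])

lemma null_sum: "(\<And>i. i \<in> I \<Longrightarrow> null (f i)) \<Longrightarrow> null (\<Sum>i\<in>I. f i)"
  by (induction I rule: infinite_finite_induct) (auto simp: null_add null_zero)

lemma X_mult_polys: "p \<in> polys m \<Longrightarrow> m < l \<Longrightarrow> X i * p \<in> polys l"
  using polys_mult[of "X i" 1 p m] polys_mono[of "1 + m" l] mono_in_polys[of "Poly_Mapping.single i 1" 1 1]
  by auto

text \<open>
  Gram--Schmidt on the monomials of degree at most \<open>k\<close>, continued with those of degree at most \<open>d\<close>,
  adds no vector in the second stage, because the numbers of vectors are the two ranks.
\<close>

lemma orthonormal_modulo_null: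
  obtains E where "moment_form.orthonormal w E" "E \<subseteq> polys k" "card E = moment_matrix_rank w k"
    "\<And>x. x \<in> polys d \<Longrightarrow> null (x - moment_form.proj w E x)"
proof -
  have psd': "0 \<le> moment_form w x x" if "x \<in> polys d" for x
    using psd[OF that] by (simp add: moment_form_def)
  have fin: "finite (monomial ` multiindices m)" for m
    by (simp add: finite_multiindices)
  have kd: "(polys k :: 'n rpoly set) \<subseteq> polys d" using k_less_d by (intro polys_mono) simp
  have sub: "monomial ` multiindices k \<subseteq> (polys d :: 'n rpoly set)"
    "monomial ` multiindices d \<subseteq> (polys d :: 'n rpoly set)"
    using span_superset[of "monomial ` multiindices k"] span_superset[of "monomial ` multiindices d"]
      kd unfolding span_monomials by auto
  obtain E where E: "moment_form.orthonormal w E" "E \<subseteq> polys k"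
    "\<forall>x\<in>polys k. \<forall>z\<in>polys d. moment_form w (x - moment_form.proj w E x) z = 0"
    using moment_form.gram_schmidt_extend[OF subspace_polys psd' fin sub(1), of "{}"]
    by (auto simp: moment_form.orthonormal_def span_monomials)
  have Ed: "E \<subseteq> polys d" using E(2) kd by blast
  obtain F where F: "moment_form.orthonormal w F" "E \<subseteq> F" "F \<subseteq> span (E \<union> monomial ` multiindices d)"
    "\<forall>x\<in>polys d. \<forall>z\<in>polys d. moment_form w (x - moment_form.proj w F x) z = 0"
    using moment_form.gram_schmidt_extend[OF subspace_polys psd' fin sub(2) E(1) Ed]
    by (auto simp: span_monomials)
  have Fd: "F \<subseteq> polys d"
    using F(3) span_minimal[OF _ subspace_polys, of "E \<union> monomial ` multiindices d" d] Ed sub(2) by blast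
  have "card E = moment_matrix_rank w k"
    by (rule moment_matrix_rank_eq_card[OF E(1,2), symmetric]) (use E(3) kd in blast)
  moreover have "card F = moment_matrix_rank w d"
    by (rule moment_matrix_rank_eq_card[OF F(1) Fd, symmetric]) (use F(4) in blast)
  ultimately have "E = F"
    using rank_eq F(1,2) by (metis card_subset_eq moment_form.orthonormal_finite)
  have "null (x - moment_form.proj w E x)" if "x \<in> polys d" for x
  proof -
    have "moment_form.proj w E x \<in> polys d"
      using moment_form.proj_in_span[of w E x] span_minimal[OF Ed subspace_polys] by blast
    then show ?thesis
      using that F(4) \<open>E = F\<close> by (simp add: null_def subspace_diff[OF subspace_polys])
  qed
  then show thesis using that E \<open>card E = _\<close> by blast
qed

text \<open>
  Multiplication by the variables, compressed to the span of the orthonormal family, is a family of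
  self-adjoint operators. They commute because products with a variable stay within degree \<open>d\<close>, where
  the compression changes nothing modulo null vectors.
\<close>

lemma joint_eigenbasis:
  obtains E and \<xi> :: "'n rpoly \<Rightarrow> real ^ 'n" where
    "moment_form.orthonormal w E" "E \<subseteq> polys k" "card E = moment_matrix_rank w k"
    "\<And>x. x \<in> polys d \<Longrightarrow> null (x - moment_form.proj w E x)"
    "\<And>e i. e \<in> E \<Longrightarrow> null (X i * e - (\<xi> e $ i) *\<^sub>R e)"
proof -
  obtain E where E: "moment_form.orthonormal w E" "E \<subseteq> polys k" "card E = moment_matrix_rank w k"
    and nul: "\<And>x. x \<in> polys d \<Longrightarrow> null (x - moment_form.proj w E x)"
    using orthonormal_modulo_null by blast
  define T where "T i x = moment_form.proj w E (X i * x)" for i x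
  have spanE: "span E \<subseteq> polys k" using E(2) subspace_polys by (rule span_minimal)
  have Xd: "X i * x \<in> polys d" if "x \<in> span E" for i x
    using X_mult_polys[OF _ k_less_d] spanE that by blast
  have T_in: "T i x \<in> span E" for i x
    unfolding T_def by (rule moment_form.proj_in_span)
  have T_form: "moment_form w (T i x) y = moment_form w (X i * x) y" if "y \<in> span E" for i x y
    unfolding T_def by (rule moment_form.form_proj_span[OF E(1) that])
  have shift: "moment_form w (X i * x) y = moment_form w x (X i * y)" for i x y
    by (simp add: moment_form_def mult_ac)
  have lin: "linear (T i)" for i
    by (rule linearI)
      (simp_all add: T_def distrib_left scaleR_mult_left_poly_mapping
        linear_add[OF moment_form.proj_linear] linear_cmul[OF moment_form.proj_linear])
  have adj: "moment_form w (T i x) y = moment_form w x (T i y)" if "x \<in> span E" "y \<in> span E" for i x y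
    using T_form[OF that(1), of i y] T_form[OF that(2), of i x] shift[of i x y]
    by (simp add: moment_form.sym)
  have TT: "moment_form w (T i (T j x)) y = riesz w (X i * X j * x * y)"
    if x: "x \<in> span E" and y: "y \<in> span E" for i j x y
  proof -
    have "moment_form w (T i (T j x)) y = moment_form w (T j x) (X i * y)"
      using T_form[OF y] shift by simp
    also have "\<dots> = moment_form w (X j * x) (X i * y)"
      using nullD[OF nul[OF Xd[OF x]] Xd[OF y]] by (simp add: T_def moment_form.diff_left)
    finally show ?thesis by (simp add: moment_form_def mult_ac)
  qed
  have comm: "T i (T j x) = T j (T i x)" if x: "x \<in> span E" for i j x
  proof -
    have "moment_form w (T i (T j x) - T j (T i x)) y = 0" if "y \<in> span E" for y
      using TT[OF x that, of i j] TT[OF x that, of j i] by (simp add: moment_form.diff_left mult_ac)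
    then show ?thesis
      using moment_form.form_definite_span[OF E(1), of "T i (T j x) - T j (T i x)"] T_in
      by (simp add: span_diff)
  qed
  have "\<exists>G. moment_form.orthonormal w G \<and> span G = span E \<and> (\<forall>e\<in>G. \<forall>i. \<exists>l. T i e = l *\<^sub>R e)"
    by (rule moment_form.joint_diagonalization[OF lin E(1) T_in adj comm])
  then obtain G where G: "moment_form.orthonormal w G" "span G = span E"
    and eig: "\<forall>e\<in>G. \<forall>i. \<exists>l. T i e = l *\<^sub>R e" by blast
  define \<xi> where "\<xi> e = (\<chi> i. SOME l. T i e = l *\<^sub>R e)" for e
  have T_eig: "T i e = (\<xi> e $ i) *\<^sub>R e" if "e \<in> G" for e i
    using eig that unfolding \<xi>_def vec_lambda_beta by (metis (mono_tags, lifting) someI_ex)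
  have pr: "moment_form.proj w G x = moment_form.proj w E x" for x
  proof -
    have "moment_form w (moment_form.proj w E x) g = moment_form w x g" if "g \<in> G" for g
      using that G by (intro moment_form.form_proj_span[OF E(1)]) (metis span_base)
    then have "moment_form.proj w G (moment_form.proj w E x) = moment_form.proj w G x"
      unfolding moment_form.proj_def[of w G] by simp
    then show ?thesis
      using moment_form.proj_span[OF G(1)] moment_form.proj_in_span[of w E x] G(2) by metis
  qed
  show thesis
  proof (rule that[of G \<xi>])
    show "moment_form.orthonormal w G" by (fact G)
    show "G \<subseteq> polys k" using G spanE span_superset[of G] by blast
    show "card G = moment_matrix_rank w k"
      using E G moment_form.dim_span_orthonormal by metis
    show "null (x - moment_form.proj w G x)" if "x \<in> polys d" for x
      using nul[OF that] pr by simp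
    show "null (X i * e - (\<xi> e $ i) *\<^sub>R e)" if "e \<in> G" for e i
    proof -
      have "e \<in> span E" using that G span_base by metis
      then have "null (X i * e - T i e)" unfolding T_def by (intro nul Xd)
      then show ?thesis by (simp only: T_eig[OF that])
    qed
  qed
qed

end

text \<open>A flat moment sequence together with a choice of joint eigenvectors.\<close>

locale flat_eigenbasis = flat_moments w d k
  for w :: "'n::finite multiseq" and d k +
  fixes E :: "'n rpoly set" and \<xi> :: "'n rpoly \<Rightarrow> real ^ 'n"
  assumes orthonormal: "moment_form.orthonormal w E"
    and E_polys: "E \<subseteq> polys k"
    and null_proj: "x \<in> polys d \<Longrightarrow> null (x - moment_form.proj w E x)"
    and null_eigen: "e \<in> E \<Longrightarrow> null (X i * e - (\<xi> e $ i) *\<^sub>R e)"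
begin

text \<open>The coefficients of the constant polynomial 1 in \<open>E\<close>; their squares will be the masses of the points.\<close>

definition c :: "'n rpoly \<Rightarrow> real" where
  "c e = riesz w e"

lemma finite_E: "finite E"
  using orthonormal by (rule moment_form.orthonormal_finite)

lemma E_polys_d: "E \<subseteq> polys d"
  using E_polys polys_mono[of k d] k_less_d by auto

lemma span_E_polys: "span E \<subseteq> polys k"
  using E_polys subspace_polys by (rule span_minimal)

text \<open>
  A polynomial of degree \<open>d\<close> may be replaced by its projection, of degree at most \<open>k < d\<close>, so that
  the factor \<open>x\<^sub>i\<close> can be moved to the other side without leaving degree \<open>d\<close>.
\<close>

lemma null_X_mult:
  assumes p: "null p" "p \<in> polys m" and m: "m < d"
  shows "null (X i * p)"
proof -
  have Xp: "X i * p \<in> polys d" using p(2) m by (rule X_mult_polys)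
  have "moment_form w (X i * p) z = 0" if z: "z \<in> polys d" for z
  proof -
    let ?z = "moment_form.proj w E z"
    have zk: "?z \<in> polys k" using moment_form.proj_in_span span_E_polys by blast
    have "moment_form w (X i * p) z = moment_form w (X i * p) ?z"
      using nullD[OF null_proj[OF z] Xp] moment_form.sym[of w "X i * p"]
      by (simp add: moment_form.diff_left)
    also have "\<dots> = moment_form w p (X i * ?z)"
      by (simp add: moment_form_def mult_ac)
    also have "\<dots> = 0"
      using nullD[OF p(1) X_mult_polys[OF zk k_less_d]] .
    finally show ?thesis .
  qed
  then show ?thesis using Xp by (simp add: null_def)
qed

text \<open>
  Modulo null vectors, multiplying \<open>1 = (\<Sum>e\<in>E. c e e)\<close> by a variable multiplies each \<open>e\<close> by its
  eigenvalue.
\<close>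

lemma null_monomial:
  "mdeg \<alpha> \<le> d \<Longrightarrow> null (monomial \<alpha> - (\<Sum>e\<in>E. (c e * mpow (\<xi> e) \<alpha>) *\<^sub>R e))"
proof (induction "mdeg \<alpha>" arbitrary: \<alpha>)
  case 0
  have \<alpha>: "\<alpha> = 0"
    using 0(1) by (intro poly_mapping_eqI) (simp add: mdeg_def)
  have "null (1 - moment_form.proj w E 1)"
    by (intro null_proj) (simp add: mono_in_polys flip: single_one)
  moreover have "moment_form.proj w E 1 = (\<Sum>e\<in>E. (c e * mpow (\<xi> e) \<alpha>) *\<^sub>R e)"
    by (simp add: moment_form.proj_def moment_form_def c_def \<alpha>)
  ultimately show ?case by (simp add: \<alpha>)
next
  case (Suc n)
  obtain i \<beta> where \<beta>: "\<alpha> = Poly_Mapping.single i 1 + \<beta>" "mdeg \<beta> = n"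
    using mdeg_Suc_split Suc(2)[symmetric] by blast
  let ?s = "\<Sum>e\<in>E. (c e * mpow (\<xi> e) \<beta>) *\<^sub>R e"
  have n: "n < d" using Suc by simp
  have "null (monomial \<beta> - ?s)" using Suc \<beta> by simp
  moreover have "monomial \<beta> - ?s \<in> polys (max n k)"
  proof (rule subspace_diff[OF subspace_polys])
    show "monomial \<beta> \<in> polys (max n k)" using \<beta> by (simp add: mono_in_polys)
    have "E \<subseteq> polys (max n k)" using E_polys polys_mono[of k "max n k"] by auto
    then show "?s \<in> polys (max n k)"
      by (intro subspace_sum[OF subspace_polys] subspace_scale[OF subspace_polys]) auto
  qed
  ultimately have 1: "null (X i * (monomial \<beta> - ?s))"
    by (rule null_X_mult) (use n k_less_d in simp)
  have 2: "null (\<Sum>e\<in>E. (c e * mpow (\<xi> e) \<beta>) *\<^sub>R (X i * e - (\<xi> e $ i) *\<^sub>R e))"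
    by (intro null_sum null_scale null_eigen)
  have "X i * (monomial \<beta> - ?s) + (\<Sum>e\<in>E. (c e * mpow (\<xi> e) \<beta>) *\<^sub>R (X i * e - (\<xi> e $ i) *\<^sub>R e)) =
      monomial \<alpha> - (\<Sum>e\<in>E. (c e * mpow (\<xi> e) \<alpha>) *\<^sub>R e)"
    by (simp add: \<beta>(1) right_diff_distrib mult_single sum_distrib_left scaleR_mult_left_poly_mapping
        scaleR_diff_right sum_subtractf mpow_add mult_ac add.commute[of \<beta>])
  then show ?case using null_add[OF 1 2] by simp
qed

lemma null_poly:
  assumes "p \<in> polys d"
  shows "null (p - (\<Sum>e\<in>E. (c e * peval p (\<xi> e)) *\<^sub>R e))"
proof -
  let ?I = "multiindices d :: 'n multiindex set"
  have keys: "keys p \<subseteq> ?I" using assms by (simp add: polys_def)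
  have ev: "peval p (\<xi> e) = (\<Sum>\<alpha>\<in>?I. lookup p \<alpha> * mpow (\<xi> e) \<alpha>)" for e
    unfolding peval_eq_riesz by (rule riesz_superset[OF finite_multiindices keys])
  have "p = (\<Sum>\<alpha>\<in>?I. Poly_Mapping.single \<alpha> (lookup p \<alpha>))"
    by (rule sum_single_lookup[OF finite_multiindices keys, symmetric])
  also have "\<dots> = (\<Sum>\<alpha>\<in>?I. lookup p \<alpha> *\<^sub>R monomial \<alpha>)"
    by (intro sum.cong refl poly_mapping_eqI) (simp add: lookup_single when_def)
  finally have p: "p = (\<Sum>\<alpha>\<in>?I. lookup p \<alpha> *\<^sub>R monomial \<alpha>)" .
  have "(\<Sum>e\<in>E. (c e * peval p (\<xi> e)) *\<^sub>R e) =
      (\<Sum>\<alpha>\<in>?I. lookup p \<alpha> *\<^sub>R (\<Sum>e\<in>E. (c e * mpow (\<xi> e) \<alpha>) *\<^sub>R e))"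
    unfolding ev scaleR_sum_right sum_distrib_left scaleR_sum_left
    by (subst sum.swap) (simp add: mult_ac)
  then have "p - (\<Sum>e\<in>E. (c e * peval p (\<xi> e)) *\<^sub>R e) =
      (\<Sum>\<alpha>\<in>?I. lookup p \<alpha> *\<^sub>R (monomial \<alpha> - (\<Sum>e\<in>E. (c e * mpow (\<xi> e) \<alpha>) *\<^sub>R e)))"
    by (subst p) (simp add: scaleR_diff_right sum_subtractf)
  also have "null \<dots>"
    by (intro null_sum null_scale null_monomial) (simp add: multiindices_def)
  finally show ?thesis .
qed

text \<open>The basis vectors are, up to the factors \<open>c\<close>, the Lagrange polynomials of the points \<open>\<xi>\<close>.\<close>

lemma lagrange:
  assumes "e \<in> E" "f \<in> E"
  shows "c e * peval f (\<xi> e) = (if e = f then 1 else 0)"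
proof -
  have f: "f \<in> polys d" "e \<in> polys d" using assms E_polys_d by auto
  have "moment_form w f e = c e * peval f (\<xi> e)"
    using nullD[OF null_poly[OF f(1)] f(2)] moment_form.form_orthonormal_sum[OF orthonormal assms(1)]
    by (simp add: moment_form.diff_left)
  then show ?thesis using orthonormal assms by (auto simp: moment_form.orthonormal_def)
qed

lemma c_nonzero: "e \<in> E \<Longrightarrow> c e \<noteq> 0"
  using lagrange[of e e] by auto

lemma inj_on_\<xi>: "inj_on \<xi> E"
proof (rule inj_onI)
  fix e f assume ef: "e \<in> E" "f \<in> E" "\<xi> e = \<xi> f"
  then have "peval f (\<xi> e) \<noteq> 0" using lagrange[of f f] by auto
  then have "c e * peval f (\<xi> e) \<noteq> 0" using c_nonzero ef(1) by simp
  then show "e = f" using lagrange[OF ef(1,2)] by (auto split: if_splits)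
qed

text \<open>
  A multi-index of degree at most \<open>2d\<close> is a sum of two of degree at most \<open>d\<close>, and the moment is the form
  applied to the two monomials, each expanded in \<open>E\<close>.
\<close>

lemma moments_eq_sum:
  assumes "mdeg \<alpha> \<le> 2 * d"
  shows "w \<alpha> = (\<Sum>e\<in>E. (c e)\<^sup>2 * mpow (\<xi> e) \<alpha>)"
proof -
  obtain \<beta> \<gamma> where \<alpha>: "\<alpha> = \<beta> + \<gamma>" and le: "mdeg \<beta> \<le> d" "mdeg \<gamma> \<le> d"
    using mdeg_split[of \<alpha> d d] assms by auto
  let ?b = "\<Sum>e\<in>E. (c e * mpow (\<xi> e) \<beta>) *\<^sub>R e"
  have \<gamma>: "monomial \<gamma> \<in> polys d" using le by (simp add: mono_in_polys)
  have "w \<alpha> = moment_form w (monomial \<beta>) (monomial \<gamma>)"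
    by (simp add: moment_form_def mult_single \<alpha>)
  also have "\<dots> = moment_form w ?b (monomial \<gamma>)"
    using nullD[OF null_monomial[OF le(1)] \<gamma>] by (simp add: moment_form.diff_left)
  also have "\<dots> = (\<Sum>e\<in>E. c e * mpow (\<xi> e) \<beta> * moment_form w e (monomial \<gamma>))"
    by (simp add: moment_form.sum_left moment_form.scale_left)
  also have "\<dots> = (\<Sum>e\<in>E. (c e)\<^sup>2 * mpow (\<xi> e) \<alpha>)"
  proof (rule sum.cong[OF refl])
    fix e assume e: "e \<in> E"
    then have "moment_form w (monomial \<gamma>) e = c e * mpow (\<xi> e) \<gamma>"
      using nullD[OF null_monomial[OF le(2)], of e] E_polys_d
        moment_form.form_orthonormal_sum[OF orthonormal e]
      by (auto simp: moment_form.diff_left)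
    then show "c e * mpow (\<xi> e) \<beta> * moment_form w e (monomial \<gamma>) = (c e)\<^sup>2 * mpow (\<xi> e) \<alpha>"
      by (simp add: moment_form.sym[of w e] \<alpha> mpow_add power2_eq_square)
  qed
  finally show ?thesis .
qed

definition \<mu> :: "(real ^ 'n) measure" where
  "\<mu> = distr (point_measure E (\<lambda>e. ennreal ((c e)\<^sup>2))) borel \<xi>"

lemma sets_\<mu> [simp]: "sets \<mu> = sets borel"
  by (simp add: \<mu>_def)

lemma emeasure_\<mu>:
  assumes "A \<in> sets borel"
  shows "emeasure \<mu> A = (\<Sum>e\<in>{e\<in>E. \<xi> e \<in> A}. ennreal ((c e)\<^sup>2))"
proof -
  have "emeasure \<mu> A = emeasure (point_measure E (\<lambda>e. ennreal ((c e)\<^sup>2))) (\<xi> -` A \<inter> E)"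
    unfolding \<mu>_def by (subst emeasure_distr) (use assms in \<open>simp_all add: space_point_measure\<close>)
  also have "\<dots> = (\<Sum>e\<in>\<xi> -` A \<inter> E. ennreal ((c e)\<^sup>2))"
    by (rule emeasure_point_measure_finite) (auto simp: finite_E)
  also have "\<xi> -` A \<inter> E = {e\<in>E. \<xi> e \<in> A}" by auto
  finally show ?thesis .
qed

lemma supp_\<mu>: "supp \<mu> = \<xi> ` E"
proof
  show "supp \<mu> \<subseteq> \<xi> ` E"
  proof
    fix x assume x: "x \<in> supp \<mu>"
    show "x \<in> \<xi> ` E"
    proof (rule ccontr)
      assume nx: "x \<notin> \<xi> ` E"
      have "open (- \<xi> ` E)" using finite_E by (simp add: finite_imp_closed open_Compl)
      then have "emeasure \<mu> (- \<xi> ` E) > 0" using x nx by (simp add: supp_def)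
      moreover have "{e\<in>E. \<xi> e \<in> - \<xi> ` E} = {}" by auto
      then have "emeasure \<mu> (- \<xi> ` E) = 0"
        using \<open>open (- \<xi> ` E)\<close> by (simp only: emeasure_\<mu> borel_open sum.empty)
      ultimately show False by simp
    qed
  qed
  show "\<xi> ` E \<subseteq> supp \<mu>"
  proof
    fix x assume "x \<in> \<xi> ` E"
    then obtain e where e: "e \<in> E" "x = \<xi> e" by blast
    have "emeasure \<mu> U > 0" if U: "open U" "x \<in> U" for U
    proof -
      have "0 < ennreal ((c e)\<^sup>2)" using c_nonzero[OF e(1)] by simp
      also have "\<dots> \<le> (\<Sum>e\<in>{e\<in>E. \<xi> e \<in> U}. ennreal ((c e)\<^sup>2))"
        using e U finite_E by (intro member_le_sum) auto
      finally show ?thesis using U by (simp add: emeasure_\<mu>)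
    qed
    then show "x \<in> supp \<mu>" by (simp add: supp_def)
  qed
qed

lemma atomic_\<mu>: "atomic (card E) \<mu>"
  by (simp add: atomic_def supp_\<mu> finite_E card_image inj_on_\<xi>)

lemma representing_\<mu>: "representing_measure d w \<mu>"
  unfolding representing_measure_def
proof (intro conjI allI impI)
  show "finite_measure \<mu>"
  proof (rule finite_measureI)
    have "space \<mu> = UNIV" by (simp add: \<mu>_def)
    then show "emeasure \<mu> (space \<mu>) \<noteq> \<infinity>" using finite_E by (simp add: emeasure_\<mu>)
  qed
  fix \<alpha> :: "'n multiindex" assume \<alpha>: "mdeg \<alpha> \<le> 2 * d"
  have [measurable]: "(\<lambda>x. mpow x \<alpha>) \<in> borel_measurable borel"
    unfolding mpow_def by measurable
  show "integrable \<mu> (\<lambda>x. mpow x \<alpha>)"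
    unfolding \<mu>_def by (subst integrable_distr_eq) (auto intro!: integrable_point_measure_finite finite_E)
  show "w \<alpha> = (\<integral>x. mpow x \<alpha> \<partial>\<mu>)"
    unfolding \<mu>_def using moments_eq_sum[OF \<alpha>]
    by (subst integral_distr) (auto simp: lebesgue_integral_point_measure_finite finite_E)
qed simp

text \<open>
  A null polynomial vanishes almost everywhere for every representing measure. Applied to the
  polynomials \<open>(x\<^sub>i - \<xi>\<^sub>e\<^sub>,\<^sub>i) e\<close> and \<open>1 - (\<Sum>e\<in>E. c\<^sub>e e)\<close> this confines the measure to the points \<open>\<xi>\<^sub>e\<close>,
  on which the squares of the Lagrange polynomials are indicator functions.
\<close>

lemma representing_measure_unique:
  assumes \<mu>': "representing_measure d w \<mu>'"
  shows "\<mu>' = \<mu>"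
proof (rule measure_eqI)
  have sets: "sets \<mu>' = sets borel" and fin: "finite_measure \<mu>'"
    using \<mu>' by (auto simp: representing_measure_def)
  interpret finite_measure \<mu>' by (fact fin)
  note [measurable_cong] = sets
  have int: "integrable \<mu>' (peval p)" "(\<integral>x. peval p x \<partial>\<mu>') = riesz w p" if "p \<in> polys (2 * d)" for p
  proof -
    have "\<And>\<alpha>. \<alpha> \<in> keys p \<Longrightarrow> integrable \<mu>' (\<lambda>x. mpow x \<alpha>) \<and> w \<alpha> = (\<integral>x. mpow x \<alpha> \<partial>\<mu>')"
      using that \<mu>' by (auto simp: polys_def multiindices_def representing_measure_def)
    then show "integrable \<mu>' (peval p)" "(\<integral>x. peval p x \<partial>\<mu>') = riesz w p"
      unfolding peval_def[abs_def] riesz_def by (auto simp: Bochner_Integration.integral_sum)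
  qed
  have int_sq: "integrable \<mu>' (\<lambda>x. (peval p x)\<^sup>2)" "(\<integral>x. (peval p x)\<^sup>2 \<partial>\<mu>') = moment_form w p p"
    if "p \<in> polys d" for p
  proof -
    have "p * p \<in> polys (2 * d)" using polys_mult[OF that that] by (simp add: mult_2)
    moreover have "peval (p * p) = (\<lambda>x. (peval p x)\<^sup>2)"
      by (simp add: fun_eq_iff peval_mult power2_eq_square)
    ultimately show "integrable \<mu>' (\<lambda>x. (peval p x)\<^sup>2)"
      "(\<integral>x. (peval p x)\<^sup>2 \<partial>\<mu>') = moment_form w p p"
      using int[of "p * p"] by (simp_all add: moment_form_def)
  qed
  have ae_null: "AE x in \<mu>'. peval p x = 0" if "null p" for p
  proof -
    have p: "p \<in> polys d" using that by (simp add: null_def)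
    have "(\<integral>x. (peval p x)\<^sup>2 \<partial>\<mu>') = 0" using int_sq(2)[OF p] nullD[OF that p] by simp
    then have "AE x in \<mu>'. (peval p x)\<^sup>2 = 0"
      using integral_nonneg_eq_0_iff_AE[OF int_sq(1)[OF p]] by simp
    then show ?thesis by simp
  qed
  have ev_diff: "peval (p - q) x = peval p x - peval q x" for p q x
    by (simp add: peval_eq_riesz riesz_diff)
  have "AE x in \<mu>'. \<forall>e\<in>E. \<forall>i\<in>UNIV. peval (X i * e - (\<xi> e $ i) *\<^sub>R e) x = 0"
    by (intro AE_finite_allI finite_E finite_class.finite_UNIV ae_null null_eigen)
  moreover have "1 \<in> polys d" by (simp add: mono_in_polys flip: single_one)
  then have "AE x in \<mu>'. peval (1 - (\<Sum>e\<in>E. (c e * peval 1 (\<xi> e)) *\<^sub>R e)) x = 0"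
    by (intro ae_null null_poly)
  ultimately have ae_pts: "AE x in \<mu>'. x \<in> \<xi> ` E"
  proof eventually_elim
    case (elim x)
    have "(\<Sum>e\<in>E. c e * peval e x) = 1"
      using elim(2) by (simp add: ev_diff) (simp add: peval_eq_riesz riesz_sum riesz_scale)
    then obtain e where e: "e \<in> E" "peval e x \<noteq> 0"
      by (metis (no_types, lifting) mult_zero_right sum.neutral zero_neq_one)
    have "x $ i = \<xi> e $ i" for i
    proof -
      have "peval (X i * e - (\<xi> e $ i) *\<^sub>R e) x = (x $ i - \<xi> e $ i) * peval e x"
        by (simp add: ev_diff peval_mult left_diff_distrib) (simp add: peval_eq_riesz riesz_scale)
      then show ?thesis using elim(1) e by auto
    qed
    then have "x = \<xi> e" by (simp add: vec_eq_iff)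
    then show ?case using e by blast
  qed
  have point: "emeasure \<mu>' {\<xi> e} = ennreal ((c e)\<^sup>2)" if e: "e \<in> E" for e
  proof -
    have "AE x in \<mu>'. indicator {\<xi> e} x = (c e)\<^sup>2 * (peval e x)\<^sup>2"
      using ae_pts
    proof eventually_elim
      case (elim x)
      then obtain f where f: "f \<in> E" "x = \<xi> f" by blast
      show ?case
      proof (cases "f = e")
        case True
        then show ?thesis using lagrange[OF e e] f by (simp flip: power_mult_distrib)
      next
        case False
        then have "peval e x = 0" using lagrange[OF f(1) e] c_nonzero[OF f(1)] f(2) by simp
        moreover have "x \<noteq> \<xi> e" using False f e inj_on_\<xi> by (auto dest: inj_onD)
        ultimately show ?thesis by simp
      qed
    qed
    then have "(\<integral>x. indicator {\<xi> e} x \<partial>\<mu>') = (\<integral>x. (c e)\<^sup>2 * (peval e x)\<^sup>2 \<partial>\<mu>')"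
      using int_sq(1)[of e] e E_polys_d by (intro integral_cong_AE) auto
    also have "\<dots> = (c e)\<^sup>2"
      using int_sq(2)[of e] e E_polys_d orthonormal by (auto simp: moment_form.orthonormal_def)
    finally have "measure \<mu>' {\<xi> e} = (c e)\<^sup>2"
      using sets sets_eq_imp_space_eq[OF sets] by simp
    then show ?thesis by (simp add: emeasure_eq_measure)
  qed
  show "sets \<mu>' = sets \<mu>" using sets by simp
  fix A assume A: "A \<in> sets \<mu>'"
  have "emeasure \<mu>' A = emeasure \<mu>' (A \<inter> \<xi> ` E)"
  proof (rule emeasure_eq_AE)
    show "AE x in \<mu>'. x \<in> A \<longleftrightarrow> x \<in> A \<inter> \<xi> ` E" using ae_pts by eventually_elim auto
    have "\<xi> ` E \<in> sets \<mu>'"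
      unfolding sets using finite_E by (intro borel_closed finite_imp_closed) simp
    then show "A \<inter> \<xi> ` E \<in> sets \<mu>'" using A by simp
  qed (fact A)
  also have "A \<inter> \<xi> ` E = \<xi> ` {e\<in>E. \<xi> e \<in> A}" by auto
  also have "emeasure \<mu>' \<dots> = (\<Sum>x\<in>\<xi> ` {e\<in>E. \<xi> e \<in> A}. emeasure \<mu>' {x})"
    by (rule emeasure_eq_sum_singleton) (use finite_E sets in auto)
  also have "\<dots> = (\<Sum>e\<in>{e\<in>E. \<xi> e \<in> A}. emeasure \<mu>' {\<xi> e})"
    by (rule sum.reindex[simplified]) (rule inj_on_subset[OF inj_on_\<xi>], auto)
  also have "\<dots> = emeasure \<mu> A"
    using A by (simp add: emeasure_\<mu> sets point)
  finally show "emeasure \<mu>' A = emeasure \<mu> A" .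
qed

end

section \<open>Carleman's inequality and orthogonal polynomials\<close>

lemma prod_le_mean_power:
  fixes a :: "'i \<Rightarrow> real"
  assumes "finite I" "I \<noteq> {}" and nn: "\<And>i. i \<in> I \<Longrightarrow> 0 \<le> a i"
  shows "(\<Prod>i\<in>I. a i) \<le> ((\<Sum>i\<in>I. a i) / card I) ^ card I"
proof -
  define m where "m = (\<Sum>i\<in>I. a i) / card I"
  have c: "real (card I) > 0" using assms by (simp add: card_gt_0_iff)
  show ?thesis
  proof (cases "m = 0")
    case True
    then have "\<forall>i\<in>I. a i = 0" using assms c by (simp add: m_def sum_nonneg_eq_0_iff)
    then have "(\<Prod>i\<in>I. a i) = 0" using assms by (auto simp: prod_zero_iff)
    moreover have "0 \<le> (\<Sum>i\<in>I. a i)" by (intro sum_nonneg nn)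
    ultimately show ?thesis by simp
  next
    case False
    moreover have "m \<ge> 0" unfolding m_def by (intro divide_nonneg_nonneg sum_nonneg nn) auto
    ultimately have m: "m > 0" by simp
    have "(\<Prod>i\<in>I. a i / m) \<le> (\<Prod>i\<in>I. exp (a i / m - 1))"
      by (intro prod_mono) (use nn m exp_ge_add_one_self[of "a _ / m - 1"] in auto)
    also have "\<dots> = exp ((\<Sum>i\<in>I. a i) / m - card I)"
      using \<open>finite I\<close> by (simp add: exp_sum[symmetric] sum_subtractf sum_divide_distrib)
    also have "\<dots> = 1" using c m by (auto simp: m_def field_simps)
    finally have "(\<Prod>i\<in>I. a i) \<le> m ^ card I"
      using m by (simp add: prod_dividef)
    then show ?thesis by (simp add: m_def)
  qed
qed

lemma power_le_exp_fact: "real n ^ n \<le> exp (real n) * fact n"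
proof -
  have "real n ^ n /\<^sub>R fact n \<le> suminf (\<lambda>k. real n ^ k /\<^sub>R fact k)"
    using sum_le_suminf[OF summable_exp_generic[of "real n"], of "{n}"] by simp
  then show ?thesis by (simp add: exp_def field_simps)
qed

lemma power_powr_inverse:
  fixes z :: real
  assumes "z \<ge> 0" "n > 0"
  shows "(z ^ n) powr (1 / real n) = z"
  using assms by (cases "z = 0") (simp_all add: powr_powr flip: powr_realpow)

text \<open>
  Carleman's inequality without its optimal constant: the arithmetic--geometric mean inequality for
  the numbers \<open>(i + 1) x\<^sub>i\<close> bounds the geometric mean of \<open>x\<^sub>0, \<dots>, x\<^sub>n\<close> by a constant times
  \<open>(n + 1)\<^sup>-\<^sup>2 (\<Sum>i\<le>n. (i + 1) x\<^sub>i)\<close>, and these bounds sum to at most a multiple of \<open>\<Sum> x\<^sub>i\<close>.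
\<close>

lemma summable_geometric_means:
  fixes x :: "nat \<Rightarrow> real"
  assumes pos: "\<And>i. 0 \<le> x i" and sum: "summable x"
  shows "summable (\<lambda>n. (\<Prod>i<Suc n. x i) powr (1 / real (Suc n)))"
proof -
  define S where "S n = (\<Sum>i<n. real (Suc i) * x i)" for n
  have S_nn: "S n \<ge> 0" for n unfolding S_def by (intro sum_nonneg) (simp add: pos)
  have bound: "(\<Prod>i<Suc n. x i) powr (1 / real (Suc n)) \<le> exp 1 * (S (Suc n) / (real (Suc n))\<^sup>2)" for n
  proof -
    define N where "N = Suc n"
    have N: "N > 0" by (simp add: N_def)
    have "(\<Prod>i<N. real (Suc i) * x i) \<le> (S N / N) ^ N"
      using prod_le_mean_power[of "{..<N}" "\<lambda>i. real (Suc i) * x i"] pos N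
      by (simp add: S_def lessThan_empty_iff)
    moreover have "(\<Prod>i<N. real (Suc i) * x i) = fact N * (\<Prod>i<N. x i)"
      by (simp add: prod.distrib fact_prod_Suc atLeast0LessThan)
    ultimately have "fact N * (\<Prod>i<N. x i) \<le> (S N / N) ^ N" by simp
    then have "real N ^ N * (\<Prod>i<N. x i) \<le> exp (real N) * (S N / N) ^ N"
      using power_le_exp_fact[of N] pos
      by (smt (verit) exp_gt_zero mult.assoc mult_left_mono mult_right_mono prod_nonneg)
    then have "(\<Prod>i<N. x i) \<le> exp (real N) * (S N / N) ^ N / real N ^ N"
      using N by (simp add: field_simps)
    also have "\<dots> = (exp 1 * (S N / (real N)\<^sup>2)) ^ N"
      by (simp add: power_mult_distrib power_divide power2_eq_square exp_of_nat_mult[symmetric])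
    finally have le: "(\<Prod>i<N. x i) \<le> (exp 1 * (S N / (real N)\<^sup>2)) ^ N" .
    have "(\<Prod>i<N. x i) powr (1 / real N) \<le> ((exp 1 * (S N / (real N)\<^sup>2)) ^ N) powr (1 / real N)"
      using le pos by (intro powr_mono2) (auto intro: prod_nonneg)
    also have "\<dots> = exp 1 * (S N / (real N)\<^sup>2)"
      using N S_nn[of N] by (intro power_powr_inverse) auto
    finally show ?thesis by (simp only: N_def)
  qed
  have partial: "(\<Sum>n<M. S (Suc n) / (real (Suc n))\<^sup>2) + S M / M \<le> 2 * (\<Sum>i<M. x i)" for M
  proof (induction M)
    case (Suc M)
    have SM: "S (Suc M) = S M + real (Suc M) * x M" by (simp add: S_def)
    have "S (Suc M) / (real (Suc M))\<^sup>2 + S (Suc M) / real (Suc M) - S M / M \<le> 2 * x M"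
    proof -
      have 1: "real (Suc M) * x M / (real (Suc M))\<^sup>2 + real (Suc M) * x M / real (Suc M) \<le> 2 * x M"
      proof -
        have "x M / real (Suc M) \<le> x M / 1" by (intro divide_left_mono) (auto simp: pos)
        then show ?thesis by (simp add: power2_eq_square del: of_nat_Suc)
      qed
      have 2: "S M / (real (Suc M))\<^sup>2 + S M / real (Suc M) - S M / M \<le> 0"
      proof (cases "M = 0")
        case True then show ?thesis by (simp add: S_def)
      next
        case False
        have "1 / (t + 1)\<^sup>2 + 1 / (t + 1) - 1 / t = - 1 / (t * (t + 1)\<^sup>2)" if "t > 0" for t :: real
          using that by (simp add: divide_simps) (simp add: algebra_simps power2_eq_square)
        from this[of "real M"] have "1 / (real (Suc M))\<^sup>2 + 1 / real (Suc M) - 1 / M \<le> 0"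
          using False by (simp add: add.commute)
        then have "S M * (1 / (real (Suc M))\<^sup>2 + 1 / real (Suc M) - 1 / M) \<le> 0"
          using S_nn[of M] by (intro mult_nonneg_nonpos)
        then show ?thesis by (simp add: algebra_simps del: of_nat_Suc)
      qed
      show ?thesis using 1 2 unfolding SM add_divide_distrib by linarith
    qed
    then show ?case using Suc by simp
  qed (simp add: S_def)
  have "summable (\<lambda>n. S (Suc n) / (real (Suc n))\<^sup>2)"
  proof (rule summableI_nonneg_bounded)
    show "(\<Sum>n<M. S (Suc n) / (real (Suc n))\<^sup>2) \<le> 2 * suminf x" for M
    proof -
      have "S M / M \<ge> 0" using S_nn by simp
      moreover have "(\<Sum>i<M. x i) \<le> suminf x" by (rule sum_le_suminf[OF sum]) (auto simp: pos)
      ultimately show ?thesis using partial[of M] by linarith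
    qed
  qed (simp add: S_nn)
  then have "summable (\<lambda>n. exp 1 * (S (Suc n) / (real (Suc n))\<^sup>2))" by (rule summable_mult)
  then show ?thesis
    by (rule summable_comparison_test') (use bound in auto)
qed

text \<open>
  Kept folded: the standard simplification rules for multiplication by \<open>[:0, 1:]\<close> would take the products
  apart to which the recurrence applies.
\<close>

definition var :: "real poly" where
  "var = [:0, 1:]"

text \<open>The monic orthogonal polynomials of a linear functional, by their three-term recurrence.\<close>

context
  fixes L :: "real poly \<Rightarrow> real"
begin

definition recurrence_coeff :: "real poly \<Rightarrow> real" where
  "recurrence_coeff p = L (var * p * p) / L (p * p)"

fun orth_poly :: "nat \<Rightarrow> real poly" where
  "orth_poly 0 = 1"
| "orth_poly (Suc 0) = var - smult (recurrence_coeff 1) 1"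
| "orth_poly (Suc (Suc n)) = var * orth_poly (Suc n) -
     smult (recurrence_coeff (orth_poly (Suc n))) (orth_poly (Suc n)) -
     smult (L (orth_poly (Suc n) * orth_poly (Suc n)) / L (orth_poly n * orth_poly n)) (orth_poly n)"

end

locale poly_functional =
  fixes L :: "real poly \<Rightarrow> real"
  assumes L_add: "L (p + q) = L p + L q"
    and L_smult: "L (smult c p) = c * L p"
begin

abbreviation "P n \<equiv> orth_poly L n"
definition "H n = L (P n * P n)"
definition "A n = recurrence_coeff L (P n)"
definition "\<beta> n = (if n = 0 then 0 else H n / H (n - 1))"

lemma L_diff: "L (p - q) = L p - L q"
  using L_add[of "p - q" q] by simp

lemma P_0: "P 0 = 1"
  by simp

lemma P_Suc: "P (Suc n) = var * P n - smult (A n) (P n) - smult (\<beta> n) (P (n - 1))"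
  by (cases n) (simp_all add: A_def \<beta>_def H_def)

declare orth_poly.simps [simp del]

lemma var_mult_P: "var * P n = P (Suc n) + smult (A n) (P n) + smult (\<beta> n) (P (n - 1))"
  by (simp add: P_Suc)

lemma L_var_mult: "L (var * P n * q) = L (P (Suc n) * q) + A n * L (P n * q) + \<beta> n * L (P (n - 1) * q)"
  unfolding var_mult_P by (simp only: distrib_right mult_smult_left L_add L_smult)

lemma L_P_Suc: "L (P (Suc n) * q) = L (var * P n * q) - A n * L (P n * q) - \<beta> n * L (P (n - 1) * q)"
  by (simp add: L_var_mult)

text \<open>
  Division by zero makes the recurrence total; it produces orthogonal polynomials as long as the
  norms in its denominators do not vanish.
\<close>

lemma orthogonal:
  assumes "\<And>i. i < n \<Longrightarrow> H i \<noteq> 0" "i < j" "j \<le> n"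
  shows "L (P i * P j) = 0"
  using assms
proof (induction n arbitrary: i j)
  case (Suc n)
  have IH: "L (P i * P j) = 0" if "i < j" "j \<le> n" for i j
    using Suc.IH[OF _ that] Suc.prems(1) by simp
  show ?case
  proof (cases "j \<le> n")
    case False
    then have j: "j = Suc n" and i: "i \<le> n" using Suc.prems by auto
    have step: "L (P i * P j) = L (var * P n * P i) - A n * L (P n * P i) - \<beta> n * L (P (n - 1) * P i)"
      unfolding j mult.commute[of "P i"] by (rule L_P_Suc)
    show ?thesis
    proof (cases "i = n")
      case True
      have "L (var * P n * P n) = A n * H n"
        using Suc.prems(1)[of n] by (simp add: A_def recurrence_coeff_def H_def)
      moreover have "\<beta> n * L (P (n - 1) * P n) = 0"
        using IH[of "n - 1" n] by (cases n) (auto simp: \<beta>_def)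
      ultimately show ?thesis unfolding step unfolding True by (simp add: H_def)
    next
      case False
      then have i: "i < n" using i by simp
      have "\<beta> i * L (P (i - 1) * P n) = 0" using IH[of "i - 1" n] i by (cases i) (auto simp: \<beta>_def)
      then have "L (var * P i * P n) = L (P (Suc i) * P n)"
        using IH[of i n] i by (simp add: L_var_mult[of i])
      moreover have "var * P n * P i = var * P i * P n" by (simp only: mult_ac)
      ultimately have "L (var * P n * P i) = L (P (Suc i) * P n)" by (simp only:)
      moreover have "L (P n * P i) = 0" using IH[OF i] by (simp add: mult.commute)
      moreover have "L (P (Suc i) * P n) = \<beta> n * L (P (n - 1) * P i)"
      proof (cases "Suc i = n")
        case True
        then show ?thesis using Suc.prems(1)[of i] by (auto simp: \<beta>_def H_def)
      next
        case False
        then have "Suc i < n" "i < n - 1" using i by auto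
        then have "L (P (Suc i) * P n) = 0" "L (P i * P (n - 1)) = 0" using IH by auto
        then show ?thesis by (simp add: mult.commute)
      qed
      ultimately show ?thesis unfolding step by simp
    qed
  qed (use IH Suc.prems in auto)
qed simp

text \<open>
  \<open>P m\<close> is monic and orthogonal to lower degrees, so replacing one factor of \<open>H m = L(P\<^sub>m\<^sup>2)\<close> by the
  monomial of degree \<open>m\<close> changes nothing. This will bound \<open>H m\<close> by the moment of order \<open>2m\<close>.
\<close>

lemma L_P_monom:
  assumes H: "\<And>n. H n \<noteq> 0"
  shows "(\<forall>n>m. L (P n * monom 1 m) = 0) \<and> L (P m * monom 1 m) = H m"
proof (induction m)
  case 0
  have "L (P n * monom 1 0) = 0" if "n > 0" for n
    using orthogonal[of n 0 n] H that by (simp add: one_pCons[symmetric] monom_0 P_0)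
  then show ?case by (simp add: H_def monom_0 one_pCons[symmetric] P_0)
next
  case (Suc m)
  have step: "L (P n * monom 1 (Suc m)) =
      L (P (Suc n) * monom 1 m) + A n * L (P n * monom 1 m) + \<beta> n * L (P (n - 1) * monom 1 m)" for n
  proof -
    have "monom (1 :: real) (Suc m) = var * monom 1 m" by (simp add: monom_Suc var_def)
    then have "P n * monom 1 (Suc m) = var * P n * monom 1 m" by (simp only: mult_ac)
    then show ?thesis by (simp only: L_var_mult)
  qed
  show ?case
  proof (intro conjI allI impI)
    fix n assume "n > Suc m"
    then have "Suc n > m" "n > m" "n - 1 > m" by auto
    then show "L (P n * monom 1 (Suc m)) = 0" using Suc by (simp add: step)
  next
    have "L (P (Suc m) * monom 1 (Suc m)) = \<beta> (Suc m) * H m"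
      using Suc by (simp add: step)
    then show "L (P (Suc m) * monom 1 (Suc m)) = H (Suc m)" using H[of m] by (simp add: \<beta>_def)
  qed
qed

end

text \<open>
  A random variable, on a space of finite mass, with all moments. In the application the measure is
  \<open>p\<^sup>2 \<nu>\<close> and the variable a coordinate.
\<close>

locale real_moments =
  fixes M :: "'a measure" and Y :: "'a \<Rightarrow> real"
  assumes Y [measurable]: "Y \<in> borel_measurable M"
    and integrable_power: "integrable M (\<lambda>x. Y x ^ n)"
begin

definition F :: "(real \<Rightarrow> real) \<Rightarrow> real poly \<Rightarrow> real" where
  "F f p = (\<integral>x. f (Y x) * poly p (Y x) \<partial>M)"

definition bounded_borel :: "(real \<Rightarrow> real) \<Rightarrow> bool" where
  "bounded_borel f \<longleftrightarrow> f \<in> borel_measurable borel \<and> (\<exists>C. \<forall>t. \<bar>f t\<bar> \<le> C)"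

lemma bounded_borelI: "f \<in> borel_measurable borel \<Longrightarrow> (\<And>t. \<bar>f t\<bar> \<le> C) \<Longrightarrow> bounded_borel f"
  by (auto simp: bounded_borel_def)

lemma integrable_poly: "integrable M (\<lambda>x. poly p (Y x))"
  unfolding poly_altdef by (intro Bochner_Integration.integrable_sum integrable_mult_right integrable_power)

lemma measurable_poly [measurable]: "poly p \<in> borel_measurable (borel :: real measure)"
  by (intro borel_measurable_continuous_onI continuous_intros)

lemma integrable_F:
  assumes "bounded_borel f"
  shows "integrable M (\<lambda>x. f (Y x) * poly p (Y x))"
proof -
  have [measurable]: "f \<in> borel_measurable borel" using assms by (simp add: bounded_borel_def)
  obtain C where C: "\<And>t. \<bar>f t\<bar> \<le> C" using assms by (auto simp: bounded_borel_def)
  show ?thesis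
  proof (rule Bochner_Integration.integrable_bound)
    show "integrable M (\<lambda>x. C * poly p (Y x))" by (intro integrable_mult_right integrable_poly)
    show "AE x in M. norm (f (Y x) * poly p (Y x)) \<le> norm (C * poly p (Y x))"
      using C by (intro AE_I2) (simp add: abs_mult, meson abs_ge_self mult_right_mono order_trans abs_ge_zero)
  qed measurable
qed

lemma F_add: "bounded_borel f \<Longrightarrow> F f (p + q) = F f p + F f q"
  unfolding F_def
  by (subst Bochner_Integration.integral_add[symmetric]) (auto simp: integrable_F distrib_left)

lemma F_smult: "F f (smult c p) = c * F f p"
  unfolding F_def by (subst integral_mult_right_zero[symmetric]) (simp add: mult_ac)

lemma bounded_borel_const: "bounded_borel (\<lambda>_. c)"
  by (rule bounded_borelI[of _ "\<bar>c\<bar>"]) auto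

abbreviation "L \<equiv> F (\<lambda>_. 1)"

sublocale poly_functional L
  by unfold_locales (simp_all add: F_add bounded_borel_const F_smult)

lemma H_nonneg: "H n \<ge> 0"
  unfolding H_def F_def by (intro integral_nonneg_AE AE_I2) simp

text \<open>The squared distance to the span of the first orthogonal polynomials is given by Parseval's identity.\<close>

lemma orthogonal_expansion:
  assumes f: "bounded_borel f" and H: "\<And>i. i < n \<Longrightarrow> H i \<noteq> 0"
  defines "q \<equiv> \<Sum>i<n. smult (F f (P i) / H i) (P i)"
  shows "(\<integral>x. (f (Y x) - poly q (Y x))\<^sup>2 \<partial>M) = (\<integral>x. (f (Y x))\<^sup>2 \<partial>M) - (\<Sum>i<n. (F f (P i))\<^sup>2 / H i)"
proof -
  have F_sum: "F g (\<Sum>i\<in>I. r i) = (\<Sum>i\<in>I. F g (r i))" if g: "bounded_borel g" for g I and r :: "nat \<Rightarrow> real poly"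
  proof (induction I rule: infinite_finite_induct)
    case (insert i I)
    then show ?case using g by (simp add: F_add)
  qed (simp_all add: F_def)
  have f2: "bounded_borel (\<lambda>t. (f t)\<^sup>2)"
  proof -
    have [measurable]: "f \<in> borel_measurable borel" using f by (simp add: bounded_borel_def)
    obtain C where C: "\<And>t. \<bar>f t\<bar> \<le> C" using f by (auto simp: bounded_borel_def)
    have "\<bar>(f t)\<^sup>2\<bar> \<le> C\<^sup>2" for t using C[of t] by (simp add: abs_le_square_iff[symmetric])
    then show ?thesis by (intro bounded_borelI) auto
  qed
  have fq: "F f q = (\<Sum>i<n. (F f (P i))\<^sup>2 / H i)"
    by (simp add: q_def F_sum[OF f] F_smult power2_eq_square)
  have Lq: "L (P j * q) = F f (P j)" if "j < n" for j
  proof -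
    have "L (P j * q) = (\<Sum>i<n. F f (P i) / H i * L (P j * P i))"
      by (simp add: q_def sum_distrib_left F_sum[OF bounded_borel_const] F_smult)
    also have "\<dots> = (\<Sum>i<n. if i = j then F f (P j) else 0)"
    proof (rule sum.cong[OF refl])
      fix i assume i: "i \<in> {..<n}"
      have "L (P j * P i) = 0" if "i \<noteq> j"
      proof (cases "i < j")
        case True
        then show ?thesis using orthogonal[of j i j] H \<open>j < n\<close> by (simp add: mult.commute)
      next
        case False
        then show ?thesis using orthogonal[of i j i] H i that by simp
      qed
      then show "F f (P i) / H i * L (P j * P i) = (if i = j then F f (P j) else 0)"
        using H[OF \<open>j < n\<close>] by (simp add: H_def)
    qed
    also have "\<dots> = F f (P j)" using that by simp
    finally show ?thesis .
  qed
  have "L (q * q) = (\<Sum>i<n. F f (P i) / H i * L (P i * q))"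
    by (subst (1) q_def) (simp add: sum_distrib_right F_sum[OF bounded_borel_const] F_smult)
  also have "\<dots> = (\<Sum>i<n. (F f (P i))\<^sup>2 / H i)"
    by (intro sum.cong refl) (simp add: Lq power2_eq_square)
  finally have qq: "L (q * q) = (\<Sum>i<n. (F f (P i))\<^sup>2 / H i)" .
  have "(\<integral>x. (f (Y x) - poly q (Y x))\<^sup>2 \<partial>M) =
      (\<integral>x. (f (Y x))\<^sup>2 * poly 1 (Y x) - 2 * (f (Y x) * poly q (Y x)) + 1 * poly (q * q) (Y x) \<partial>M)"
    by (simp add: power2_diff power2_eq_square algebra_simps)
  also have "\<dots> = F (\<lambda>t. (f t)\<^sup>2) 1 - 2 * F f q + L (q * q)"
    unfolding F_def
    using integrable_F[OF f2, of 1] integrable_F[OF f, of q]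
      integrable_F[OF bounded_borel_const, of 1 "q * q"]
    by (subst Bochner_Integration.integral_add Bochner_Integration.integral_diff; simp)+
  finally show ?thesis by (simp add: fq qq F_def[of "\<lambda>t. (f t)\<^sup>2"])
qed

context
  fixes a b :: real
  assumes b: "b > 0"
begin

text \<open>The real and imaginary parts of the resolvent \<open>1 / (t - (a + i b))\<close>.\<close>

definition "u t = (t - a) / ((t - a)\<^sup>2 + b\<^sup>2)"
definition "v t = b / ((t - a)\<^sup>2 + b\<^sup>2)"

lemma denom_pos: "(t - a)\<^sup>2 + b\<^sup>2 > 0"
  using b by (simp add: add_nonneg_pos)

lemma uv_relations: "(t - a) * u t = 1 - b * v t" "(t - a) * v t = b * u t"
  "(u t)\<^sup>2 + (v t)\<^sup>2 = v t / b"
proof -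
  show "(t - a) * u t = 1 - b * v t" "(t - a) * v t = b * u t"
    using denom_pos[of t] by (simp_all add: u_def v_def field_simps power2_eq_square)
  have "(u t)\<^sup>2 + (v t)\<^sup>2 = ((t - a)\<^sup>2 + b\<^sup>2) / ((t - a)\<^sup>2 + b\<^sup>2)\<^sup>2"
    by (simp add: u_def v_def power_divide add_divide_distrib)
  also have "\<dots> = v t / b" using denom_pos[of t] b by (simp add: v_def power2_eq_square[of "_ + _"])
  finally show "(u t)\<^sup>2 + (v t)\<^sup>2 = v t / b" .
qed

lemma bounded_u: "bounded_borel u" and bounded_v: "bounded_borel v"
proof -
  have v: "\<bar>v t\<bar> \<le> 1 / b" for t
  proof -
    have "b * b \<le> (t - a)\<^sup>2 + b\<^sup>2" by (simp add: power2_eq_square)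
    then show ?thesis using denom_pos[of t] b by (simp add: v_def field_simps)
  qed
  have u: "\<bar>u t\<bar> \<le> 1 / b" for t
  proof -
    have "(u t)\<^sup>2 \<le> v t / b" using uv_relations(3)[of t] by (smt (verit) zero_le_power2)
    also have "\<dots> \<le> (1 / b) / b" using v[of t] b by (intro divide_right_mono) auto
    finally have "(u t)\<^sup>2 \<le> (1 / b)\<^sup>2" by (simp add: power2_eq_square)
    then show ?thesis using b by (simp add: abs_le_square_iff[symmetric])
  qed
  have [measurable]: "u \<in> borel_measurable borel" "v \<in> borel_measurable borel"
    unfolding u_def[abs_def] v_def[abs_def] by measurable
  show "bounded_borel u" by (rule bounded_borelI[OF _ u]) measurable
  show "bounded_borel v" by (rule bounded_borelI[OF _ v]) measurable
qed

lemma F_u_var: "F u (var * q) = L q - b * F v q + a * F u q"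
proof -
  have "u (Y x) * poly (var * q) (Y x) =
      1 * poly q (Y x) - b * (v (Y x) * poly q (Y x)) + a * (u (Y x) * poly q (Y x))" for x
    using arg_cong[OF uv_relations(1)[of "Y x"], of "\<lambda>z. z * poly q (Y x)"]
    by (simp add: var_def algebra_simps)
  then show ?thesis
    unfolding F_def
    using integrable_F[OF bounded_u, of q] integrable_F[OF bounded_v, of q] integrable_poly[of q]
    by simp
qed

lemma F_v_var: "F v (var * q) = b * F u q + a * F v q"
proof -
  have "v (Y x) * poly (var * q) (Y x) =
      b * (u (Y x) * poly q (Y x)) + a * (v (Y x) * poly q (Y x))" for x
    using arg_cong[OF uv_relations(2)[of "Y x"], of "\<lambda>z. z * poly q (Y x)"]
    by (simp add: var_def algebra_simps)
  then show ?thesis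
    unfolding F_def
    using integrable_F[OF bounded_u, of q] integrable_F[OF bounded_v, of q]
    by simp
qed

definition "W n = F u (P (Suc n)) * F v (P n) - F u (P n) * F v (P (Suc n))"

text \<open>
  The coefficients of \<open>u\<close> and \<open>v\<close> satisfy the recurrence of the orthogonal polynomials, coupled by \<open>b\<close>;
  this is the Christoffel--Darboux summation for that recurrence.
\<close>

lemma wronskian:
  assumes "\<And>i. i \<le> n \<Longrightarrow> H i \<noteq> 0"
  shows "b * (\<Sum>i<Suc n. ((F u (P i))\<^sup>2 + (F v (P i))\<^sup>2) / H i) + W n / H n = F v 1"
  using assms
proof (induction n)
  have F_diff: "F f (p - q) = F f p - F f q" if "bounded_borel f" for f p q
    using F_add[OF that, of "p - q" q] by simp
  have rec_u: "F u (P (Suc n)) = L (P n) - b * F v (P n) + (a - A n) * F u (P n) - \<beta> n * F u (P (n - 1))" for n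
    by (simp only: P_Suc F_diff[OF bounded_u] F_smult F_u_var) (simp add: algebra_simps)
  have rec_v: "F v (P (Suc n)) = b * F u (P n) + (a - A n) * F v (P n) - \<beta> n * F v (P (n - 1))" for n
    by (simp only: P_Suc F_diff[OF bounded_v] F_smult F_v_var) (simp add: algebra_simps)
  {
    case 0
    then have H0: "H 0 \<noteq> 0" by simp
    have "W 0 = H 0 * F v 1 - b * ((F u 1)\<^sup>2 + (F v 1)\<^sup>2)"
      unfolding W_def rec_u rec_v by (simp add: \<beta>_def H_def P_0 algebra_simps power2_eq_square)
    then show ?case using H0 by (simp add: P_0 field_simps)
  next
    case (Suc n)
    have H: "H n \<noteq> 0" "H (Suc n) \<noteq> 0" using Suc.prems by auto
    have "L (P (Suc n)) = 0"
      using orthogonal[of "Suc n" 0 "Suc n"] Suc.prems by (simp add: P_0)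
    then have "W (Suc n) = - b * ((F u (P (Suc n)))\<^sup>2 + (F v (P (Suc n)))\<^sup>2) + \<beta> (Suc n) * W n"
      unfolding W_def rec_u[of "Suc n"] rec_v[of "Suc n"] by (simp add: algebra_simps power2_eq_square)
    then have "W (Suc n) / H (Suc n) = W n / H n - b * (((F u (P (Suc n)))\<^sup>2 + (F v (P (Suc n)))\<^sup>2) / H (Suc n))"
      using H by (simp add: \<beta>_def field_simps)
    then show ?case
      using Suc.IH Suc.prems by (subst sum.lessThan_Suc) (simp only: distrib_left, simp)
  }
qed

text \<open>
  The Wronskian is \<open>b H\<^sub>n\<close> times the sum of the squared distances of \<open>u\<close> and \<open>v\<close> to the polynomials of
  degree at most \<open>n\<close>. If that sum stayed above \<open>\<epsilon> > 0\<close>, then \<open>sqrt (H\<^sub>n / H\<^sub>n\<^sub>+\<^sub>1)\<close> would be dominated by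
  the squares of the normalized coefficients, which are summable by Bessel's inequality, and since
  \<open>H\<^sub>n\<close> is at most the moment of order \<open>2n\<close>, Carleman's inequality would contradict the divergence of
  the Carleman series.
\<close>

theorem poly_approx_v:
  assumes carleman: "(\<And>n. L (monom 1 (2 * n)) > 0) \<Longrightarrow>
      \<not> summable (\<lambda>n. L (monom 1 (2 * Suc n)) powr (- 1 / (2 * real (Suc n))))"
    and \<epsilon>: "\<epsilon> > 0"
  shows "\<exists>q. (\<integral>x. (v (Y x) - poly q (Y x))\<^sup>2 \<partial>M) < \<epsilon>"
proof (rule ccontr)
  assume "\<not> ?thesis"
  then have far: "\<epsilon> \<le> (\<integral>x. (v (Y x) - poly q (Y x))\<^sup>2 \<partial>M)" for q by (simp add: not_less)
  define s where "s i = ((F u (P i))\<^sup>2 + (F v (P i))\<^sup>2) / H i" for i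
  have s_nn: "s i \<ge> 0" for i by (simp add: s_def H_nonneg)
  have sq: "(\<integral>x. (u (Y x))\<^sup>2 \<partial>M) + (\<integral>x. (v (Y x))\<^sup>2 \<partial>M) = F v 1 / b"
  proof -
    have "integrable M (\<lambda>x. (u (Y x))\<^sup>2)" "integrable M (\<lambda>x. (v (Y x))\<^sup>2)"
    proof -
      have [measurable]: "u \<in> borel_measurable borel" "v \<in> borel_measurable borel"
        using bounded_u bounded_v by (auto simp: bounded_borel_def)
      have i: "integrable M (\<lambda>x. v (Y x) / b)" using integrable_F[OF bounded_v, of 1] by simp
      have le: "(u t)\<^sup>2 \<le> v t / b" "(v t)\<^sup>2 \<le> v t / b" for t
        using uv_relations(3)[of t] zero_le_power2[of "u t"] zero_le_power2[of "v t"] by linarith+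
      have bd: "norm ((u t)\<^sup>2) \<le> norm (v t / b)" "norm ((v t)\<^sup>2) \<le> norm (v t / b)" for t
        unfolding real_norm_def abs_power2 using le[of t] by linarith+
      show "integrable M (\<lambda>x. (u (Y x))\<^sup>2)" "integrable M (\<lambda>x. (v (Y x))\<^sup>2)"
        by (rule Bochner_Integration.integrable_bound[OF i _ AE_I2]; (rule bd | measurable))+
    qed
    then show ?thesis
      by (simp add: F_def uv_relations(3) flip: Bochner_Integration.integral_add)
  qed
  have dist: "\<epsilon> \<le> F v 1 / b - (\<Sum>i<n. s i)" if H: "\<And>i. i < n \<Longrightarrow> H i \<noteq> 0" for n
  proof -
    have "0 \<le> (\<integral>x. (u (Y x))\<^sup>2 \<partial>M) - (\<Sum>i<n. (F u (P i))\<^sup>2 / H i)"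
      by (subst orthogonal_expansion[OF bounded_u H, symmetric]) (auto intro: integral_nonneg_AE)
    moreover have "\<epsilon> \<le> (\<integral>x. (v (Y x))\<^sup>2 \<partial>M) - (\<Sum>i<n. (F v (P i))\<^sup>2 / H i)"
      by (subst orthogonal_expansion[OF bounded_v H, symmetric]) (auto intro: far)
    ultimately show ?thesis
      using sq by (simp add: s_def add_divide_distrib sum.distrib)
  qed
  (* The Wronskian identity rewrites the error of the joint approximation of u and v. *)
  have W: "b * \<epsilon> \<le> W n / H n" if H: "\<And>i. i \<le> n \<Longrightarrow> H i \<noteq> 0" for n
  proof -
    have "b * (\<Sum>i<Suc n. s i) + W n / H n = F v 1"
      unfolding s_def by (rule wronskian[OF H])
    moreover have "\<epsilon> \<le> F v 1 / b - (\<Sum>i<Suc n. s i)" by (rule dist) (simp add: H)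
    then have "b * \<epsilon> \<le> F v 1 - b * (\<Sum>i<Suc n. s i)"
      using b by (simp add: field_simps)
    ultimately show ?thesis by linarith
  qed
  (* If some H n vanishes, the polynomials of degree below n already exhaust the space: P n is zero
     almost everywhere, and with it the Wronskian before it. *)
  have H_nz: "H n \<noteq> 0" for n
  proof (induction n rule: less_induct)
    case (less n)
    show ?case
    proof
      assume Hn: "H n = 0"
      have ae: "AE x in M. poly (P n) (Y x) = 0"
      proof -
        have int: "integrable M (\<lambda>x. (poly (P n) (Y x))\<^sup>2)"
          using integrable_poly[of "P n * P n"] by (simp add: power2_eq_square)
        have "(\<integral>x. (poly (P n) (Y x))\<^sup>2 \<partial>M) = 0"
          using Hn by (simp add: H_def F_def power2_eq_square)
        then show ?thesis using integral_nonneg_eq_0_iff_AE[OF int] by simp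
      qed
      show False
      proof (cases n)
        case 0
        then have "AE x in M. False" using ae by (simp add: P_0)
        then have "AE x in M. (v (Y x) - poly 0 (Y x))\<^sup>2 = 0" by eventually_elim simp
        then have "(\<integral>x. (v (Y x) - poly 0 (Y x))\<^sup>2 \<partial>M) = 0" by (rule integral_eq_zero_AE)
        then show False using far[of 0] \<epsilon> by simp
      next
        case (Suc m)
        have F0: "F f (P n) = 0" for f
        proof -
          have "AE x in M. f (Y x) * poly (P n) (Y x) = 0" using ae by eventually_elim simp
          then show ?thesis unfolding F_def[of f "P n"] by (rule integral_eq_zero_AE)
        qed
        then have "W m = 0" by (simp add: W_def Suc)
        then show False using W[of m] less Suc mult_pos_pos[OF b \<epsilon>] by simp
      qed
    qed
  qed
  then have H_pos: "H n > 0" for n using H_nonneg[of n] by (simp add: order_less_le)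
  have "summable s"
  proof (rule summableI_nonneg_bounded[OF s_nn])
    show "(\<Sum>i<n. s i) \<le> F v 1 / b" for n using dist[of n] H_nz \<epsilon> by auto
  qed
  define x where "x n = sqrt (H n / H (Suc n))" for n
  have x_le: "x n \<le> (s n + s (Suc n)) / (2 * b * \<epsilon>)" for n
  proof -
    define R where "R = sqrt (H n)"
    define R' where "R' = sqrt (H (Suc n))"
    have R: "R > 0" "R' > 0" "H n = R\<^sup>2" "H (Suc n) = R'\<^sup>2"
      using H_pos by (simp_all add: R_def R'_def less_imp_le)
    have x: "x n = R / R'" by (simp add: x_def R_def R'_def real_sqrt_divide)
    define p where "p = F u (P (Suc n)) / R'"
    define p' where "p' = F v (P (Suc n)) / R'"
    define r where "r = F u (P n) / R"
    define r' where "r' = F v (P n) / R"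
    have ss: "s n + s (Suc n) = r\<^sup>2 + r'\<^sup>2 + p\<^sup>2 + p'\<^sup>2"
      by (simp add: s_def R(3,4) p_def p'_def r_def r'_def power_divide add_divide_distrib)
    have "b * \<epsilon> * x n \<le> W n / H n * x n"
      using W[of n] H_nz R x by (intro mult_right_mono) auto
    also have "\<dots> = p * r' - r * p'"
      using R(1,2) unfolding x R(3) by (simp add: W_def p_def p'_def r_def r'_def field_simps power2_eq_square)
    also have "\<dots> \<le> (s n + s (Suc n)) / 2"
      using zero_le_power2[of "p - r'"] zero_le_power2[of "r + p'"] unfolding ss
      by (simp add: power2_diff power2_sum)
    finally show ?thesis using b \<epsilon> by (simp add: field_simps)
  qed
  have x_pos: "x n > 0" for n using H_pos by (simp add: x_def)
  have "summable (\<lambda>n. (s n + s (Suc n)) / (2 * b * \<epsilon>))"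
    using \<open>summable s\<close> by (intro summable_divide summable_add) (auto simp: summable_Suc_iff)
  then have "summable x"
    by (rule summable_comparison_test') (use x_le x_pos in \<open>auto simp: less_imp_le\<close>)
  then have gm: "summable (\<lambda>n. (\<Prod>i<Suc n. x i) powr (1 / real (Suc n)))"
    using x_pos by (intro summable_geometric_means) (auto simp: less_imp_le)
  (* The product telescopes, so the geometric means are the roots of H 0 / H n. *)
  have prod_x: "(\<Prod>i<n. x i) = sqrt (H 0 / H n)" for n
  proof (induction n)
    case (Suc n)
    have "sqrt (H 0 / H n) * sqrt (H n / H (Suc n)) = sqrt (H 0 / H (Suc n))"
      using H_nz[of n] by (simp add: real_sqrt_mult[symmetric])
    then show ?case using Suc by (simp add: x_def)
  qed (use H_nz in simp)
  have H_le: "H n \<le> L (monom 1 (2 * n))" for n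
  proof -
    let ?m = "monom (1 :: real) n"
    have "0 \<le> L ((P n - ?m) * (P n - ?m))"
      unfolding F_def by (intro integral_nonneg_AE AE_I2) simp
    also have "(P n - ?m) * (P n - ?m) = P n * P n - P n * ?m - P n * ?m + ?m * ?m"
      by (simp add: algebra_simps)
    also have "L \<dots> = H n - 2 * L (P n * ?m) + L (?m * ?m)"
      by (simp only: L_add L_diff H_def)
    also have "L (P n * ?m) = H n" using L_P_monom[OF H_nz] by blast
    also have "?m * ?m = monom 1 (2 * n)" by (simp only: mult_monom mult_2 mult_1)
    finally show ?thesis by simp
  qed
  then have mom_pos: "L (monom 1 (2 * n)) > 0" for n
    using H_pos[of n] less_le_trans by blast
  define c where "c = min 1 (H 0)"
  have c: "c > 0" using H_pos by (simp add: c_def)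
  have bound: "c * L (monom 1 (2 * Suc n)) powr (- 1 / (2 * real (Suc n))) \<le>
      (\<Prod>i<Suc n. x i) powr (1 / real (Suc n))" for n
  proof -
    define N where "N = real (Suc n)"
    define m where "m = L (monom 1 (2 * Suc n))"
    have N: "N \<ge> 1" by (simp add: N_def)
    have m: "H (Suc n) \<le> m" "m > 0" unfolding m_def by (rule H_le, rule mom_pos)
    have "c \<le> H 0 powr (1 / (2 * N))"
    proof (cases "H 0 \<ge> 1")
      case True
      then have "1 \<le> H 0 powr (1 / (2 * N))" using N by (intro ge_one_powr_ge_zero) auto
      then show ?thesis by (simp add: c_def)
    next
      case False
      then have "H 0 powr 1 \<le> H 0 powr (1 / (2 * N))"
        using N H_pos[of 0] by (intro powr_mono') (auto simp: field_simps)
      then show ?thesis using H_pos[of 0] by (simp add: c_def)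
    qed
    then have "c * m powr (- 1 / (2 * N)) \<le> H 0 powr (1 / (2 * N)) * m powr (- 1 / (2 * N))"
      by (intro mult_right_mono) auto
    also have "\<dots> = (H 0 / m) powr (1 / (2 * N))"
    proof -
      have "m powr (- 1 / (2 * N)) = 1 / m powr (1 / (2 * N))"
        using powr_minus_divide[of m "1 / (2 * N)"] by simp
      then show ?thesis using H_pos[of 0] m by (simp add: powr_divide)
    qed
    also have "\<dots> \<le> (H 0 / H (Suc n)) powr (1 / (2 * N))"
      using H_pos m N by (intro powr_mono2) (auto intro!: divide_left_mono simp: less_imp_le)
    also have "\<dots> = sqrt (H 0 / H (Suc n)) powr (1 / N)"
      using H_pos by (simp add: powr_half_sqrt[symmetric] powr_powr less_imp_le)
    finally show ?thesis unfolding prod_x N_def m_def .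
  qed
  have "summable (\<lambda>n. c * L (monom 1 (2 * Suc n)) powr (- 1 / (2 * real (Suc n))))"
    by (rule summable_comparison_test'[OF gm]) (use bound c in \<open>simp add: less_imp_le\<close>)
  then show False using carleman[OF mom_pos] c by (simp add: summable_cmult_iff)
qed

end

end

section \<open>Polynomial approximation in several variables\<close>

lemma real_polynomial_function_mpow: "real_polynomial_function (\<lambda>x. mpow x \<alpha>)"
proof -
  have lin: "real_polynomial_function (\<lambda>x :: real ^ 'a. x $ i)" for i
    by (intro real_polynomial_function.intros(1) bounded_linear_vec_nth)
  have "real_polynomial_function (\<lambda>x :: real ^ 'a. (x $ i) ^ n)" for i n
  proof (induction n)
    case 0
    show ?case by (simp add: real_polynomial_function.intros(2))
  next
    case (Suc n)
    then show ?case using real_polynomial_function.intros(4)[OF lin] by simp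
  qed
  then show ?thesis unfolding mpow_def
    by (intro real_polynomial_function_prod) auto
qed

lemma real_polynomial_function_iff_peval:
  fixes f :: "real ^ 'n::finite \<Rightarrow> real"
  shows "real_polynomial_function f \<longleftrightarrow> (\<exists>q. f = peval q)"
proof
  assume "\<exists>q. f = peval q"
  then show "real_polynomial_function f"
    by (auto simp: peval_def[abs_def] intro!: real_polynomial_function_sum
        real_polynomial_function.intros(4) real_polynomial_function_mpow real_polynomial_function.intros(2))
next
  assume "real_polynomial_function f"
  then show "\<exists>q. f = peval q"
  proof (induction rule: real_polynomial_function.induct)
    case (linear f)
    interpret bounded_linear f by (fact linear)
    have "f x = peval (\<Sum>i\<in>UNIV. Poly_Mapping.single (Poly_Mapping.single i 1) (f (axis i 1))) x" for x
    proof -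
      have "f x = f (\<Sum>i\<in>UNIV. x $ i *\<^sub>R axis i 1)"
        using basis_expansion[of x] by (simp add: scalar_mult_eq_scaleR)
      then show ?thesis by (simp add: sum scale peval_eq_riesz riesz_sum mult.commute)
    qed
    then show ?case by blast
  next
    case (const c)
    have "peval (Poly_Mapping.single 0 c) = (\<lambda>x. c)"
      by (simp add: fun_eq_iff peval_eq_riesz)
    then show ?case by metis
  next
    case (add f g)
    then obtain p q where "f = peval p" "g = peval q" by blast
    then have "(\<lambda>x. f x + g x) = peval (p + q)"
      by (simp add: fun_eq_iff peval_eq_riesz riesz_add)
    then show ?case by blast
  next
    case (mult f g)
    then obtain p q where "f = peval p" "g = peval q" by blast
    then have "(\<lambda>x. f x * g x) = peval (p * q)"
      by (simp add: fun_eq_iff peval_mult)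
    then show ?case by blast
  qed
qed

lemma real_polynomial_function_power:
  "real_polynomial_function f \<Longrightarrow> real_polynomial_function (\<lambda>x. f x ^ n)"
proof (induction n)
  case 0
  show ?case by (simp add: real_polynomial_function.intros(2))
next
  case (Suc n)
  then show ?case using real_polynomial_function.intros(4)[of f] by simp
qed

lemma real_polynomial_function_poly:
  assumes "real_polynomial_function f"
  shows "real_polynomial_function (\<lambda>x. poly p (f x))"
  unfolding poly_altdef
  by (intro real_polynomial_function_sum real_polynomial_function.intros(4) real_polynomial_function.intros(2)
      real_polynomial_function_power assms) auto

lemma measurable_real_polynomial_function:
  fixes f :: "real ^ 'n::finite \<Rightarrow> real"
  shows "real_polynomial_function f \<Longrightarrow> f \<in> borel_measurable borel"
  by (intro borel_measurable_continuous_onI) (auto simp: real_polynomial_function_eq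
      intro: continuous_on_polymonial_function)

lemma summable_even_odd:
  fixes f :: "nat \<Rightarrow> real"
  assumes nn: "\<And>n. 0 \<le> f n" and ev: "summable (\<lambda>n. f (2 * n))" and od: "summable (\<lambda>n. f (2 * n + 1))"
  shows "summable f"
proof (rule summableI_nonneg_bounded[OF nn])
  fix n
  have "(\<Sum>i<2 * n. f i) = (\<Sum>i<n. f (2 * i)) + (\<Sum>i<n. f (2 * i + 1))"
    by (induction n) auto
  moreover have "(\<Sum>i<n. f (2 * i)) \<le> suminf (\<lambda>i. f (2 * i))" "(\<Sum>i<n. f (2 * i + 1)) \<le> suminf (\<lambda>i. f (2 * i + 1))"
    by (intro sum_le_suminf ev od; simp add: nn)+
  moreover have "(\<Sum>i<n. f i) \<le> (\<Sum>i<2 * n. f i)"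
    by (rule sum_mono2) (auto simp: nn)
  ultimately show "(\<Sum>i<n. f i) \<le> suminf (\<lambda>i. f (2 * i)) + suminf (\<lambda>i. f (2 * i + 1))" by linarith
qed

locale carleman_measure =
  fixes \<nu> :: "(real ^ 'm::finite) measure"
  assumes sets_\<nu> [measurable_cong]: "sets \<nu> = sets borel"
    and fin: "finite_measure \<nu>" and moments: "finite_moments \<nu>" and carleman: "carleman \<nu>"
begin

sublocale finite_measure \<nu> by (fact fin)

lemma integrable_poly_fun:
  assumes "real_polynomial_function f"
  shows "integrable \<nu> f"
proof -
  obtain q where "f = peval q" using assms real_polynomial_function_iff_peval by blast
  then show ?thesis
    using moments by (auto simp: peval_def[abs_def] finite_moments_def)
qed

lemma poly_fun_coord: "real_polynomial_function (\<lambda>y :: real ^ 'm. (y $ j) ^ n)"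
  by (intro real_polynomial_function_power real_polynomial_function.intros(1) bounded_linear_vec_nth)

text \<open>
  By the Cauchy--Schwarz inequality the weighted moment of order \<open>2n\<close> is bounded by the root of the
  unweighted moment of order \<open>4n\<close>, so only every second term of the Carleman series is controlled
  directly; the next term is at most a constant multiple of it, because for a finite measure the \<open>L\<^sup>p\<close>
  norms increase with \<open>p\<close> up to a constant.
\<close>

lemma carleman_weighted:
  fixes j :: 'm
  assumes p: "real_polynomial_function p"
  defines "m' \<equiv> \<lambda>n. \<integral>y. (y $ j) ^ (2 * n) * (p y)\<^sup>2 \<partial>\<nu>"
  assumes pos': "\<And>n. m' n > 0"
  shows "\<not> summable (\<lambda>n. m' (Suc n) powr (- 1 / (2 * real (Suc n))))"
proof
  assume summ: "summable (\<lambda>n. m' (Suc n) powr (- 1 / (2 * real (Suc n))))"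
  define m where "m n = (\<integral>y. (y $ j) ^ (2 * n) \<partial>\<nu>)" for n
  (* The summand 1 only keeps C positive. *)
  define C where "C = 1 + (\<integral>y. (p y) ^ 4 \<partial>\<nu>)"
  note rpf = poly_fun_coord real_polynomial_function_power[OF p] real_polynomial_function.intros(4)
    real_polynomial_function.intros(3) real_polynomial_function.intros(2) real_polynomial_function_diff
  have C: "C \<ge> 1" unfolding C_def by (simp add: integral_nonneg_AE)
  have m_nn: "m n \<ge> 0" for n unfolding m_def by (intro integral_nonneg_AE AE_I2) simp
  have cs: "(m' n)\<^sup>2 \<le> C * m (2 * n)" for n
  proof -
    define t where "t = m' n / C"
    have "0 \<le> (\<integral>y. ((y $ j) ^ (2 * n) - t * (p y)\<^sup>2)\<^sup>2 \<partial>\<nu>)" by (intro integral_nonneg_AE AE_I2) simp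
    also have "\<dots> = (\<integral>y. (y $ j) ^ (2 * (2 * n)) - 2 * t * ((y $ j) ^ (2 * n) * (p y)\<^sup>2) + t\<^sup>2 * (p y) ^ 4 \<partial>\<nu>)"
      by (intro Bochner_Integration.integral_cong refl)
        (simp add: power2_diff power_mult_distrib algebra_simps flip: power_mult)
    also have "\<dots> = m (2 * n) - 2 * t * m' n + t\<^sup>2 * (\<integral>y. (p y) ^ 4 \<partial>\<nu>)"
      unfolding m_def m'_def
      using integrable_poly_fun[OF rpf(1)[of j "2 * (2 * n)"]] integrable_poly_fun[OF rpf(2)[of 4]]
        integrable_poly_fun[OF rpf(3)[OF rpf(1)[of j "2 * n"] rpf(2)[of 2]]] by simp
    also have "\<dots> \<le> m (2 * n) - 2 * t * m' n + t\<^sup>2 * C" by (simp add: C_def mult_left_mono)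
    also have "\<dots> = m (2 * n) - (m' n)\<^sup>2 / C"
      using C by (simp add: t_def power2_eq_square)
    finally show ?thesis using C by (simp add: field_simps)
  qed
  have m_pos: "m n > 0" for n
  proof (rule ccontr)
    assume "\<not> m n > 0"
    then have mn: "m n = 0" using m_nn[of n] by simp
    have "AE y in \<nu>. (y $ j) ^ (2 * n) = 0"
      using mn integral_nonneg_eq_0_iff_AE[OF integrable_poly_fun[OF rpf(1)[of j "2 * n"]]]
      by (simp add: m_def)
    then have "AE y in \<nu>. (y $ j) ^ (2 * (2 * n)) = 0"
      by eventually_elim (simp add: power_mult[of _ 2])
    then have "m (2 * n) = 0" unfolding m_def by (rule integral_eq_zero_AE)
    then show False using cs[of n] pos'[of n] by simp
  qed
  define \<tau> where "\<tau> n = m n powr (- 1 / (2 * real n))" for n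
  have even: "\<tau> (2 * Suc n) \<le> C * m' (Suc n) powr (- 1 / (2 * real (Suc n)))" for n
  proof -
    define N where "N = real (Suc n)"
    have N: "N \<ge> 1" by (simp add: N_def)
    let ?m' = "m' (Suc n)" and ?m = "m (2 * Suc n)"
    have "?m' powr (1 / (2 * N)) = (?m'\<^sup>2) powr (1 / (4 * N))"
      using pos'[of "Suc n"] by (simp add: powr_powr flip: powr_numeral)
    also have "\<dots> \<le> (C * ?m) powr (1 / (4 * N))"
      using N by (intro powr_mono2 cs) auto
    also have "\<dots> = C powr (1 / (4 * N)) * ?m powr (1 / (4 * N))"
      using C m_nn by (simp add: powr_mult)
    also have "C powr (1 / (4 * N)) \<le> C powr 1"
      using C N by (intro powr_mono) (auto simp: field_simps)
    finally have "?m' powr (1 / (2 * N)) \<le> C * ?m powr (1 / (4 * N))"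
      using C by (simp add: mult_right_mono)
    then have "1 / ?m powr (1 / (4 * N)) \<le> C * (1 / ?m' powr (1 / (2 * N)))"
      using pos'[of "Suc n"] m_pos[of "2 * Suc n"] by (simp add: field_simps)
    moreover have "- 1 / (2 * real (2 * Suc n)) = - (1 / (4 * N))" "- 1 / (2 * real (Suc n)) = - (1 / (2 * N))"
      by (simp_all add: N_def)
    ultimately show ?thesis unfolding \<tau>_def by (simp only: powr_minus_divide)
  qed
  define B where "B = 1 + measure \<nu> (space \<nu>)"
  have B: "B \<ge> 1" by (simp add: B_def)
  have odd: "\<tau> (2 * Suc n + 1) \<le> B * \<tau> (2 * Suc n)" for n
  proof -
    define k where "k = 2 * Suc n"
    have k: "k > 0" by (simp add: k_def)
    define l where "l = m (k + 1) powr (1 / (2 * real (k + 1)))"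
    have l: "l > 0" using m_pos[of "k + 1"] by (simp add: l_def)
    have lp: "l ^ (2 * (k + 1)) = m (k + 1)"
    proof -
      have "l ^ (2 * (k + 1)) = l powr real (2 * (k + 1))" using l by (simp only: powr_realpow)
      also have "\<dots> = m (k + 1) powr (1 / (2 * real (k + 1)) * real (2 * (k + 1)))"
        by (simp only: l_def powr_powr)
      also have "1 / (2 * real (k + 1)) * real (2 * (k + 1)) = 1"
        by simp
      finally show ?thesis using m_pos[of "k + 1"] by simp
    qed
    (* The threshold l balances the two terms after integration. *)
    have pt: "z ^ (2 * k) \<le> l ^ (2 * k) + z ^ (2 * (k + 1)) / l\<^sup>2" for z :: real
    proof (cases "z\<^sup>2 \<le> l\<^sup>2")
      case True
      then have "(z\<^sup>2) ^ k \<le> (l\<^sup>2) ^ k" by (rule power_mono) auto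
      moreover have "0 \<le> z ^ (2 * (k + 1)) / l\<^sup>2"
        by (intro divide_nonneg_nonneg zero_le_even_power' zero_le_power2)
      ultimately show ?thesis unfolding power_mult by linarith
    next
      case False
      then have "z ^ (2 * k) * l\<^sup>2 \<le> z ^ (2 * k) * z\<^sup>2" by (intro mult_left_mono) auto
      then have "z ^ (2 * k) \<le> z ^ (2 * (k + 1)) / l\<^sup>2"
        using l by (simp add: field_simps power_add power2_eq_square)
      moreover have "0 \<le> l ^ (2 * k)" by (rule zero_le_even_power')
      ultimately show ?thesis by linarith
    qed
    have "m k \<le> (\<integral>y. l ^ (2 * k) + (y $ j) ^ (2 * (k + 1)) / l\<^sup>2 \<partial>\<nu>)"
      unfolding m_def using pt integrable_poly_fun[OF rpf(1)[of j "2 * (k + 1)"]]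
        integrable_poly_fun[OF rpf(1)[of j "2 * k"]]
      by (intro integral_mono) auto
    also have "\<dots> = l ^ (2 * k) * measure \<nu> (space \<nu>) + m (k + 1) / l\<^sup>2"
      unfolding m_def using integrable_poly_fun[OF rpf(1)[of j "2 * (k + 1)"]]
      by (subst Bochner_Integration.integral_add) auto
    also have "m (k + 1) / l\<^sup>2 = l ^ (2 * k)"
      using l unfolding lp[symmetric] by (simp add: power2_eq_square)
    finally have "m k \<le> B * l ^ (2 * k)" by (simp add: B_def algebra_simps)
    then have "m k powr (1 / (2 * real k)) \<le> (B * l ^ (2 * k)) powr (1 / (2 * real k))"
      using m_nn by (intro powr_mono2) auto
    also have "\<dots> = B powr (1 / (2 * real k)) * l"
      using B l k power_powr_inverse[of l "2 * k"] by (simp add: powr_mult)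
    also have "B powr (1 / (2 * real k)) \<le> B powr 1"
      using B k by (intro powr_mono) (auto simp: field_simps)
    finally have "m k powr (1 / (2 * real k)) \<le> B * l"
      using B l by (simp add: mult_right_mono)
    then have "1 / l \<le> B * (1 / m k powr (1 / (2 * real k)))"
      using l m_pos[of k] by (simp add: field_simps)
    then show ?thesis
      by (simp add: \<tau>_def l_def k_def powr_minus_divide del: of_nat_Suc)
  qed
  have \<tau>_nn: "\<tau> n \<ge> 0" for n by (simp add: \<tau>_def)
  have ev: "summable (\<lambda>n. \<tau> (2 * Suc n))"
    by (rule summable_comparison_test'[OF summable_mult[OF summ, of C]]) (use even \<tau>_nn in auto)
  have od: "summable (\<lambda>n. \<tau> (2 * Suc n + 1))"
    by (rule summable_comparison_test'[OF summable_mult[OF ev, of B]]) (use odd \<tau>_nn in auto)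
  have "summable (\<lambda>n. \<tau> (n + 2))"
    by (rule summable_even_odd) (use ev od \<tau>_nn in \<open>simp_all\<close>)
  then have s: "summable (\<lambda>n. \<tau> (Suc n))"
    using summable_iff_shift[of \<tau> 2] summable_Suc_iff[of \<tau>] by simp
  have "carleman_term \<nu> j (Suc d) = ennreal (\<tau> (Suc d))" for d
    using m_pos[of "Suc d"] by (simp add: carleman_term_def m_def \<tau>_def Let_def)
  moreover have "suminf (\<lambda>d. carleman_term \<nu> j (Suc d)) = \<infinity>"
    using carleman by (simp only: carleman_def)
  ultimately have "suminf (\<lambda>d. ennreal (\<tau> (Suc d))) = \<infinity>" by simp
  then show False using ennreal_suminf_neq_top[OF s \<tau>_nn] by (simp only: infinity_ennreal_def)
qed

text \<open>
  The bounded functions in the closure of the polynomials in \<open>L\<^sup>2(p\<^sup>2 \<nu>)\<close> for every polynomial \<open>p\<close>. Allowing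
  all weights makes the class closed under products.
\<close>

definition approximable :: "(real ^ 'm \<Rightarrow> real) \<Rightarrow> bool" where
  "approximable f \<longleftrightarrow> f \<in> borel_measurable borel \<and> (\<forall>y. \<bar>f y\<bar> \<le> 1) \<and>
     (\<forall>p \<epsilon>. real_polynomial_function p \<longrightarrow> \<epsilon> > 0 \<longrightarrow>
       (\<exists>q. real_polynomial_function q \<and> (\<integral>y. (f y - q y)\<^sup>2 * (p y)\<^sup>2 \<partial>\<nu>) < \<epsilon>))"

lemma integrable_bounded_mult_poly:
  assumes [measurable]: "f \<in> borel_measurable borel" and f: "\<And>y. \<bar>f y\<bar> \<le> C"
    and p: "real_polynomial_function p"
  shows "integrable \<nu> (\<lambda>y. f y * p y)"
proof (rule Bochner_Integration.integrable_bound)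
  show "integrable \<nu> (\<lambda>y. C * p y)" by (intro integrable_mult_right integrable_poly_fun p)
  show "AE y in \<nu>. norm (f y * p y) \<le> norm (C * p y)"
    using f by (intro AE_I2) (simp add: abs_mult, meson abs_ge_self mult_right_mono order_trans abs_ge_zero)
  have [measurable]: "p \<in> borel_measurable borel" using p by (rule measurable_real_polynomial_function)
  show "(\<lambda>y. f y * p y) \<in> borel_measurable \<nu>" by measurable
qed

lemma integrable_approx_error:
  assumes f: "f \<in> borel_measurable borel" "\<And>y. \<bar>f y\<bar> \<le> 1"
    and q: "real_polynomial_function q" and p: "real_polynomial_function p"
  shows "integrable \<nu> (\<lambda>y. (f y - q y)\<^sup>2 * (p y)\<^sup>2)"
proof -
  have eq: "(\<lambda>y. (f y - q y)\<^sup>2 * (p y)\<^sup>2) =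
      (\<lambda>y. (f y * f y) * (p y * p y) - f y * (2 * (q y * (p y * p y))) + (q y * q y) * (p y * p y))"
    by (auto simp: fun_eq_iff power2_eq_square algebra_simps)
  note [measurable] = f(1)
  have "\<bar>f y * f y\<bar> \<le> 1" for y
    using f(2)[of y] by (simp add: abs_square_le_1 flip: power2_eq_square)
  then have "integrable \<nu> (\<lambda>y. (f y * f y) * (p y * p y))"
    by (intro integrable_bounded_mult_poly real_polynomial_function.intros(4) p) measurable
  moreover have "integrable \<nu> (\<lambda>y. f y * (2 * (q y * (p y * p y))))"
    using f by (intro integrable_bounded_mult_poly real_polynomial_function.intros(2,4) p q)
  moreover have "integrable \<nu> (\<lambda>y. (q y * q y) * (p y * p y))"
    by (intro integrable_poly_fun real_polynomial_function.intros(4) p q)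
  ultimately show ?thesis unfolding eq by simp
qed

lemma approximable_one: "approximable (\<lambda>_. 1)"
  unfolding approximable_def using real_polynomial_function.intros(2)[of 1]
  by (auto intro!: exI[of _ "\<lambda>_. 1"])

lemma approximable_mult:
  assumes f: "approximable f" and g: "approximable g"
  shows "approximable (\<lambda>y. f y * g y)"
  unfolding approximable_def
proof (intro conjI allI impI)
  have fb: "f \<in> borel_measurable borel" "\<And>y. \<bar>f y\<bar> \<le> 1"
    and gb: "g \<in> borel_measurable borel" "\<And>y. \<bar>g y\<bar> \<le> 1"
    using f g by (auto simp: approximable_def)
  show m: "(\<lambda>y. f y * g y) \<in> borel_measurable borel" using fb gb by measurable
  show b: "\<bar>f y * g y\<bar> \<le> 1" for y using fb(2)[of y] gb(2)[of y] unfolding abs_mult by (intro mult_le_one) auto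
  fix p :: "real ^ 'm \<Rightarrow> real" and \<epsilon> :: real assume p: "real_polynomial_function p" and \<epsilon>: "\<epsilon> > 0"
  have \<epsilon>4: "\<epsilon> / 4 > 0" using \<epsilon> by simp
  obtain r where r: "real_polynomial_function r" "(\<integral>y. (g y - r y)\<^sup>2 * (p y)\<^sup>2 \<partial>\<nu>) < \<epsilon> / 4"
    using g p \<epsilon>4 unfolding approximable_def by blast
  have rp: "real_polynomial_function (\<lambda>y. r y * p y)"
    by (intro real_polynomial_function.intros(4) r p)
  obtain q where q: "real_polynomial_function q" "(\<integral>y. (f y - q y)\<^sup>2 * (r y * p y)\<^sup>2 \<partial>\<nu>) < \<epsilon> / 4"
    using f rp \<epsilon>4 unfolding approximable_def by blast
  have qr: "real_polynomial_function (\<lambda>y. q y * r y)"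
    by (intro real_polynomial_function.intros(4) q r)
  (* f g - q r = f (g - r) + r (f - q), where f is bounded and r joins the weight. *)
  have pt: "(f y * g y - q y * r y)\<^sup>2 * (p y)\<^sup>2 \<le>
      2 * ((g y - r y)\<^sup>2 * (p y)\<^sup>2) + 2 * ((f y - q y)\<^sup>2 * (r y * p y)\<^sup>2)" for y
  proof -
    define s where "s = f y * (g y - r y) * p y"
    define t where "t = (f y - q y) * (r y * p y)"
    have "(f y * g y - q y * r y)\<^sup>2 * (p y)\<^sup>2 = (s + t)\<^sup>2"
      by (simp add: s_def t_def power_mult_distrib[symmetric]) (simp add: algebra_simps)
    also have "\<dots> \<le> 2 * s\<^sup>2 + 2 * t\<^sup>2"
      using zero_le_power2[of "s - t"] by (simp add: power2_diff power2_sum)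
    also have "s\<^sup>2 \<le> (g y - r y)\<^sup>2 * (p y)\<^sup>2"
    proof -
      have "(f y)\<^sup>2 \<le> 1" using fb(2)[of y] by (simp add: abs_square_le_1)
      then have "(f y)\<^sup>2 * ((g y - r y)\<^sup>2 * (p y)\<^sup>2) \<le> 1 * ((g y - r y)\<^sup>2 * (p y)\<^sup>2)"
        by (intro mult_right_mono) auto
      then show ?thesis by (simp add: s_def power_mult_distrib mult.assoc)
    qed
    finally show ?thesis by (simp add: t_def power_mult_distrib)
  qed
  have "(\<integral>y. (f y * g y - q y * r y)\<^sup>2 * (p y)\<^sup>2 \<partial>\<nu>) \<le>
      (\<integral>y. 2 * ((g y - r y)\<^sup>2 * (p y)\<^sup>2) + 2 * ((f y - q y)\<^sup>2 * (r y * p y)\<^sup>2) \<partial>\<nu>)"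
    using pt integrable_approx_error[OF m b qr p] integrable_approx_error[OF gb r(1) p]
      integrable_approx_error[OF fb q(1) rp]
    by (intro integral_mono) auto
  also have "\<dots> = 2 * (\<integral>y. (g y - r y)\<^sup>2 * (p y)\<^sup>2 \<partial>\<nu>) + 2 * (\<integral>y. (f y - q y)\<^sup>2 * (r y * p y)\<^sup>2 \<partial>\<nu>)"
    using integrable_approx_error[OF gb r(1) p] integrable_approx_error[OF fb q(1) rp] by simp
  also have "\<dots> < \<epsilon>" using r(2) q(2) by simp
  finally show "\<exists>q. real_polynomial_function q \<and> (\<integral>y. (f y * g y - q y)\<^sup>2 * (p y)\<^sup>2 \<partial>\<nu>) < \<epsilon>"
    using qr by (intro exI[of _ "\<lambda>y. q y * r y"]) simp
qed

lemma approximable_prod: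
  "finite I \<Longrightarrow> (\<And>i. i \<in> I \<Longrightarrow> approximable (f i)) \<Longrightarrow> approximable (\<lambda>y. \<Prod>i\<in>I. f i y)"
  by (induction I rule: finite_induct) (auto simp: approximable_one intro!: approximable_mult)

lemma approximable_power: "approximable f \<Longrightarrow> approximable (\<lambda>y. f y ^ n)"
  by (induction n) (auto simp: approximable_one intro!: approximable_mult)

text \<open>The one-variable theorem for the coordinate \<open>j\<close> under the measure \<open>p\<^sup>2 \<nu>\<close>.\<close>

lemma approximable_cauchy_kernel: "approximable (\<lambda>y. 1 / ((y $ j - a)\<^sup>2 + 1))"
  unfolding approximable_def
proof (intro conjI allI impI)
  show "(\<lambda>y. 1 / ((y $ j - a)\<^sup>2 + 1)) \<in> borel_measurable borel" by measurable
  show "\<bar>1 / ((y $ j - a)\<^sup>2 + 1)\<bar> \<le> 1" for y :: "real ^ 'm"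
  proof -
    have "0 < (y $ j - a)\<^sup>2 + 1" by (simp add: add_nonneg_pos)
    then show ?thesis by simp
  qed
  fix p :: "real ^ 'm \<Rightarrow> real" and \<epsilon> :: real assume p: "real_polynomial_function p" and \<epsilon>: "\<epsilon> > 0"
  have [measurable]: "p \<in> borel_measurable borel" using p by (rule measurable_real_polynomial_function)
  define M where "M = density \<nu> (\<lambda>y. ennreal ((p y)\<^sup>2))"
  have int_M: "integral\<^sup>L M f = (\<integral>y. f y * (p y)\<^sup>2 \<partial>\<nu>)" if [measurable]: "f \<in> borel_measurable borel" for f
    unfolding M_def by (subst integral_density) (auto simp: mult.commute)
  interpret real_moments M "\<lambda>y. y $ j"
  proof
    show "(\<lambda>y. y $ j) \<in> borel_measurable M" unfolding M_def by measurable
    show "integrable M (\<lambda>y. y $ j ^ n)" for n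
      unfolding M_def
      by (subst integrable_density)
        (auto simp: power2_eq_square intro!: integrable_poly_fun real_polynomial_function.intros(4) p poly_fun_coord)
  qed
  have L: "L (monom 1 (2 * n)) = (\<integral>y. (y $ j) ^ (2 * n) * (p y)\<^sup>2 \<partial>\<nu>)" for n
    unfolding F_def by (subst int_M) (auto simp: poly_monom)
  obtain q where q: "(\<integral>y. (v a 1 (y $ j) - poly q (y $ j))\<^sup>2 \<partial>M) < \<epsilon>"
    using poly_approx_v[of 1 \<epsilon> a] carleman_weighted[OF p, of j] \<epsilon> unfolding L by auto
  have "(\<integral>y. (v a 1 (y $ j) - poly q (y $ j))\<^sup>2 \<partial>M) =
      (\<integral>y. (1 / ((y $ j - a)\<^sup>2 + 1) - poly q (y $ j))\<^sup>2 * (p y)\<^sup>2 \<partial>\<nu>)"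
    unfolding v_def[OF zero_less_one] power_one by (rule int_M) measurable
  then show "\<exists>q. real_polynomial_function q \<and>
      (\<integral>y. (1 / ((y $ j - a)\<^sup>2 + 1) - q y)\<^sup>2 * (p y)\<^sup>2 \<partial>\<nu>) < \<epsilon>"
    using q real_polynomial_function_poly[OF real_polynomial_function.intros(1)[OF bounded_linear_vec_nth[of j]], of q]
    by (intro exI[of _ "\<lambda>y. poly q (y $ j)"]) simp
qed

text \<open>
  The weight \<open>1 + h\<^sup>2\<close> dominates both \<open>\<bar>h\<bar>\<close> and \<open>h\<^sup>2\<close> after squaring, so approximation in that weight controls
  \<open>\<integral> (q\<^sup>2 - f\<^sup>2) h d\<nu>\<close>.
\<close>

lemma integral_approximable_square_nonneg:
  assumes h: "real_polynomial_function h"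
    and pos: "\<And>q. real_polynomial_function q \<Longrightarrow> 0 \<le> (\<integral>y. (q y)\<^sup>2 * h y \<partial>\<nu>)"
    and f: "approximable f"
  shows "0 \<le> (\<integral>y. (f y)\<^sup>2 * h y \<partial>\<nu>)"
proof (rule field_le_epsilon)
  fix \<delta> :: real assume \<delta>: "\<delta> > 0"
  have fb: "f \<in> borel_measurable borel" "\<And>y. \<bar>f y\<bar> \<le> 1" using f by (auto simp: approximable_def)
  note [measurable] = fb(1)
  define c where "c = measure \<nu> (space \<nu>) + 1"
  have c: "c > 0" unfolding c_def by (simp add: add_nonneg_pos)
  define \<eta> where "\<eta> = \<delta> / (2 * c)"
  have \<eta>: "\<eta> > 0" using \<delta> c by (simp add: \<eta>_def)
  define p where "p y = 1 + (h y)\<^sup>2" for y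
  have p: "real_polynomial_function p"
    unfolding p_def power2_eq_square by (intro real_polynomial_function.intros(2-) h)
  have "\<delta> / (2 * (1 + 1 / \<eta>)) > 0" using \<delta> \<eta> by (simp add: add_pos_pos)
  then obtain q where q: "real_polynomial_function q"
    "(\<integral>y. (f y - q y)\<^sup>2 * (p y)\<^sup>2 \<partial>\<nu>) < \<delta> / (2 * (1 + 1 / \<eta>))"
    using f p unfolding approximable_def by blast
  have pt: "(q y)\<^sup>2 * h y \<le> (f y)\<^sup>2 * h y + (1 + 1 / \<eta>) * ((f y - q y)\<^sup>2 * (p y)\<^sup>2) + \<eta>" for y
  proof -
    define e where "e = q y - f y"
    have hp: "\<bar>h y\<bar> \<le> (p y)\<^sup>2" "(h y)\<^sup>2 \<le> (p y)\<^sup>2"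
    proof -
      have "\<bar>h y\<bar> \<le> p y" using zero_le_power2[of "\<bar>h y\<bar> - 1"] by (simp add: p_def power2_diff)
      moreover have "p y \<ge> 1" by (simp add: p_def)
      moreover from this have "p y * 1 \<le> p y * p y" by (intro mult_left_mono) auto
      ultimately show "\<bar>h y\<bar> \<le> (p y)\<^sup>2" unfolding power2_eq_square by linarith
      show "(h y)\<^sup>2 \<le> (p y)\<^sup>2"
        using abs_le_square_iff[of "h y" "p y"] \<open>\<bar>h y\<bar> \<le> p y\<close> by simp
    qed
    have "(q y)\<^sup>2 * h y - (f y)\<^sup>2 * h y = e\<^sup>2 * h y + 2 * f y * e * h y"
      by (simp add: e_def power2_eq_square algebra_simps)
    also have "e\<^sup>2 * h y \<le> e\<^sup>2 * (p y)\<^sup>2"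
      using hp(1) by (intro mult_left_mono) auto
    also have "2 * f y * e * h y \<le> e\<^sup>2 * (p y)\<^sup>2 / \<eta> + \<eta>"
    proof -
      have "2 * f y * e * h y \<le> 2 * \<bar>e * h y\<bar>"
        using fb(2)[of y] mult_right_mono[of "\<bar>f y\<bar>" 1 "\<bar>e * h y\<bar>"]
          abs_ge_self[of "f y * (e * h y)"] by (simp add: abs_mult mult_ac)
      also have "\<dots> \<le> (e * h y)\<^sup>2 / \<eta> + \<eta>"
        using zero_le_power2[of "\<bar>e * h y\<bar> - \<eta>"] \<eta> by (simp add: power2_diff field_simps power2_eq_square)
      also have "(e * h y)\<^sup>2 / \<eta> \<le> e\<^sup>2 * (p y)\<^sup>2 / \<eta>"
        using hp(2) \<eta> by (simp add: power_mult_distrib divide_right_mono mult_left_mono)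
      finally show ?thesis by simp
    qed
    finally show ?thesis by (simp add: e_def power2_commute distrib_right)
  qed
  have f2: "\<bar>(f y)\<^sup>2\<bar> \<le> 1" for y using fb(2)[of y] by (simp add: abs_square_le_1)
  have int: "integrable \<nu> (\<lambda>y. (f y)\<^sup>2 * h y)"
    by (intro integrable_bounded_mult_poly[OF _ f2 h]) measurable
  note ierr = integrable_approx_error[OF fb q(1) p]
  have "0 \<le> (\<integral>y. (q y)\<^sup>2 * h y \<partial>\<nu>)" using q(1) by (rule pos)
  also have "\<dots> \<le> (\<integral>y. (f y)\<^sup>2 * h y + (1 + 1 / \<eta>) * ((f y - q y)\<^sup>2 * (p y)\<^sup>2) + \<eta> \<partial>\<nu>)"
  proof (rule integral_mono[OF _ _ pt])
    show "integrable \<nu> (\<lambda>y. (q y)\<^sup>2 * h y)"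
      unfolding power2_eq_square by (intro integrable_poly_fun real_polynomial_function.intros(4) q h)
  qed (use int ierr in simp)
  also have "\<dots> = (\<integral>y. (f y)\<^sup>2 * h y \<partial>\<nu>) + (1 + 1 / \<eta>) * (\<integral>y. (f y - q y)\<^sup>2 * (p y)\<^sup>2 \<partial>\<nu>) + \<eta> * measure \<nu> (space \<nu>)"
    using int ierr by simp
  also have "(1 + 1 / \<eta>) * (\<integral>y. (f y - q y)\<^sup>2 * (p y)\<^sup>2 \<partial>\<nu>) \<le> \<delta> / 2"
  proof -
    have "1 + 1 / \<eta> > 0" using \<eta> by (simp add: add_pos_pos)
    then show ?thesis using q(2) by (simp add: field_simps)
  qed
  also have "\<eta> * measure \<nu> (space \<nu>) \<le> \<delta> / 2"
  proof -
    have "\<eta> * measure \<nu> (space \<nu>) \<le> \<eta> * c" using \<eta> by (intro mult_left_mono) (auto simp: c_def)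
    then show ?thesis using c by (simp add: \<eta>_def)
  qed
  finally show "0 \<le> (\<integral>y. (f y)\<^sup>2 * h y \<partial>\<nu>) + \<delta>" by simp
qed

text \<open>
  High powers of the product of the kernels centred at \<open>y\<^sub>0\<close> concentrate at \<open>y\<^sub>0\<close>, so a negative value of
  \<open>h\<close> there would dominate the integral.
\<close>

theorem nonneg_on_support:
  assumes h: "real_polynomial_function h"
    and pos: "\<And>q. real_polynomial_function q \<Longrightarrow> 0 \<le> (\<integral>y. (q y)\<^sup>2 * h y \<partial>\<nu>)"
    and y\<^sub>0: "y\<^sub>0 \<in> supp \<nu>"
  shows "0 \<le> h y\<^sub>0"
proof (rule ccontr)
  assume neg: "\<not> 0 \<le> h y\<^sub>0"
  define \<delta> where "\<delta> = - h y\<^sub>0 / 2"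
  have \<delta>: "\<delta> > 0" using neg by (simp add: \<delta>_def)
  have cont_h: "continuous_on UNIV h"
    using h by (intro continuous_on_polymonial_function) (simp add: real_polynomial_function_eq[symmetric])
  have [measurable]: "h \<in> borel_measurable borel" using h by (rule measurable_real_polynomial_function)
  define G where "G y = (\<Prod>j\<in>UNIV. 1 / ((y $ j - y\<^sub>0 $ j)\<^sup>2 + 1))" for y :: "real ^ 'm"
  have approx: "approximable (\<lambda>y. G y ^ n)" for n
    unfolding G_def by (intro approximable_power approximable_prod approximable_cauchy_kernel) simp
  have G_pos: "G y > 0" for y unfolding G_def by (intro prod_pos) (simp add: add_nonneg_pos)
  have cont_G: "continuous_on UNIV G"
    unfolding G_def by (intro continuous_intros) (simp add: add_nonneg_eq_0_iff)
  have G0: "G y\<^sub>0 = 1" by (simp add: G_def)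
  obtain \<rho> where \<rho>: "\<rho> > 0" "\<And>y. dist y y\<^sub>0 < \<rho> \<Longrightarrow> h y < - \<delta>"
  proof -
    have "open {y. h y < - \<delta>}" by (rule open_Collect_less[OF cont_h continuous_on_const])
    moreover have "y\<^sub>0 \<in> {y. h y < - \<delta>}" using neg by (simp add: \<delta>_def)
    ultimately obtain e where "e > 0" "ball y\<^sub>0 e \<subseteq> {y. h y < - \<delta>}" using openE by blast
    then show thesis using that[of e] by (auto simp: dist_commute subset_iff)
  qed
  define \<kappa> where "\<kappa> = 1 / (1 + \<rho>\<^sup>2)"
  have \<kappa>: "0 < \<kappa>" "\<kappa> < 1" using \<rho> by (simp_all add: \<kappa>_def add_pos_pos)
  have G_far: "G y \<le> \<kappa>" if "\<not> dist y y\<^sub>0 < \<rho>" for y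
  proof -
    have "1 + (\<Sum>j\<in>J. s j) \<le> (\<Prod>j\<in>J. s j + 1)" if "finite J" "\<And>j. 0 \<le> s j" for J :: "'m set" and s :: "'m \<Rightarrow> real"
      using that(1)
    proof (induction J rule: finite_induct)
      case (insert j J)
      have "1 \<le> (\<Prod>j\<in>J. s j + 1)" by (intro prod_ge_1) (simp add: that(2))
      then have "s j * 1 \<le> s j * (\<Prod>j\<in>J. s j + 1)" using that(2) by (intro mult_left_mono)
      then show ?case using insert by (simp add: distrib_right)
    qed simp
    from this[of UNIV "\<lambda>j. (y $ j - y\<^sub>0 $ j)\<^sup>2"]
    have "1 + (\<Sum>j\<in>UNIV. (y $ j - y\<^sub>0 $ j)\<^sup>2) \<le> (\<Prod>j\<in>UNIV. (y $ j - y\<^sub>0 $ j)\<^sup>2 + 1)" by simp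
    moreover have "(\<Sum>j\<in>UNIV. (y $ j - y\<^sub>0 $ j)\<^sup>2) = (dist y y\<^sub>0)\<^sup>2"
      by (simp add: dist_vec_def L2_set_def sum_nonneg dist_real_def)
    moreover have "\<rho>\<^sup>2 \<le> (dist y y\<^sub>0)\<^sup>2" using that \<rho> by (intro power_mono) auto
    ultimately have "1 + \<rho>\<^sup>2 \<le> (\<Prod>j\<in>UNIV. (y $ j - y\<^sub>0 $ j)\<^sup>2 + 1)" by linarith
    then show ?thesis
      using \<rho> unfolding G_def \<kappa>_def prod_dividef by (simp add: frac_le add_pos_pos)
  qed
  (* Any level strictly between the bound far away from the centre and the value 1 at the centre. *)
  define \<kappa>' where "\<kappa>' = (1 + \<kappa>) / 2"
  have \<kappa>': "\<kappa> < \<kappa>'" "\<kappa>' < 1" "0 < \<kappa>'" using \<kappa> by (simp_all add: \<kappa>'_def)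
  define U where "U = {y. \<kappa>' < G y}"
  have U: "open U" "y\<^sub>0 \<in> U"
    unfolding U_def using \<kappa>' G0 by (auto intro!: open_Collect_less continuous_on_const cont_G)
  have U_near: "dist y y\<^sub>0 < \<rho>" if "y \<in> U" for y
    using that G_far[of y] \<kappa>' unfolding U_def by force
  have Um [measurable]: "U \<in> sets \<nu>" using U(1) sets_\<nu> by simp
  have "emeasure \<nu> U > 0" using y\<^sub>0 U by (simp add: supp_def)
  then have mU: "measure \<nu> U > 0" by (simp add: emeasure_eq_measure)
  define I where "I = (\<integral>y. \<bar>h y\<bar> \<partial>\<nu>)"
  have key: "\<delta> * measure \<nu> U \<le> (\<kappa> / \<kappa>') ^ (2 * n) * I" for n
  proof -
    have pt: "(G y ^ n)\<^sup>2 * h y \<le> \<kappa> ^ (2 * n) * \<bar>h y\<bar> - \<delta> * \<kappa>' ^ (2 * n) * indicator U y" for y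
    proof (cases "dist y y\<^sub>0 < \<rho>")
      case True
      then have hy: "h y \<le> - \<delta>" using \<rho>(2) by fastforce
      have "0 \<le> \<kappa> ^ (2 * n) * \<bar>h y\<bar>" using \<kappa> by simp
      moreover have "(G y ^ n)\<^sup>2 * h y \<le> - (\<delta> * \<kappa>' ^ (2 * n) * indicator U y)"
      proof (cases "y \<in> U")
        case True
        then have "\<kappa>' ^ (2 * n) \<le> G y ^ (2 * n)" using \<kappa>' by (intro power_mono) (auto simp: U_def)
        then have "\<kappa>' ^ (2 * n) * \<delta> \<le> G y ^ (2 * n) * - h y"
          using \<delta> hy \<kappa>' by (intro mult_mono) auto
        then show ?thesis using True by (simp add: power_mult[symmetric] mult.commute)
      next
        case False
        have "(G y ^ n)\<^sup>2 * h y \<le> 0" using hy \<delta> by (intro mult_nonneg_nonpos) auto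
        then show ?thesis using False by simp
      qed
      ultimately show ?thesis by linarith
    next
      case False
      then have "y \<notin> U" using U_near by blast
      have "(G y ^ n)\<^sup>2 * h y \<le> (G y ^ n)\<^sup>2 * \<bar>h y\<bar>" by (intro mult_left_mono) auto
      also have "(G y ^ n)\<^sup>2 \<le> \<kappa> ^ (2 * n)"
        using G_far[OF False] G_pos[of y] power_mono[of "G y" \<kappa> "2 * n"]
        by (simp add: power_mult[symmetric] mult.commute)
      finally show ?thesis using \<open>y \<notin> U\<close> by (simp add: mult_right_mono)
    qed
    have "0 \<le> (\<integral>y. (G y ^ n)\<^sup>2 * h y \<partial>\<nu>)"
      by (rule integral_approximable_square_nonneg[OF h pos approx])
    also have "\<dots> \<le> (\<integral>y. \<kappa> ^ (2 * n) * \<bar>h y\<bar> - \<delta> * \<kappa>' ^ (2 * n) * indicator U y \<partial>\<nu>)"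
    proof (rule integral_mono[OF _ _ pt])
      have "(\<lambda>y. (G y ^ n)\<^sup>2) \<in> borel_measurable borel" "\<bar>(G y ^ n)\<^sup>2\<bar> \<le> 1" for y
        using approx[of n] by (auto simp: approximable_def abs_square_le_1)
      then show "integrable \<nu> (\<lambda>y. (G y ^ n)\<^sup>2 * h y)"
        by (intro integrable_bounded_mult_poly[OF _ _ h])
    qed (use integrable_poly_fun[OF h] Um in \<open>auto intro!: integrable_real_indicator simp: emeasure_eq_measure\<close>)
    also have "\<dots> = \<kappa> ^ (2 * n) * I - \<delta> * \<kappa>' ^ (2 * n) * measure \<nu> U"
      using integrable_poly_fun[OF h] Um unfolding I_def
      by (subst Bochner_Integration.integral_diff) (auto simp: emeasure_eq_measure)
    finally have "\<delta> * measure \<nu> U * \<kappa>' ^ (2 * n) \<le> \<kappa> ^ (2 * n) * I" by (simp add: mult_ac)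
    then show ?thesis using \<kappa>' by (simp add: power_divide field_simps)
  qed
  have "(\<lambda>n. (\<kappa> / \<kappa>') ^ (2 * n) * I) \<longlonglongrightarrow> 0 * I"
  proof (intro tendsto_mult tendsto_const)
    have "((\<kappa> / \<kappa>')\<^sup>2) < 1" using \<kappa> \<kappa>' by (simp add: power_less_one_iff abs_square_less_1)
    then show "(\<lambda>n. (\<kappa> / \<kappa>') ^ (2 * n)) \<longlonglongrightarrow> 0"
      unfolding power_mult by (intro LIMSEQ_power_zero) simp
  qed
  then have "\<delta> * measure \<nu> U \<le> 0 * I"
    by (rule LIMSEQ_le_const) (use key in blast)
  then show False using \<delta> mU by (simp add: mult_le_0_iff)
qed

end

section \<open>Localizing matrices and the support of the measure\<close>

lemma ex_polys: "\<exists>l. q \<in> polys l"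
proof
  show "q \<in> polys (\<Sum>\<alpha>\<in>keys q. mdeg \<alpha>)"
    by (auto simp: polys_def multiindices_def intro: member_le_sum)
qed

lemma riesz_mult_monomial: "riesz f (p * monomial \<gamma>) = riesz (\<lambda>\<alpha>. f (\<alpha> + \<gamma>)) p"
  unfolding riesz_mult by (simp add: riesz_def)

lemma riesz_y_integral_monomial_mult:
  assumes "finite_moments \<nu>"
  shows "riesz w (y_integral \<nu> (Poly_Mapping.single a 1 * g)) =
    (\<Sum>e\<in>keys g. lookup g e * (w (fst a + fst e) * (\<integral>y. mpow y (snd a + snd e) \<partial>\<nu>)))"
proof -
  have single: "riesz w (y_integral \<nu> (Poly_Mapping.single b t)) = t * (w (fst b) * (\<integral>y. mpow y (snd b) \<partial>\<nu>))" for b t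
    unfolding riesz_def sum_keys_y_integral[OF assms] by (cases "t = 0") (simp_all add: case_prod_beta)
  have "Poly_Mapping.single a 1 * g = Poly_Mapping.single a 1 * (\<Sum>e\<in>keys g. Poly_Mapping.single e (lookup g e))"
    by (simp add: sum_single_lookup)
  also have "\<dots> = (\<Sum>e\<in>keys g. Poly_Mapping.single (a + e) (lookup g e))"
    by (simp add: sum_distrib_left mult_single)
  finally show ?thesis by (simp add: riesz_y_integral_sum[OF assms] single)
qed

text \<open>
  For a test polynomial \<open>p(x) q(y)\<close> the quadratic form of the localizing matrix separates, for each
  monomial of \<open>g\<close>, into a moment in \<open>x\<close> and a moment in \<open>y\<close>.
\<close>

lemma localizing_psd_product:
  assumes fin: "finite_moments \<nu>" and psd: "localizing_psd \<nu> g w k l"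
    and p: "p \<in> polys m" "int m \<le> loc_order k (deg_x g)"
    and q: "q \<in> polys n" "int n \<le> loc_order l (deg_y g)"
  shows "0 \<le> (\<Sum>e\<in>keys g. lookup g e * (riesz w (p * p * monomial (fst e)) *
      riesz (\<lambda>\<beta>. \<integral>y. mpow y \<beta> \<partial>\<nu>) (q * q * monomial (snd e))))"
proof -
  define I where "I = loc_index g k l"
  define J where "J = keys p \<times> keys q"
  define v where "v a = lookup p (fst a) * lookup q (snd a)" for a
  let ?m = "\<lambda>\<beta>. \<integral>y. mpow y \<beta> \<partial>\<nu>"
  have JI: "J \<subseteq> I"
    using p q by (fastforce simp: J_def I_def loc_index_def polys_def multiindices_def)
  have v0: "v a = 0" if "a \<notin> J" for a
    using that by (cases a) (auto simp: v_def J_def in_keys_iff)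
  have finI: "finite I" unfolding I_def by (rule finite_loc_index)
  have "0 \<le> quad_form I (localizing_matrix \<nu> g w k l) v"
    using psd by (simp add: localizing_psd_def pos_semidef_def I_def)
  also have "\<dots> = (\<Sum>a\<in>I. \<Sum>b\<in>I. v a * riesz w (y_integral \<nu> (Poly_Mapping.single (a + b) 1 * g)) * v b)"
    unfolding quad_form_def localizing_matrix_entry[OF fin] I_def by simp
  also have "\<dots> = (\<Sum>a\<in>J. \<Sum>b\<in>J. v a * riesz w (y_integral \<nu> (Poly_Mapping.single (a + b) 1 * g)) * v b)"
  proof -
    have "(\<Sum>b\<in>I. v a * riesz w (y_integral \<nu> (Poly_Mapping.single (a + b) 1 * g)) * v b) =
        (\<Sum>b\<in>J. v a * riesz w (y_integral \<nu> (Poly_Mapping.single (a + b) 1 * g)) * v b)" for a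
      by (rule sum.mono_neutral_right[OF finI JI]) (simp add: v0)
    then show ?thesis
      by (simp only:) (rule sum.mono_neutral_right[OF finI JI], simp add: v0)
  qed
  also have "\<dots> = (\<Sum>a\<in>J. \<Sum>b\<in>J. \<Sum>e\<in>keys g. lookup g e * (v a * v b *
      (w (fst a + fst b + fst e) * ?m (snd a + snd b + snd e))))"
    unfolding riesz_y_integral_monomial_mult[OF fin] fst_add snd_add sum_distrib_left sum_distrib_right
    by (simp add: mult_ac)
  also have "\<dots> = (\<Sum>e\<in>keys g. \<Sum>a\<in>J. \<Sum>b\<in>J. lookup g e * (v a * v b *
      (w (fst a + fst b + fst e) * ?m (snd a + snd b + snd e))))"
    by (subst (2) sum.swap, subst sum.swap) simp
  also have "\<dots> = (\<Sum>e\<in>keys g. lookup g e * (riesz w (p * p * monomial (fst e)) *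
      riesz ?m (q * q * monomial (snd e))))"
  proof (rule sum.cong[OF refl])
    fix e
    show "(\<Sum>a\<in>J. \<Sum>b\<in>J. lookup g e * (v a * v b *
        (w (fst a + fst b + fst e) * ?m (snd a + snd b + snd e)))) =
      lookup g e * (riesz w (p * p * monomial (fst e)) * riesz ?m (q * q * monomial (snd e)))"
      unfolding riesz_mult_monomial unfolding riesz_mult sum_product J_def v_def sum.cartesian_product'
      by (simp add: sum_distrib_left mult_ac)
  qed
  finally show ?thesis .
qed

context flat_eigenbasis
begin

lemma riesz_eq_sum:
  assumes "p \<in> polys (2 * d)"
  shows "riesz w p = (\<Sum>e\<in>E. (c e)\<^sup>2 * peval p (\<xi> e))"
proof -
  have "riesz w p = (\<Sum>\<alpha>\<in>keys p. lookup p \<alpha> * (\<Sum>e\<in>E. (c e)\<^sup>2 * mpow (\<xi> e) \<alpha>))"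
    unfolding riesz_def
    by (intro sum.cong refl) (use assms in \<open>auto simp: polys_def multiindices_def moments_eq_sum\<close>)
  also have "\<dots> = (\<Sum>e\<in>E. (c e)\<^sup>2 * peval p (\<xi> e))"
    unfolding peval_def sum_distrib_left by (subst sum.swap) (simp add: mult_ac)
  finally show ?thesis .
qed

text \<open>
  Testing the localizing matrix with the Lagrange polynomial of a point \<open>\<xi>\<^sub>e\<close>, times \<open>q(y)\<close>, isolates the
  contribution of that point.
\<close>

lemma localized_integral_nonneg:
  fixes g :: "('n, 'm::finite) rpoly2"
  assumes fin: "finite_moments \<nu>" and e: "e \<in> E"
    and psd: "\<And>l. l \<ge> 1 \<Longrightarrow> localizing_psd \<nu> g w (k + nat \<lceil>real (deg_x g) / 2\<rceil>) l"
    and deg: "2 * k + deg_x g \<le> 2 * d"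
  shows "0 \<le> (\<integral>y. (peval q y)\<^sup>2 * peval2 g (\<xi> e) y \<partial>\<nu>)"
proof -
  let ?m = "\<lambda>\<beta>. \<integral>y. mpow y \<beta> \<partial>\<nu>"
  obtain n where n: "q \<in> polys n" using ex_polys by blast
  have int_mpow: "integrable \<nu> (\<lambda>y. mpow y \<beta>)" for \<beta>
    using fin by (simp add: finite_moments_def)
  have int_peval: "integrable \<nu> (peval r)" for r
    unfolding peval_def[abs_def] by (intro Bochner_Integration.integrable_sum integrable_mult_right int_mpow)
  have riesz_m: "riesz ?m r = (\<integral>y. peval r y \<partial>\<nu>)" for r
    unfolding riesz_def peval_def
    by (subst Bochner_Integration.integral_sum) (auto intro!: int_mpow)
  have square: "riesz w (e * e * monomial \<gamma>) = mpow (\<xi> e) \<gamma>" if \<gamma>: "mdeg \<gamma> \<le> deg_x g" for \<gamma>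
  proof -
    have "e * e * monomial \<gamma> \<in> polys (k + k + mdeg \<gamma>)"
      using e E_polys by (intro polys_mult mono_in_polys) auto
    then have "e * e * monomial \<gamma> \<in> polys (2 * d)"
      using polys_mono[of "k + k + mdeg \<gamma>" "2 * d"] deg \<gamma> by auto
    then have "riesz w (e * e * monomial \<gamma>) = (\<Sum>f\<in>E. (c f)\<^sup>2 * peval (e * e * monomial \<gamma>) (\<xi> f))"
      by (rule riesz_eq_sum)
    also have "\<dots> = (\<Sum>f\<in>E. if f = e then mpow (\<xi> e) \<gamma> else 0)"
    proof (rule sum.cong[OF refl])
      fix f assume f: "f \<in> E"
      have "(c f)\<^sup>2 * peval (e * e * monomial \<gamma>) (\<xi> f) = (c f * peval e (\<xi> f))\<^sup>2 * mpow (\<xi> f) \<gamma>"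
        by (simp add: peval_mult power_mult_distrib power2_eq_square peval_eq_riesz[of "monomial \<gamma>"])
      then show "(c f)\<^sup>2 * peval (e * e * monomial \<gamma>) (\<xi> f) = (if f = e then mpow (\<xi> e) \<gamma> else 0)"
        unfolding lagrange[OF f e] by simp
    qed
    also have "\<dots> = mpow (\<xi> e) \<gamma>" using e finite_E by simp
    finally show ?thesis .
  qed
  have "0 \<le> (\<Sum>a\<in>keys g. lookup g a * (riesz w (e * e * monomial (fst a)) * riesz ?m (q * q * monomial (snd a))))"
  proof (rule localizing_psd_product[OF fin psd])
    show "1 \<le> n + 1 + nat \<lceil>real (deg_y g) / 2\<rceil>" by simp
    show "e \<in> polys k" using e E_polys by blast
    show "int k \<le> loc_order (k + nat \<lceil>real (deg_x g) / 2\<rceil>) (deg_x g)"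
      by (simp add: loc_order_def)
    show "q \<in> polys n" by (fact n)
    show "int n \<le> loc_order (n + 1 + nat \<lceil>real (deg_y g) / 2\<rceil>) (deg_y g)"
      by (simp add: loc_order_def)
  qed
  also have "\<dots> = (\<Sum>a\<in>keys g. lookup g a * (mpow (\<xi> e) (fst a) * (\<integral>y. (peval q y)\<^sup>2 * mpow y (snd a) \<partial>\<nu>)))"
  proof (rule sum.cong[OF refl])
    fix a assume "a \<in> keys g"
    then have "mdeg (fst a) \<le> deg_x g"
      using deg_x_le_iff[of g "deg_x g"] by (cases a) auto
    moreover have "riesz ?m (q * q * monomial (snd a)) = (\<integral>y. (peval q y)\<^sup>2 * mpow y (snd a) \<partial>\<nu>)"
      by (simp add: riesz_m peval_mult power2_eq_square peval_eq_riesz[of "monomial _"])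
    ultimately show "lookup g a * (riesz w (e * e * monomial (fst a)) * riesz ?m (q * q * monomial (snd a))) =
        lookup g a * (mpow (\<xi> e) (fst a) * (\<integral>y. (peval q y)\<^sup>2 * mpow y (snd a) \<partial>\<nu>))"
      by (simp add: square)
  qed
  also have "\<dots> = (\<integral>y. (peval q y)\<^sup>2 * peval2 g (\<xi> e) y \<partial>\<nu>)"
  proof -
    have "integrable \<nu> (\<lambda>y. (peval q y)\<^sup>2 * mpow y \<beta>)" for \<beta>
      using int_peval[of "q * q * monomial \<beta>"]
      by (simp add: peval_mult[abs_def] power2_eq_square peval_eq_riesz[of "monomial _"])
    then have "(\<integral>y. (\<Sum>a\<in>keys g. lookup g a * (mpow (\<xi> e) (fst a) * ((peval q y)\<^sup>2 * mpow y (snd a)))) \<partial>\<nu>) =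
        (\<Sum>a\<in>keys g. lookup g a * (mpow (\<xi> e) (fst a) * (\<integral>y. (peval q y)\<^sup>2 * mpow y (snd a) \<partial>\<nu>)))"
      by (subst Bochner_Integration.integral_sum) auto
    moreover have "(\<Sum>a\<in>keys g. lookup g a * (mpow (\<xi> e) (fst a) * ((peval q y)\<^sup>2 * mpow y (snd a)))) =
        (peval q y)\<^sup>2 * peval2 g (\<xi> e) y" for y
      by (simp add: peval2_def case_prod_beta sum_distrib_left mult_ac)
    ultimately show ?thesis by simp
  qed
  finally show ?thesis .
qed

end

lemma real_polynomial_function_peval2: "real_polynomial_function (\<lambda>y. peval2 g x y)"
  unfolding peval2_def case_prod_beta
  by (intro real_polynomial_function_sum real_polynomial_function.intros(2,4) real_polynomial_function_mpow) simp

text \<open>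
  For \<open>g = 1\<close> and \<open>q = 1\<close> the localizing form is the moment form times the mass of \<open>\<nu>\<close>, which is positive
  because the support is nonempty.
\<close>

lemma moment_matrix_psd:
  fixes \<nu> :: "(real ^ 'm::finite) measure" and w :: "'n::finite multiseq"
  assumes fin: "finite_measure \<nu>" "finite_moments \<nu>" and \<nu>: "supp \<nu> \<noteq> {}"
    and psd: "localizing_psd \<nu> 1 w d 1" and p: "p \<in> polys d"
  shows "0 \<le> riesz w (p * p)"
proof -
  interpret finite_measure \<nu> by (fact fin)
  have deg: "deg_x (1 :: ('n, 'm) rpoly2) = 0" "deg_y (1 :: ('n, 'm) rpoly2) = 0"
    using deg_x_le_iff[of "1 :: ('n, 'm) rpoly2" 0] deg_y_le_iff[of "1 :: ('n, 'm) rpoly2" 0]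
    by (simp_all add: zero_prod_def)
  have one: "(1 :: 'm rpoly) \<in> polys 0" by (simp add: mono_in_polys flip: single_one)
  have "0 \<le> riesz w (p * p) * measure \<nu> (space \<nu>)"
    using localizing_psd_product[OF fin(2) psd p _ one]
    by (simp add: deg loc_order_def zero_prod_def lookup_one riesz_superset[of "{0}" 1])
  moreover have "measure \<nu> (space \<nu>) > 0"
  proof -
    obtain y where "y \<in> supp \<nu>" using \<nu> by blast
    then have "emeasure \<nu> UNIV > 0" by (simp add: supp_def)
    then have "emeasure \<nu> (space \<nu>) > 0"
      by (metis emeasure_notin_sets emeasure_space less_le_trans)
    then show ?thesis by (simp add: emeasure_eq_measure)
  qed
  ultimately show ?thesis by (simp add: zero_le_mult_iff)
qed

theorem theorem4p6:
  fixes Q :: "(real ^ 'm::finite) set"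
    and g :: "nat \<Rightarrow> ('n::finite, 'm) rpoly2"
    and s d d\<^sub>g k r :: nat
    and K :: "(real ^ 'n) set"
    and \<nu> :: "(real ^ 'm) measure"
    and w :: "'n multiseq"
  assumes Q: "Q \<noteq> {}" "closed Q"
    and g0: "g 0 = 1"
    and K: "K = {x. \<forall>y\<in>Q. \<forall>j\<in>{1..s}. peval2 (g j) x y \<ge> 0}"
    and \<nu>: "sets \<nu> = sets borel" "finite_measure \<nu>" "finite_moments \<nu>"
    and supp_\<nu>: "supp \<nu> = Q"
    and carleman_\<nu>: "carleman \<nu>"
    and psd: "\<And>j k l. j \<in> {0..s} \<Longrightarrow> k \<in> {1..d} \<Longrightarrow> l \<ge> 1 \<Longrightarrow> localizing_psd \<nu> (g j) w k l"
    and d\<^sub>g: "d\<^sub>g = Max (insert 1 ((\<lambda>j. deg_x (g j)) ` {1..s}))"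
    and k: "k > 0" "k + d\<^sub>g \<le> d"
    and rank: "r = moment_matrix_rank w k" "moment_matrix_rank w k = moment_matrix_rank w d"
  shows "\<exists>\<mu>. representing_measure d w \<mu> \<and> atomic r \<mu> \<and> supp \<mu> \<subseteq> K \<and>
             (\<forall>\<mu>'. representing_measure d w \<mu>' \<longrightarrow> \<mu>' = \<mu>)"
proof -
  note localizing = psd
  have dg1: "1 \<le> d\<^sub>g" unfolding d\<^sub>g by (intro Max_ge) auto
  have dg_ge: "deg_x (g j) \<le> d\<^sub>g" if "j \<in> {1..s}" for j
    unfolding d\<^sub>g using that by (intro Max_ge) auto
  interpret carleman_measure \<nu>
    by (rule carleman_measure.intro[OF \<nu> carleman_\<nu>])
  interpret flat_moments w d k
  proof
    show "0 \<le> riesz w (p * p)" if "p \<in> polys d" for p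
      by (rule moment_matrix_psd[OF \<nu>(2,3) _ _ that]) (use Q supp_\<nu> localizing[of 0 d 1] g0 k dg1 in auto)
  qed (use k dg1 rank in auto)
  obtain E and \<xi> :: "'n rpoly \<Rightarrow> real ^ 'n" where
    E: "moment_form.orthonormal w E" "E \<subseteq> polys k" "card E = moment_matrix_rank w k"
    "\<And>x. x \<in> polys d \<Longrightarrow> null (x - moment_form.proj w E x)"
    "\<And>e i. e \<in> E \<Longrightarrow> null (X i * e - (\<xi> e $ i) *\<^sub>R e)"
    using joint_eigenbasis by blast
  interpret flat_eigenbasis w d k E \<xi>
    using E by unfold_locales
  have "\<xi> e \<in> K" if e: "e \<in> E" for e
  proof -
    have "0 \<le> peval2 (g j) (\<xi> e) y" if y: "y \<in> Q" and j: "j \<in> {1..s}" for y j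
    proof (rule nonneg_on_support[OF real_polynomial_function_peval2])
      show "y \<in> supp \<nu>" using y supp_\<nu> by simp
      (* The order at which test polynomials of degree k in x are admissible. *)
      have "nat \<lceil>real (deg_x (g j)) / 2\<rceil> \<le> deg_x (g j)" by linarith
      then have "k + nat \<lceil>real (deg_x (g j)) / 2\<rceil> \<in> {1..d}"
        using dg_ge[OF j] k unfolding atLeastAtMost_iff by linarith
      then have psd_j: "localizing_psd \<nu> (g j) w (k + nat \<lceil>real (deg_x (g j)) / 2\<rceil>) l" if "l \<ge> 1" for l
        using j that by (intro localizing) auto
      have deg: "2 * k + deg_x (g j) \<le> 2 * d" using dg_ge[OF j] k by simp
      fix q :: "real ^ 'm \<Rightarrow> real" assume "real_polynomial_function q"
      then obtain q' where "q = peval q'" using real_polynomial_function_iff_peval by blast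
      then show "0 \<le> (\<integral>y. (q y)\<^sup>2 * peval2 (g j) (\<xi> e) y \<partial>\<nu>)"
        using localized_integral_nonneg[OF \<nu>(3) e psd_j deg] by simp
    qed
    then show ?thesis by (simp add: K)
  qed
  then have "supp \<mu> \<subseteq> K" by (auto simp: supp_\<mu>)
  moreover have "atomic r \<mu>" using atomic_\<mu> E(3) rank by simp
  ultimately show ?thesis
    using representing_\<mu> representing_measure_unique by blast
qed

end
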